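(* Let $\mathcal Q$ be a quaternion division algebra with center $F$. Then the following are equivalent: (i) $\mathcal Q^*$ has no subgroup of index $2$. (ii) The group $\mathrm{CK}_1(M_2(\mathcal Q))$ is trivial. (iii) $F$ is a euclidean field and $\mathcal Q\cong \left(\frac{-1,-1}{F}\right)$.
   Context: A quaternion division algebra over a field $F$ (of any characteristic) is a division algebra with center $F$ of dimension $4$ over $F$; $\mathcal Q^*=\mathcal Q\setminus\{0\}$ is its multiplicative group. For a central simple algebra $A$ with center $F$, $\mathrm{CK}_1(A)=\mathrm{coker}(K_1(F)\to K_1(A))$, where the map is induced by the inclusion $F\hookrightarrow A$. A field $F$ is euclidean if it has an ordering with respect to which every positive element is a square. $\left(\frac{-1,-1}{F}\right)$ is the quaternion algebra over $F$ with $F$-base $\{1,\mathbf i,\mathbf j,\mathbf k\}$, $\mathbf i^2=\mathbf j^2=-1$, $\mathbf k=\mathbf i\mathbf j=-\mathbf j\mathbf i$. *)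

theory Defs
  imports
    "HOL-Algebra.QuotRing"
    "HOL-Algebra.Embedded_Algebras"
    "HOL-Algebra.Elementary_Groups"
    "HOL-Algebra.Multiplicative_Group"
begin

section \<open>Quaternion division algebras\<close>

definition ring_center :: "('a, 'm) ring_scheme \<Rightarrow> 'a set" where
  "ring_center R =
     {z \<in> carrier R. \<forall>x\<in>carrier R. z \<otimes>\<^bsub>R\<^esub> x = x \<otimes>\<^bsub>R\<^esub> z}"

abbreviation center_ring :: "('a, 'm) ring_scheme \<Rightarrow> ('a, 'm) ring_scheme" where
  "center_ring R \<equiv> R\<lparr>carrier := ring_center R\<rparr>"

locale skew_field = ring +
  assumes skew_field_Units: "Units R = carrier R - {\<zero>}"

text \<open>Here \<open>F\<close> is literally a subset of the algebra, namely its center; as a field in its own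
  right it is \<open>Q\<lparr>carrier := F\<rparr>\<close>.\<close>

definition quaternion_division_algebra :: "'a set \<Rightarrow> ('a, 'm) ring_scheme \<Rightarrow> bool" where
  "quaternion_division_algebra F Q \<longleftrightarrow>
     skew_field Q \<and> ring_center Q = F \<and> ring.dimension Q 4 F (carrier Q)"

text \<open>The quadruple \<open>(x\<^sub>0, x\<^sub>1, x\<^sub>2, x\<^sub>3)\<close> stands for
  \<open>x\<^sub>0 + x\<^sub>1 i + x\<^sub>2 j + x\<^sub>3 k\<close>. The product below is the bilinear extension of
  \<open>i\<^sup>2 = a\<close>, \<open>j\<^sup>2 = b\<close>, \<open>k = i j = - j i\<close>, whence
  \<open>k\<^sup>2 = - a b\<close>, \<open>i k = - k i = a j\<close> and \<open>j k = - k j = - b i\<close>.\<close>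

definition quaternion_algebra ::
    "'a \<Rightarrow> 'a \<Rightarrow> ('a, 'm) ring_scheme \<Rightarrow> ('a \<times> 'a \<times> 'a \<times> 'a) ring" where
  "quaternion_algebra a b F =
     \<lparr>carrier = carrier F \<times> carrier F \<times> carrier F \<times> carrier F,
      mult = (\<lambda>(x0, x1, x2, x3) (y0, y1, y2, y3).
        (x0 \<otimes>\<^bsub>F\<^esub> y0 \<oplus>\<^bsub>F\<^esub> a \<otimes>\<^bsub>F\<^esub> (x1 \<otimes>\<^bsub>F\<^esub> y1) \<oplus>\<^bsub>F\<^esub> b \<otimes>\<^bsub>F\<^esub> (x2 \<otimes>\<^bsub>F\<^esub> y2)
           \<ominus>\<^bsub>F\<^esub> a \<otimes>\<^bsub>F\<^esub> b \<otimes>\<^bsub>F\<^esub> (x3 \<otimes>\<^bsub>F\<^esub> y3),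
         x0 \<otimes>\<^bsub>F\<^esub> y1 \<oplus>\<^bsub>F\<^esub> x1 \<otimes>\<^bsub>F\<^esub> y0 \<oplus>\<^bsub>F\<^esub> b \<otimes>\<^bsub>F\<^esub> (x3 \<otimes>\<^bsub>F\<^esub> y2 \<ominus>\<^bsub>F\<^esub> x2 \<otimes>\<^bsub>F\<^esub> y3),
         x0 \<otimes>\<^bsub>F\<^esub> y2 \<oplus>\<^bsub>F\<^esub> x2 \<otimes>\<^bsub>F\<^esub> y0 \<oplus>\<^bsub>F\<^esub> a \<otimes>\<^bsub>F\<^esub> (x1 \<otimes>\<^bsub>F\<^esub> y3 \<ominus>\<^bsub>F\<^esub> x3 \<otimes>\<^bsub>F\<^esub> y1),
         x0 \<otimes>\<^bsub>F\<^esub> y3 \<oplus>\<^bsub>F\<^esub> x3 \<otimes>\<^bsub>F\<^esub> y0 \<oplus>\<^bsub>F\<^esub> x1 \<otimes>\<^bsub>F\<^esub> y2 \<ominus>\<^bsub>F\<^esub> x2 \<otimes>\<^bsub>F\<^esub> y1)),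
      one = (\<one>\<^bsub>F\<^esub>, \<zero>\<^bsub>F\<^esub>, \<zero>\<^bsub>F\<^esub>, \<zero>\<^bsub>F\<^esub>),
      zero = (\<zero>\<^bsub>F\<^esub>, \<zero>\<^bsub>F\<^esub>, \<zero>\<^bsub>F\<^esub>, \<zero>\<^bsub>F\<^esub>),
      add = (\<lambda>(x0, x1, x2, x3) (y0, y1, y2, y3).
        (x0 \<oplus>\<^bsub>F\<^esub> y0, x1 \<oplus>\<^bsub>F\<^esub> y1, x2 \<oplus>\<^bsub>F\<^esub> y2, x3 \<oplus>\<^bsub>F\<^esub> y3))\<rparr>"

text \<open>Isomorphism as \<open>F\<close>-algebras, where \<open>F\<close> is a central subfield of \<open>Q\<close>: a ring isomorphism
  that is the identity on scalars.\<close>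

definition iso_quaternion_algebra :: "'a set \<Rightarrow> ('a, 'm) ring_scheme \<Rightarrow> 'a \<Rightarrow> 'a \<Rightarrow> bool" where
  "iso_quaternion_algebra F Q a b \<longleftrightarrow>
     (\<exists>\<phi> \<in> ring_iso Q (quaternion_algebra a b (Q\<lparr>carrier := F\<rparr>)).
        \<forall>c\<in>F. \<phi> c = (c, \<zero>\<^bsub>Q\<^esub>, \<zero>\<^bsub>Q\<^esub>, \<zero>\<^bsub>Q\<^esub>))"


section \<open>Euclidean fields\<close>

text \<open>A pair \<open>(a, b) \<in> r\<close> means \<open>a \<le> b\<close>.\<close>

definition field_ordering :: "('a, 'm) ring_scheme \<Rightarrow> ('a \<times> 'a) set \<Rightarrow> bool" where
  "field_ordering F r \<longleftrightarrow>
     linear_order_on (carrier F) r \<and>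
     (\<forall>a\<in>carrier F. \<forall>b\<in>carrier F. \<forall>c\<in>carrier F.
        (a, b) \<in> r \<longrightarrow> (a \<oplus>\<^bsub>F\<^esub> c, b \<oplus>\<^bsub>F\<^esub> c) \<in> r) \<and>
     (\<forall>a\<in>carrier F. \<forall>b\<in>carrier F.
        (\<zero>\<^bsub>F\<^esub>, a) \<in> r \<longrightarrow> (\<zero>\<^bsub>F\<^esub>, b) \<in> r \<longrightarrow> (\<zero>\<^bsub>F\<^esub>, a \<otimes>\<^bsub>F\<^esub> b) \<in> r)"

definition euclidean_field :: "('a, 'm) ring_scheme \<Rightarrow> bool" where
  "euclidean_field F \<longleftrightarrow>
     field F \<and>
     (\<exists>r. field_ordering F r \<and>
        (\<forall>a\<in>carrier F. (\<zero>\<^bsub>F\<^esub>, a) \<in> r \<and> a \<noteq> \<zero>\<^bsub>F\<^esub> \<longrightarrow>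
           (\<exists>b\<in>carrier F. a = b \<otimes>\<^bsub>F\<^esub> b)))"


section \<open>Matrix rings\<close>

text \<open>An \<open>n \<times> n\<close> matrix is a function on all index pairs that is padded with zeros outside
  \<open>{..<n} \<times> {..<n}\<close>, so that equality of matrices is equality of functions.\<close>

definition matrix_ring :: "nat \<Rightarrow> ('a, 'm) ring_scheme \<Rightarrow> (nat \<Rightarrow> nat \<Rightarrow> 'a) ring" where
  "matrix_ring n R =
     \<lparr>carrier = {M. (\<forall>i j. M i j \<in> carrier R) \<and> (\<forall>i j. n \<le> i \<or> n \<le> j \<longrightarrow> M i j = \<zero>\<^bsub>R\<^esub>)},
      mult = (\<lambda>M N i j. \<Oplus>\<^bsub>R\<^esub>k\<in>{..<n}. M i k \<otimes>\<^bsub>R\<^esub> N k j),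
      one = (\<lambda>i j. if i = j \<and> i < n then \<one>\<^bsub>R\<^esub> else \<zero>\<^bsub>R\<^esub>),
      zero = (\<lambda>i j. \<zero>\<^bsub>R\<^esub>),
      add = (\<lambda>M N i j. M i j \<oplus>\<^bsub>R\<^esub> N i j)\<rparr>"


section \<open>The functor \<open>K\<^sub>1\<close> and the cokernel \<open>CK\<^sub>1\<close>\<close>

text \<open>Stable matrices are the infinite matrices that agree with the identity outside some finite
  \<open>n \<times> n\<close> block. They form the direct limit of the multiplicative monoids of \<open>n \<times> n\<close> matrices
  along \<open>M \<mapsto> diag(M, 1)\<close>, and the units of this monoid are the stable general linear group.
  Rows of a stable matrix have finite support, so the sum defining the product is finite.\<close>

definition stable_matrix_monoid :: "('a, 'm) ring_scheme \<Rightarrow> (nat \<Rightarrow> nat \<Rightarrow> 'a) monoid" where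
  "stable_matrix_monoid R =
     \<lparr>carrier = {M. (\<forall>i j. M i j \<in> carrier R) \<and>
        (\<exists>n. \<forall>i j. n \<le> i \<or> n \<le> j \<longrightarrow> M i j = (if i = j then \<one>\<^bsub>R\<^esub> else \<zero>\<^bsub>R\<^esub>))},
      mult = (\<lambda>M N i j. \<Oplus>\<^bsub>R\<^esub>k\<in>{k. M i k \<noteq> \<zero>\<^bsub>R\<^esub>}. M i k \<otimes>\<^bsub>R\<^esub> N k j),
      one = (\<lambda>i j. if i = j then \<one>\<^bsub>R\<^esub> else \<zero>\<^bsub>R\<^esub>)\<rparr>"

definition stable_GL :: "('a, 'm) ring_scheme \<Rightarrow> (nat \<Rightarrow> nat \<Rightarrow> 'a) monoid" where
  "stable_GL R = units_of (stable_matrix_monoid R)"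

abbreviation GL_commutators :: "('a, 'm) ring_scheme \<Rightarrow> (nat \<Rightarrow> nat \<Rightarrow> 'a) set" where
  "GL_commutators R \<equiv> derived (stable_GL R) (carrier (stable_GL R))"

definition K1 :: "('a, 'm) ring_scheme \<Rightarrow> (nat \<Rightarrow> nat \<Rightarrow> 'a) set monoid" where
  "K1 R = stable_GL R Mod GL_commutators R"

text \<open>The map \<open>K\<^sub>1(R) \<rightarrow> K\<^sub>1(S)\<close> induced by a unital ring homomorphism \<open>f\<close>: the class of \<open>M\<close> goes
  to the class of \<open>f(M)\<close>. The union is over all representatives of the class and consists of a
  single coset.\<close>

definition K1_map ::
    "('b, 'n) ring_scheme \<Rightarrow> ('a \<Rightarrow> 'b) \<Rightarrow> (nat \<Rightarrow> nat \<Rightarrow> 'a) set \<Rightarrow> (nat \<Rightarrow> nat \<Rightarrow> 'b) set" where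
  "K1_map S f X = (\<Union>M\<in>X. GL_commutators S #>\<^bsub>stable_GL S\<^esub> (\<lambda>i j. f (M i j)))"

text \<open>For a central simple algebra \<open>A\<close> with center \<open>F\<close>, the inclusion of \<open>F\<close> into \<open>A\<close> is the
  identity function on \<open>ring_center A\<close>.\<close>

definition CK1 :: "('a, 'm) ring_scheme \<Rightarrow> (nat \<Rightarrow> nat \<Rightarrow> 'a) set set monoid" where
  "CK1 A = K1 A Mod (K1_map A (\<lambda>x. x) ` carrier (K1 (center_ring A)))"

end

theory Submission
  imports Defs "HOL-Library.Z2"
begin

text \<open>
  Write \<open>Q\<^sup>*'\<close> for the commutator subgroup of \<open>Q\<^sup>*\<close>. All three conditions are compared with
  the single equation \<open>Q\<^sup>* = F\<^sup>*\<^sup>2 Q\<^sup>*'\<close>.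

  \<^item> If \<open>Q\<^sup>*\<close> has no subgroup of index two, then by Zorn's lemma every subgroup that contains all
    squares is \<open>Q\<^sup>*\<close> itself (\<open>exists_index_two\<close>). The conjugate \<open>t - a\<close> of an element \<open>a\<close> with
    \<open>a\<^sup>2 = t a - n\<close> is conjugate to \<open>a\<close> in the group \<open>Q\<^sup>*\<close>, so \<open>a\<^sup>2\<close> equals the norm
    \<open>n = a (t - a)\<close> up to a commutator. Hence \<open>F\<^sup>* Q\<^sup>*'\<close> contains all squares and is \<open>Q\<^sup>*\<close>;
    but then \<open>F\<^sup>*\<^sup>2 Q\<^sup>*'\<close> contains all squares as well
    (\<open>central_squares_if_no_index_two\<close>).

  \<^item> Gaussian elimination shows that a stable invertible matrix over a skew field is a product
    of commutators and a matrix \<open>diag(a, 1, 1, \<dots>)\<close>. A scalar \<open>f\<close> in \<open>M\<^sub>2(Q)\<close> becomes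
    \<open>diag(f, f)\<close> over \<open>Q\<close>, which is \<open>diag(f\<^sup>2, 1)\<close> up to commutators. Therefore \<open>CK\<^sub>1(M\<^sub>2(Q))\<close>
    is trivial if \<open>Q\<^sup>* = F\<^sup>*\<^sup>2 Q\<^sup>*'\<close> (\<open>trivial_CK1_if_central_squares\<close>).

  \<^item> A subgroup \<open>H\<close> of index two is the kernel of a character of \<open>Q\<^sup>*\<close> of order two. The
    Dieudonne determinant extends it to the stable general linear group of \<open>Q\<close>, where it vanishes
    on \<open>diag(f, f)\<close> and is nontrivial on \<open>diag(a, 1)\<close> for \<open>a \<notin> H\<close>. So \<open>CK\<^sub>1(M\<^sub>2(Q))\<close> is not
    trivial (\<open>character_trivial_if_trivial_CK1\<close>). The determinant is constructed by Artin's
    recursion on the size of the matrix.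

  \<^item> If \<open>Q\<^sup>* = F\<^sup>*\<^sup>2 Q\<^sup>*'\<close>, then the reduced norm, being multiplicative and equal to \<open>c\<^sup>2\<close> on
    \<open>c \<in> F\<close>, takes only fourth powers as values on \<open>Q\<^sup>*\<close>. Applied to \<open>F\<close> itself this says that
    every element of \<open>F\<close> is a square up to sign; applied to elements of reduced trace zero it
    provides \<open>i\<close> and \<open>j\<close> with \<open>i\<^sup>2 = j\<^sup>2 = -1\<close> and \<open>i j = - j i\<close>; applied to \<open>a + b i\<close> it says
    that sums of two squares are squares and vanish only trivially. Thus the squares order \<open>F\<close>
    (\<open>hamilton_units\<close>, \<open>euclidean_field_iff\<close>, \<open>iso_hamilton\<close>).

  \<^item> Over a euclidean field every Hamilton quaternion is a square (\<open>hamilton_square\<close>), while the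
    square of anything lies in each subgroup of index two.\<close>

section \<open>Stable matrices\<close>

definition stable_from :: "('a, 'm) ring_scheme \<Rightarrow> nat \<Rightarrow> (nat \<Rightarrow> nat \<Rightarrow> 'a) \<Rightarrow> bool" where
  "stable_from R n M \<longleftrightarrow> (\<forall>i j. M i j \<in> carrier R) \<and>
     (\<forall>i j. n \<le> i \<or> n \<le> j \<longrightarrow> M i j = (if i = j then \<one>\<^bsub>R\<^esub> else \<zero>\<^bsub>R\<^esub>))"

abbreviation SM :: "('a, 'm) ring_scheme \<Rightarrow> (nat \<Rightarrow> nat \<Rightarrow> 'a) monoid" where
  "SM \<equiv> stable_matrix_monoid"

lemma carrier_SM: "M \<in> carrier (SM R) \<longleftrightarrow> (\<exists>n. stable_from R n M)"
  by (auto simp: stable_matrix_monoid_def stable_from_def)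

lemma stable_from_entry: "stable_from R n M \<Longrightarrow> M i j \<in> carrier R"
  by (simp add: stable_from_def)

lemma SM_entry: "M \<in> carrier (SM R) \<Longrightarrow> M i j \<in> carrier R"
  by (auto simp: carrier_SM stable_from_def)

lemma stable_from_mono: "stable_from R n M \<Longrightarrow> n \<le> m \<Longrightarrow> stable_from R m M"
  by (auto simp: stable_from_def)

lemma one_SM: "\<one>\<^bsub>SM R\<^esub> = (\<lambda>i j. if i = j then \<one>\<^bsub>R\<^esub> else \<zero>\<^bsub>R\<^esub>)"
  by (simp add: stable_matrix_monoid_def)

context ring
begin

lemma finsum_eq_single:
  assumes "finite A" "a \<in> A" "\<And>x. x \<in> A \<Longrightarrow> x \<noteq> a \<Longrightarrow> f x = \<zero>" "f a \<in> carrier R"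
  shows "finsum R f A = f a"
proof -
  have "f x \<in> carrier R" if "x \<in> A" for x using assms that by (cases "x = a") auto
  then have "finsum R f A = finsum R f {a}"
    by (intro add.finprod_mono_neutral_cong_right) (use assms in auto)
  then show ?thesis using assms(4) by simp
qed

lemma finsum_swap:
  assumes "finite A" "finite B" "\<And>a b. f a b \<in> carrier R"
  shows "(\<Oplus>a\<in>A. \<Oplus>b\<in>B. f a b) = (\<Oplus>b\<in>B. \<Oplus>a\<in>A. f a b)"
  using assms(1)
proof (induction A)
  case empty then show ?case by simp
next
  case (insert x A)
  have "(\<Oplus>a\<in>insert x A. \<Oplus>b\<in>B. f a b) = (\<Oplus>b\<in>B. f x b) \<oplus> (\<Oplus>b\<in>B. \<Oplus>a\<in>A. f a b)"
    using insert assms(3) by (simp add: Pi_def)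
  also have "\<dots> = (\<Oplus>b\<in>B. f x b \<oplus> (\<Oplus>a\<in>A. f a b))"
    using assms(3) by (simp add: finsum_addf Pi_def)
  also have "\<dots> = (\<Oplus>b\<in>B. \<Oplus>a\<in>insert x A. f a b)"
    by (rule add.finprod_cong') (use insert assms(3) in \<open>auto simp: Pi_def\<close>)
  finally show ?case .
qed

text \<open>The product sums over the support of a row, which varies with the row; any common bound on the
  supports may be used instead.\<close>

lemma SM_mult_eq:
  assumes "\<And>i j. M i j \<in> carrier R" "\<And>i j. N i j \<in> carrier R"
    and "\<And>k. m \<le> k \<Longrightarrow> M i k = \<zero>"
  shows "(M \<otimes>\<^bsub>SM R\<^esub> N) i j = (\<Oplus>k\<in>{..<m}. M i k \<otimes> N k j)"
proof -
  have "(M \<otimes>\<^bsub>SM R\<^esub> N) i j = (\<Oplus>k\<in>{k. M i k \<noteq> \<zero>}. M i k \<otimes> N k j)"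
    by (simp add: stable_matrix_monoid_def)
  also have "\<dots> = (\<Oplus>k\<in>{..<m}. M i k \<otimes> N k j)"
  proof (rule add.finprod_mono_neutral_cong_left)
    show "{k. M i k \<noteq> \<zero>} \<subseteq> {..<m}" using assms(3) by (auto simp: not_less[symmetric])
  qed (use assms in auto)
  finally show ?thesis .
qed

lemma stable_from_row_zero: "stable_from R n M \<Longrightarrow> n \<le> k \<Longrightarrow> i < k \<Longrightarrow> M i k = \<zero>"
  by (auto simp: stable_from_def)

lemma stable_from_mult:
  assumes M: "stable_from R n M" and N: "stable_from R n N"
  shows "stable_from R n (M \<otimes>\<^bsub>SM R\<^esub> N)"
proof -
  have eM: "M i j \<in> carrier R" and eN: "N i j \<in> carrier R" for i j
    using M N by (auto simp: stable_from_def)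
  have eq: "(M \<otimes>\<^bsub>SM R\<^esub> N) i j = (\<Oplus>k\<in>{..<Suc (n + i)}. M i k \<otimes> N k j)" for i j
    by (rule SM_mult_eq) (use eM eN stable_from_row_zero[OF M] in auto)
  have "(M \<otimes>\<^bsub>SM R\<^esub> N) i j = (if i = j then \<one> else \<zero>)" if "n \<le> i \<or> n \<le> j" for i j
  proof (cases "n \<le> i")
    case True
    have "(\<Oplus>k\<in>{..<Suc (n + i)}. M i k \<otimes> N k j) = M i i \<otimes> N i j"
      by (rule finsum_eq_single) (use M True eM eN in \<open>auto simp: stable_from_def\<close>)
    then show ?thesis using M N True eM eN by (simp add: eq stable_from_def)
  next
    case False
    have "(\<Oplus>k\<in>{..<Suc (n + i)}. M i k \<otimes> N k j) = \<zero>"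
      by (rule add.finprod_one_eqI) (use M N eM eN False that in \<open>auto simp: stable_from_def\<close>)
    then show ?thesis using False that by (simp add: eq)
  qed
  moreover have "(M \<otimes>\<^bsub>SM R\<^esub> N) i j \<in> carrier R" for i j
    using eM eN by (simp add: eq Pi_def del: finsum_Suc)
  ultimately show ?thesis by (simp add: stable_from_def)
qed

lemma SM_monoid: "monoid (SM R)"
proof (rule monoidI)
  fix M N assume "M \<in> carrier (SM R)" "N \<in> carrier (SM R)"
  then obtain a b where "stable_from R a M" "stable_from R b N" by (auto simp: carrier_SM)
  then have "stable_from R (max a b) M" "stable_from R (max a b) N"
    by (auto elim: stable_from_mono)
  then show "M \<otimes>\<^bsub>SM R\<^esub> N \<in> carrier (SM R)" using stable_from_mult carrier_SM by blast
next
  show "\<one>\<^bsub>SM R\<^esub> \<in> carrier (SM R)" by (auto simp: carrier_SM one_SM stable_from_def)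
next
  fix M N P assume "M \<in> carrier (SM R)" "N \<in> carrier (SM R)" "P \<in> carrier (SM R)"
  then obtain a b c where "stable_from R a M" "stable_from R b N" "stable_from R c P"
    by (auto simp: carrier_SM)
  define n where "n = max a (max b c)"
  have M: "stable_from R n M" and N: "stable_from R n N" and P: "stable_from R n P"
    using \<open>stable_from R a M\<close> \<open>stable_from R b N\<close> \<open>stable_from R c P\<close>
    by (auto simp: n_def elim: stable_from_mono)
  note MN = stable_from_mult[OF M N] and NP = stable_from_mult[OF N P]
  note e[simp] = stable_from_entry[OF M] stable_from_entry[OF N] stable_from_entry[OF P]
    stable_from_entry[OF MN] stable_from_entry[OF NP]
  show "(M \<otimes>\<^bsub>SM R\<^esub> N) \<otimes>\<^bsub>SM R\<^esub> P = M \<otimes>\<^bsub>SM R\<^esub> (N \<otimes>\<^bsub>SM R\<^esub> P)"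
  proof (intro ext)
    fix i j
    define m where "m = Suc (n + i)"
    have eq: "(A \<otimes>\<^bsub>SM R\<^esub> B) k j = (\<Oplus>l\<in>{..<m}. A k l \<otimes> B l j)"
      if "stable_from R n A" "stable_from R n B" "k < m" for A B k j
      by (rule SM_mult_eq) (use that stable_from_row_zero[OF that(1)] stable_from_entry
          in \<open>auto simp: m_def\<close>)
    have "((M \<otimes>\<^bsub>SM R\<^esub> N) \<otimes>\<^bsub>SM R\<^esub> P) i j = (\<Oplus>l\<in>{..<m}. (M \<otimes>\<^bsub>SM R\<^esub> N) i l \<otimes> P l j)"
      by (rule eq[OF MN P]) (simp add: m_def)
    also have "\<dots> = (\<Oplus>l\<in>{..<m}. \<Oplus>k\<in>{..<m}. M i k \<otimes> N k l \<otimes> P l j)"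
      by (rule add.finprod_cong') (auto simp: eq[OF M N] m_def finsum_ldistr Pi_def simp del: finsum_Suc)
    also have "\<dots> = (\<Oplus>k\<in>{..<m}. \<Oplus>l\<in>{..<m}. M i k \<otimes> N k l \<otimes> P l j)"
      by (rule finsum_swap) auto
    also have "\<dots> = (\<Oplus>k\<in>{..<m}. M i k \<otimes> (N \<otimes>\<^bsub>SM R\<^esub> P) k j)"
      by (rule add.finprod_cong') (auto simp: eq[OF N P] finsum_rdistr Pi_def m_assoc simp del: finsum_Suc)
    also have "\<dots> = (M \<otimes>\<^bsub>SM R\<^esub> (N \<otimes>\<^bsub>SM R\<^esub> P)) i j"
      by (rule eq[OF M NP, symmetric]) (simp add: m_def)
    finally show "((M \<otimes>\<^bsub>SM R\<^esub> N) \<otimes>\<^bsub>SM R\<^esub> P) i j = (M \<otimes>\<^bsub>SM R\<^esub> (N \<otimes>\<^bsub>SM R\<^esub> P)) i j" .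
  qed
next
  fix M assume "M \<in> carrier (SM R)"
  then obtain n where M: "stable_from R n M" by (auto simp: carrier_SM)
  note e[simp] = stable_from_entry[OF M]
  have o: "\<one>\<^bsub>SM R\<^esub> i j \<in> carrier R" for i j by (simp add: one_SM)
  show "\<one>\<^bsub>SM R\<^esub> \<otimes>\<^bsub>SM R\<^esub> M = M"
  proof (intro ext)
    fix i j
    have "(\<one>\<^bsub>SM R\<^esub> \<otimes>\<^bsub>SM R\<^esub> M) i j = (\<Oplus>k\<in>{..<Suc i}. \<one>\<^bsub>SM R\<^esub> i k \<otimes> M k j)"
      by (rule SM_mult_eq) (auto simp: one_SM)
    also have "\<dots> = \<one>\<^bsub>SM R\<^esub> i i \<otimes> M i j"
      by (rule finsum_eq_single) (auto simp: one_SM)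
    finally show "(\<one>\<^bsub>SM R\<^esub> \<otimes>\<^bsub>SM R\<^esub> M) i j = M i j" by (simp add: one_SM)
  qed
  show "M \<otimes>\<^bsub>SM R\<^esub> \<one>\<^bsub>SM R\<^esub> = M"
  proof (intro ext)
    fix i j
    have "(M \<otimes>\<^bsub>SM R\<^esub> \<one>\<^bsub>SM R\<^esub>) i j = (\<Oplus>k\<in>{..<Suc (n + i + j)}. M i k \<otimes> \<one>\<^bsub>SM R\<^esub> k j)"
      by (rule SM_mult_eq) (use stable_from_row_zero[OF M] in \<open>auto simp: one_SM\<close>)
    also have "\<dots> = M i j \<otimes> \<one>\<^bsub>SM R\<^esub> j j"
      by (rule finsum_eq_single) (auto simp: one_SM)
    finally show "(M \<otimes>\<^bsub>SM R\<^esub> \<one>\<^bsub>SM R\<^esub>) i j = M i j" by (simp add: one_SM)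
  qed
qed

lemma GL_group: "group (stable_GL R)"
  unfolding stable_GL_def by (rule monoid.units_group[OF SM_monoid])

lemma GL_carrier_iff:
  "M \<in> carrier (stable_GL R) \<longleftrightarrow> M \<in> carrier (SM R) \<and>
     (\<exists>N\<in>carrier (SM R). N \<otimes>\<^bsub>SM R\<^esub> M = \<one>\<^bsub>SM R\<^esub> \<and> M \<otimes>\<^bsub>SM R\<^esub> N = \<one>\<^bsub>SM R\<^esub>)"
  by (auto simp: stable_GL_def units_of_def Units_def)

lemma GL_entry: "M \<in> carrier (stable_GL R) \<Longrightarrow> M i j \<in> carrier R"
  using SM_entry unfolding GL_carrier_iff by blast

lemma GL_mult: "mult (stable_GL R) = mult (SM R)" and GL_one: "one (stable_GL R) = one (SM R)"
  by (simp_all add: stable_GL_def units_of_def)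

section \<open>Row operations\<close>

text \<open>Left multiplication by these matrices is a row operation; besides additions of rows, elimination
  needs scalings in row 0 only.\<close>

definition transvection :: "nat \<Rightarrow> nat \<Rightarrow> 'a \<Rightarrow> nat \<Rightarrow> nat \<Rightarrow> 'a" where
  "transvection i j c = (\<lambda>k l. if k = l then \<one> else if k = i \<and> l = j then c else \<zero>)"

definition corner :: "'a \<Rightarrow> nat \<Rightarrow> nat \<Rightarrow> 'a" where
  "corner a = (\<lambda>k l. if k = l then if k = 0 then a else \<one> else \<zero>)"

definition add_row :: "nat \<Rightarrow> nat \<Rightarrow> 'a \<Rightarrow> (nat \<Rightarrow> nat \<Rightarrow> 'a) \<Rightarrow> nat \<Rightarrow> nat \<Rightarrow> 'a" where
  "add_row i j c M = M(i := \<lambda>l. M i l \<oplus> c \<otimes> M j l)"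

definition scale_row :: "nat \<Rightarrow> 'a \<Rightarrow> (nat \<Rightarrow> nat \<Rightarrow> 'a) \<Rightarrow> nat \<Rightarrow> nat \<Rightarrow> 'a" where
  "scale_row i a M = M(i := \<lambda>l. a \<otimes> M i l)"

lemma transvection_stable: "c \<in> carrier R \<Longrightarrow> stable_from R (Suc (max i j)) (transvection i j c)"
  by (auto simp: stable_from_def transvection_def)

lemma corner_stable: "a \<in> carrier R \<Longrightarrow> stable_from R 1 (corner a)"
  by (auto simp: stable_from_def corner_def)

lemma transvection_SM: "c \<in> carrier R \<Longrightarrow> transvection i j c \<in> carrier (SM R)"
  using transvection_stable carrier_SM by blast

lemma corner_SM: "a \<in> carrier R \<Longrightarrow> corner a \<in> carrier (SM R)"
  using corner_stable carrier_SM by blast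

lemma transvection_mult:
  assumes "c \<in> carrier R" "i \<noteq> j" and M: "\<And>i j. M i j \<in> carrier R"
  shows "transvection i j c \<otimes>\<^bsub>SM R\<^esub> M = add_row i j c M"
proof (intro ext)
  fix k l
  have T: "transvection i j c p q \<in> carrier R" for p q using assms by (simp add: transvection_def)
  have eq: "(transvection i j c \<otimes>\<^bsub>SM R\<^esub> M) k l
      = (\<Oplus>p\<in>{..<Suc (max k j)}. transvection i j c k p \<otimes> M p l)"
    by (rule SM_mult_eq) (use T M in \<open>auto simp: transvection_def\<close>)
  show "(transvection i j c \<otimes>\<^bsub>SM R\<^esub> M) k l = add_row i j c M k l"
  proof (cases "k = i")
    case True
    have "(\<Oplus>p\<in>{..<Suc (max k j)}. transvection i j c k p \<otimes> M p l)
        = (\<Oplus>p\<in>{i, j}. transvection i j c k p \<otimes> M p l)"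
      by (rule add.finprod_mono_neutral_cong_right) (use assms True in \<open>auto simp: transvection_def\<close>)
    also have "\<dots> = M i l \<oplus> c \<otimes> M j l" using assms True by (simp add: transvection_def)
    finally show ?thesis using True unfolding eq by (simp add: add_row_def)
  next
    case False
    have "(\<Oplus>p\<in>{..<Suc (max k j)}. transvection i j c k p \<otimes> M p l)
        = transvection i j c k k \<otimes> M k l"
      by (rule finsum_eq_single) (use False M T in \<open>auto simp: transvection_def\<close>)
    then show ?thesis using False M unfolding eq by (simp add: add_row_def transvection_def)
  qed
qed

lemma corner_mult:
  assumes "a \<in> carrier R" and M: "\<And>i j. M i j \<in> carrier R"
  shows "corner a \<otimes>\<^bsub>SM R\<^esub> M = scale_row 0 a M"
proof (intro ext)
  fix k l
  have T: "corner a p q \<in> carrier R" for p q using assms by (simp add: corner_def)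
  have "(corner a \<otimes>\<^bsub>SM R\<^esub> M) k l = (\<Oplus>p\<in>{..<Suc k}. corner a k p \<otimes> M p l)"
    by (rule SM_mult_eq) (use T M in \<open>auto simp: corner_def\<close>)
  also have "\<dots> = corner a k k \<otimes> M k l"
    by (rule finsum_eq_single) (use M T assms(1) in \<open>auto simp: corner_def\<close>)
  finally show "(corner a \<otimes>\<^bsub>SM R\<^esub> M) k l = scale_row 0 a M k l"
    using assms by (simp add: corner_def scale_row_def)
qed

lemma add_row_closed:
  "c \<in> carrier R \<Longrightarrow> (\<And>i j. M i j \<in> carrier R) \<Longrightarrow> add_row i j c M k l \<in> carrier R"
  by (simp add: add_row_def)

lemma add_row_cancel:
  assumes "c \<in> carrier R" "i \<noteq> j" "\<And>i j. M i j \<in> carrier R"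
  shows "add_row i j (\<ominus> c) (add_row i j c M) = M"
proof (intro ext)
  fix k l
  show "add_row i j (\<ominus> c) (add_row i j c M) k l = M k l"
    using assms by (auto simp: add_row_def a_assoc l_minus r_neg)
qed

lemma transvection_one: 
  assumes "c \<in> carrier R" "i \<noteq> j"
  shows "transvection i j c = add_row i j c \<one>\<^bsub>SM R\<^esub>"
  using assms by (auto simp: fun_eq_iff transvection_def add_row_def one_SM)

lemma transvection_inv:
  assumes "c \<in> carrier R" "i \<noteq> j"
  shows "transvection i j (\<ominus> c) \<otimes>\<^bsub>SM R\<^esub> transvection i j c = \<one>\<^bsub>SM R\<^esub>"
    "transvection i j c \<otimes>\<^bsub>SM R\<^esub> transvection i j (\<ominus> c) = \<one>\<^bsub>SM R\<^esub>"
proof -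
  have o: "\<one>\<^bsub>SM R\<^esub> i j \<in> carrier R" for i j by (simp add: one_SM)
  have t: "transvection i j c p q \<in> carrier R" if "c \<in> carrier R" for c p q
    using that by (simp add: transvection_def)
  have "transvection i j (\<ominus> c) \<otimes>\<^bsub>SM R\<^esub> transvection i j c = \<one>\<^bsub>SM R\<^esub>"
    if "c \<in> carrier R" for c
  proof -
    have "transvection i j (\<ominus> c) \<otimes>\<^bsub>SM R\<^esub> transvection i j c
        = add_row i j (\<ominus> c) (transvection i j c)"
      by (rule transvection_mult) (use that assms t in auto)
    also have "\<dots> = \<one>\<^bsub>SM R\<^esub>"
      unfolding transvection_one[OF that assms(2)]
      by (rule add_row_cancel) (use that assms o in auto)
    finally show ?thesis .
  qed
  from this[OF assms(1)] this[of "\<ominus> c"] assms(1)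
  show "transvection i j (\<ominus> c) \<otimes>\<^bsub>SM R\<^esub> transvection i j c = \<one>\<^bsub>SM R\<^esub>"
    "transvection i j c \<otimes>\<^bsub>SM R\<^esub> transvection i j (\<ominus> c) = \<one>\<^bsub>SM R\<^esub>" by simp_all
qed

lemma transvection_GL:
  assumes "c \<in> carrier R" "i \<noteq> j" shows "transvection i j c \<in> carrier (stable_GL R)"
  using transvection_inv[OF assms] transvection_SM assms(1) unfolding GL_carrier_iff by blast

lemma corner_corner:
  assumes "a \<in> carrier R" "b \<in> carrier R"
  shows "corner a \<otimes>\<^bsub>SM R\<^esub> corner b = corner (a \<otimes> b)"
  using assms by (subst corner_mult) (auto simp: corner_def scale_row_def fun_eq_iff)

lemma corner_one: "corner \<one> = \<one>\<^bsub>SM R\<^esub>"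
  by (auto simp: corner_def one_SM)

lemma corner_GL:
  assumes "a \<in> Units R" shows "corner a \<in> carrier (stable_GL R)"
proof -
  obtain b where "b \<in> carrier R" "a \<otimes> b = \<one>" "b \<otimes> a = \<one>" "a \<in> carrier R"
    using assms by (auto simp: Units_def)
  then show ?thesis unfolding GL_carrier_iff using corner_corner corner_one corner_SM by metis
qed

text \<open>Stability provides a third index \<open>k\<close>: \<open>e\<^sub>i\<^sub>j(c) = [e\<^sub>i\<^sub>k(c), e\<^sub>k\<^sub>j(1)]\<close>.\<close>

lemma transvection_commutator:
  assumes c: "c \<in> carrier R" and "i \<noteq> j"
  shows "transvection i j c \<in> GL_commutators R"
proof -
  define k where "k = Suc (max i j)"
  have k: "k \<noteq> i" "k \<noteq> j" "i \<noteq> k" "j \<noteq> k" by (auto simp: k_def)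
  let ?G = "stable_GL R"
  let ?a = "transvection i k c" and ?b = "transvection k j \<one>"
  interpret G: group ?G by (rule GL_group)
  have a: "?a \<in> carrier ?G" and b: "?b \<in> carrier ?G" and
    a': "transvection i k (\<ominus> c) \<in> carrier ?G" and b': "transvection k j (\<ominus> \<one>) \<in> carrier ?G"
    using transvection_GL c k by auto
  have ia: "inv\<^bsub>?G\<^esub> ?a = transvection i k (\<ominus> c)"
    by (rule G.inv_equality[OF _ a a']) (use transvection_inv[OF c k(3)] in \<open>simp add: GL_mult GL_one\<close>)
  have ib: "inv\<^bsub>?G\<^esub> ?b = transvection k j (\<ominus> \<one>)"
    by (rule G.inv_equality[OF _ b b'])
      (use transvection_inv[OF one_closed k(2)] in \<open>simp add: GL_mult GL_one\<close>)
  have o: "\<one>\<^bsub>SM R\<^esub> i j \<in> carrier R" for i j by (simp add: one_SM)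
  note cl = add_row_closed o
  have "?a \<otimes>\<^bsub>?G\<^esub> ?b \<otimes>\<^bsub>?G\<^esub> inv\<^bsub>?G\<^esub> ?a \<otimes>\<^bsub>?G\<^esub> inv\<^bsub>?G\<^esub> ?b
      = ?a \<otimes>\<^bsub>?G\<^esub> (?b \<otimes>\<^bsub>?G\<^esub> (inv\<^bsub>?G\<^esub> ?a \<otimes>\<^bsub>?G\<^esub> inv\<^bsub>?G\<^esub> ?b))"
    using a b by (simp add: G.m_assoc)
  also have "inv\<^bsub>?G\<^esub> ?b = add_row k j (\<ominus> \<one>) \<one>\<^bsub>SM R\<^esub>"
    using ib transvection_one[of "\<ominus> \<one>" k j] k by simp
  also have "?a \<otimes>\<^bsub>?G\<^esub> (?b \<otimes>\<^bsub>?G\<^esub> (inv\<^bsub>?G\<^esub> ?a \<otimes>\<^bsub>?G\<^esub> \<dots>))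
     = add_row i k c (add_row k j \<one> (add_row i k (\<ominus> c) (add_row k j (\<ominus> \<one>) \<one>\<^bsub>SM R\<^esub>)))"
    unfolding ia GL_mult using c k cl by (simp add: transvection_mult)
  also have "\<dots> = transvection i j c"
    using c k \<open>i \<noteq> j\<close>
    by (auto simp: fun_eq_iff add_row_def transvection_def one_SM l_minus r_neg l_neg minus_equality a_assoc r_minus)
  finally have *: "transvection i j c = ?a \<otimes>\<^bsub>?G\<^esub> ?b \<otimes>\<^bsub>?G\<^esub> inv\<^bsub>?G\<^esub> ?a \<otimes>\<^bsub>?G\<^esub> inv\<^bsub>?G\<^esub> ?b"
    unfolding ib using transvection_one[of "\<ominus> \<one>" k j] k by simp
  show ?thesis unfolding derived_def by (rule generate.incl) (use * a b in blast)
qed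

end

section \<open>Gaussian elimination over a skew field\<close>

context skew_field
begin

lemma inv_skew:
  assumes "a \<in> carrier R" "a \<noteq> \<zero>"
  shows "a \<in> Units R" "inv a \<in> carrier R" "inv a \<otimes> a = \<one>" "a \<otimes> inv a = \<one>" "inv a \<noteq> \<zero>"
proof -
  show u: "a \<in> Units R" using assms skew_field_Units by simp
  then show "inv a \<in> carrier R" "inv a \<otimes> a = \<one>" "a \<otimes> inv a = \<one>" by simp_all
  show "inv a \<noteq> \<zero>" using Units_inv_Units[OF u] skew_field_Units by simp
qed

lemma one_neq_zero: "\<one> \<noteq> \<zero>"
  using Units_one_closed skew_field_Units by auto

lemma skew_integral:
  assumes "a \<in> carrier R" "b \<in> carrier R" "a \<otimes> b = \<zero>" shows "a = \<zero> \<or> b = \<zero>"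
proof (rule ccontr)
  assume "\<not> ?thesis"
  then have "a \<in> Units R" "b \<noteq> \<zero>" using assms inv_skew by auto
  then have "inv a \<otimes> a \<otimes> b = inv a \<otimes> (a \<otimes> b)" using assms by (intro m_assoc) auto
  then show False using assms \<open>b \<noteq> \<zero>\<close> \<open>a \<in> Units R\<close> by simp
qed

lemma mult_nonzero:
  "a \<in> carrier R \<Longrightarrow> b \<in> carrier R \<Longrightarrow> a \<noteq> \<zero> \<Longrightarrow> b \<noteq> \<zero> \<Longrightarrow> a \<otimes> b \<noteq> \<zero>"
  using skew_integral by blast

text \<open>The columns are cleared from right to left: with the columns beyond the \<open>n\<close>-th already
  those of the identity, invertibility forces a pivot in column \<open>n\<close> at some row \<open>i \<le> n\<close>, and
  adding multiples of the rows up to \<open>n\<close> does not disturb the columns that are done. Hence row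
  operations alone reduce to the identity; a scaling is needed only in row 0, where there is no
  other row from which the pivot could be normalised.\<close>

lemma GL_induct [consumes 1, case_names one add scale]:
  assumes M: "M \<in> carrier (stable_GL R)"
    and one: "P \<one>\<^bsub>SM R\<^esub>"
    and add: "\<And>M i j c. M \<in> carrier (stable_GL R) \<Longrightarrow> P M \<Longrightarrow> i \<noteq> j \<Longrightarrow> c \<in> carrier R \<Longrightarrow>
      P (transvection i j c \<otimes>\<^bsub>SM R\<^esub> M)"
    and scale: "\<And>M a. M \<in> carrier (stable_GL R) \<Longrightarrow> P M \<Longrightarrow> a \<in> Units R \<Longrightarrow>
      P (corner a \<otimes>\<^bsub>SM R\<^esub> M)"
  shows "P M"
proof -
  let ?G = "stable_GL R"
  interpret G: group ?G by (rule GL_group)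
  have entry: "M i j \<in> carrier R" if "M \<in> carrier ?G" for M i j
    using that SM_entry unfolding GL_carrier_iff by blast
  have add_GL: "add_row i j c M \<in> carrier ?G" if "M \<in> carrier ?G" "i \<noteq> j" "c \<in> carrier R" for M i j c
    using G.m_closed[OF transvection_GL[OF that(3,2)] that(1)] transvection_mult[OF that(3,2)]
      entry[OF that(1)] by (simp add: GL_mult)
  have un_add: "P M" if "M \<in> carrier ?G" "i \<noteq> j" "c \<in> carrier R" "P (add_row i j c M)" for M i j c
  proof -
    have "P (transvection i j (\<ominus> c) \<otimes>\<^bsub>SM R\<^esub> add_row i j c M)"
      using that by (intro add add_GL) auto
    also have "transvection i j (\<ominus> c) \<otimes>\<^bsub>SM R\<^esub> add_row i j c M = M"
      using that entry[OF that(1)] entry[OF add_GL[OF that(1-3)]]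
      by (simp add: transvection_mult add_row_cancel)
    finally show ?thesis .
  qed
  define clear where "clear n M \<longleftrightarrow> (\<forall>k. \<forall>l\<ge>n. M k l = (if k = l then \<one> else \<zero>))"
    for n :: nat and M :: "nat \<Rightarrow> nat \<Rightarrow> 'a"
  have clear_add: "clear (Suc n) (add_row i j c M)"
    if "M \<in> carrier ?G" "c \<in> carrier R" "clear (Suc n) M" "j \<le> n" for n i j c M
    using that by (auto simp: clear_def add_row_def)
  have "P M" if "M \<in> carrier ?G" "clear n M" for n M
    using that
  proof (induction n arbitrary: M)
    case 0
    then have "M = \<one>\<^bsub>SM R\<^esub>" by (auto simp: clear_def one_SM fun_eq_iff)
    then show ?case using one by simp
  next
    case (Suc n)
    have pivot1: "P M" if "M \<in> carrier ?G" "clear (Suc n) M" "M n n = \<one>" for M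
    proof -
      note prems = that
      obtain m where m: "stable_from R m M" using prems(1) by (auto simp: GL_carrier_iff carrier_SM)
      have "{k. k \<noteq> n \<and> M k n \<noteq> \<zero>} \<subseteq> {..<m}" using m
        by (auto simp: stable_from_def not_less[symmetric] split: if_splits)
      moreover have "finite {..<m}" by simp
      ultimately obtain S where "finite S" "{k. k \<noteq> n \<and> M k n \<noteq> \<zero>} \<subseteq> S" by blast
      then show ?thesis using that
      proof (induction S arbitrary: M)
        case empty
        have "M k l = (if k = l then \<one> else \<zero>)" if "n \<le> l" for k l
          using empty that by (cases "l = n") (auto simp: clear_def)
        then have "clear n M" by (simp add: clear_def)
        then show ?case using Suc.IH empty by blast
      next
        case (insert x S)
        show ?case
        proof (cases "x = n")
          case True
          then show ?thesis using insert by blast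
        next
          case False
          let ?M = "add_row x n (\<ominus> M x n) M"
          note e = entry[OF insert.prems(2)]
          have "P ?M"
          proof (rule insert.IH)
            show "{k. k \<noteq> n \<and> ?M k n \<noteq> \<zero>} \<subseteq> S"
              using insert.prems(1,4) e by (auto simp: add_row_def r_neg)
            show "?M n n = \<one>" using insert.prems(4) False by (simp add: add_row_def)
            show "?M \<in> carrier ?G" by (rule add_GL) (use insert.prems False e in auto)
            show "clear (Suc n) ?M" by (rule clear_add) (use insert.prems e in auto)
          qed
          then show ?thesis using un_add[of M x n "\<ominus> M x n"] insert.prems False e by simp
        qed
      qed
    qed
    have pivot2: "P M" if "M \<in> carrier ?G" "clear (Suc n) M" "i < n" "M i n \<noteq> \<zero>" for M i
    proof -
      note e = entry[OF that(1)]
      let ?c = "(\<one> \<ominus> M n n) \<otimes> inv (M i n)"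
      have c: "?c \<in> carrier R" using inv_skew that e by simp
      have "P (add_row n i ?c M)"
      proof (rule pivot1)
        have "?c \<otimes> M i n = \<one> \<ominus> M n n" using inv_skew that e by (simp add: m_assoc)
        then show "add_row n i ?c M n n = \<one>" using e by (simp add: add_row_def minus_eq a_ac r_neg r_neg2)
        show "add_row n i ?c M \<in> carrier ?G" by (rule add_GL) (use that c in auto)
        show "clear (Suc n) (add_row n i ?c M)" by (rule clear_add) (use that c in auto)
      qed
      then show ?thesis using un_add[OF that(1) _ c, of n i] that by auto
    qed
    obtain N where N: "N \<in> carrier (SM R)" "N \<otimes>\<^bsub>SM R\<^esub> M = \<one>\<^bsub>SM R\<^esub>"
      using Suc.prems(1) unfolding GL_carrier_iff by blast
    note e = entry[OF Suc.prems(1)] and eN = SM_entry[OF N(1)]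
    have "\<exists>i\<le>n. M i n \<noteq> \<zero>"
    proof (rule ccontr)
      assume *: "\<not> ?thesis"
      obtain m where m: "stable_from R m N" using N(1) by (auto simp: carrier_SM)
      have row: "(N \<otimes>\<^bsub>SM R\<^esub> M) n l = (\<Oplus>k\<in>{..<m + n + l + 1}. N n k \<otimes> M k l)" for l
        by (rule SM_mult_eq) (use e eN stable_from_row_zero[OF m] in auto)
      have N0: "N n l = \<zero>" if "n < l" for l
      proof -
        have "(\<Oplus>k\<in>{..<m + n + l + 1}. N n k \<otimes> M k l) = N n l \<otimes> M l l"
          by (rule finsum_eq_single) (use Suc.prems(2) that e eN in \<open>auto simp: clear_def\<close>)
        then have "(N \<otimes>\<^bsub>SM R\<^esub> M) n l = N n l"
          using Suc.prems(2) that eN unfolding row by (simp add: clear_def)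
        then show ?thesis using that by (simp add: N(2) one_SM)
      qed
      have "(\<Oplus>k\<in>{..<m + n + n + 1}. N n k \<otimes> M k n) = \<zero>"
      proof (rule add.finprod_one_eqI)
        fix k show "N n k \<otimes> M k n = \<zero>"
          using * N0[of k] e eN by (cases "k \<le> n") auto
      qed
      then have "(N \<otimes>\<^bsub>SM R\<^esub> M) n n = \<zero>" unfolding row .
      then show False using one_neq_zero by (simp add: N(2) one_SM)
    qed
    then obtain i where i: "i \<le> n" "M i n \<noteq> \<zero>" by blast
    show ?case
    proof (cases "\<exists>i<n. M i n \<noteq> \<zero>")
      case True
      then show ?thesis using pivot2 Suc.prems by blast
    next
      case False
      then have nn: "M n n \<noteq> \<zero>" using i by (metis le_less)
      show ?thesis
      proof (cases "n = 0")
        case True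
        let ?a = "M n n"
        note a = inv_skew[OF e nn]
        have u: "inv ?a \<in> Units R" using a by simp
        let ?M = "corner (inv ?a) \<otimes>\<^bsub>SM R\<^esub> M"
        have M': "?M = scale_row 0 (inv ?a) M" by (rule corner_mult) (use a e in auto)
        have G': "?M \<in> carrier ?G"
          using G.m_closed[OF corner_GL[OF u] Suc.prems(1)] by (simp add: GL_mult)
        have "P ?M"
        proof (rule pivot1[OF G'])
          show "clear (Suc n) ?M" unfolding M'
            using Suc.prems(2) True a by (auto simp: clear_def scale_row_def)
          show "?M n n = \<one>" unfolding M' using True a by (simp add: scale_row_def)
        qed
        then have "P (corner ?a \<otimes>\<^bsub>SM R\<^esub> ?M)" using scale[OF G' _ a(1)] by simp
        also have "corner ?a \<otimes>\<^bsub>SM R\<^esub> ?M = (corner ?a \<otimes>\<^bsub>SM R\<^esub> corner (inv ?a)) \<otimes>\<^bsub>SM R\<^esub> M"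
          using a e Suc.prems(1) monoid.m_assoc[OF SM_monoid corner_SM corner_SM]
          by (simp add: GL_carrier_iff)
        also have "\<dots> = M"
          using a e Suc.prems(1) monoid.l_one[OF SM_monoid]
          by (simp add: corner_corner corner_one GL_carrier_iff)
        finally show ?thesis .
      next
        case False': False
        have "P (add_row 0 n \<one> M)"
        proof (rule pivot2[where i = 0])
          show "add_row 0 n \<one> M 0 n \<noteq> \<zero>" using False False' nn e by (simp add: add_row_def)
          show "add_row 0 n \<one> M \<in> carrier ?G" using add_GL Suc.prems False' by simp
          show "clear (Suc n) (add_row 0 n \<one> M)" using clear_add Suc.prems by simp
        qed (use False' in simp)
        then show ?thesis using un_add[of M 0 n \<one>] Suc.prems False' by simp
      qed
    qed
  qed
  moreover obtain m where "stable_from R m M" using M by (auto simp: GL_carrier_iff carrier_SM)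
  then have "clear m M" by (auto simp: clear_def stable_from_def)
  ultimately show ?thesis using M by blast
qed

text \<open>The diagonal factor can be moved past the commutators because these form a normal subgroup.\<close>

lemma GL_eq_commutator_corner:
  assumes "M \<in> carrier (stable_GL R)"
  shows "\<exists>C\<in>GL_commutators R. \<exists>a\<in>Units R. M = C \<otimes>\<^bsub>stable_GL R\<^esub> corner a"
  using assms
proof (induction rule: GL_induct)
  let ?G = "stable_GL R"
  interpret G: group ?G by (rule GL_group)
  interpret D: normal "GL_commutators R" ?G by (rule G.derived_self_is_normal)
  {
    case one
    have "\<one>\<^bsub>?G\<^esub> \<in> GL_commutators R" by simp
    then show ?case using corner_one Units_one_closed G.l_one[OF G.one_closed] by (metis GL_one)
  next
    case (add M i j c)
    then obtain C a where C: "C \<in> GL_commutators R" "a \<in> Units R" "M = C \<otimes>\<^bsub>?G\<^esub> corner a" by blast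
    let ?T = "transvection i j c"
    have T: "?T \<in> GL_commutators R" using transvection_commutator add by blast
    have "?T \<otimes>\<^bsub>SM R\<^esub> M = (?T \<otimes>\<^bsub>?G\<^esub> C) \<otimes>\<^bsub>?G\<^esub> corner a"
      using C T D.mem_carrier corner_GL by (simp add: GL_mult[symmetric] G.m_assoc)
    moreover have "?T \<otimes>\<^bsub>?G\<^esub> C \<in> GL_commutators R" using T C by simp
    ultimately show ?case using C(2) by blast
  next
    case (scale M b)
    then obtain C a where C: "C \<in> GL_commutators R" "a \<in> Units R" "M = C \<otimes>\<^bsub>?G\<^esub> corner a" by blast
    let ?B = "corner b"
    have B: "?B \<in> carrier ?G" using corner_GL scale by blast
    have Cc: "C \<in> carrier ?G" and A: "corner a \<in> carrier ?G" using C D.mem_carrier corner_GL by auto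
    have "?B \<otimes>\<^bsub>SM R\<^esub> M = (?B \<otimes>\<^bsub>?G\<^esub> C \<otimes>\<^bsub>?G\<^esub> inv\<^bsub>?G\<^esub> ?B) \<otimes>\<^bsub>?G\<^esub> (?B \<otimes>\<^bsub>?G\<^esub> corner a)"
      using B Cc A using G.inv_solve_left[of "corner a" ?B "?B \<otimes>\<^bsub>?G\<^esub> corner a"]
      by (simp add: C(3) GL_mult[symmetric] G.m_assoc)
    also have "?B \<otimes>\<^bsub>?G\<^esub> corner a = corner (b \<otimes> a)"
      using C(2) scale by (simp add: GL_mult corner_corner Units_closed)
    finally show ?case using D.inv_op_closed2[OF B C(1)] Units_m_closed C(2) scale by blast
  }
qed

end

section \<open>The Dieudonne determinant\<close>

text \<open>The determinant is built for an arbitrary homomorphism \<open>\<chi>\<close> from the multiplicative group to an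
  abelian group, written additively; its values are images of the Dieudonne determinant under
  \<open>\<chi>\<close>. Since \<open>\<chi> (-1)\<close> may be nonzero, signs have to be tracked.\<close>

locale skew_field_character = skew_field R for R (structure) +
  fixes \<chi> :: "'a \<Rightarrow> 'c::ab_group_add"
  assumes \<chi>_mult: "\<And>a b. a \<in> carrier R \<Longrightarrow> b \<in> carrier R \<Longrightarrow> a \<noteq> \<zero> \<Longrightarrow> b \<noteq> \<zero> \<Longrightarrow>
    \<chi> (a \<otimes> b) = \<chi> a + \<chi> b"
begin

lemma \<chi>_one: "\<chi> \<one> = 0"
  using \<chi>_mult[of \<one> \<one>] one_neq_zero by simp

lemma \<chi>_inv: "a \<in> carrier R \<Longrightarrow> a \<noteq> \<zero> \<Longrightarrow> \<chi> (inv a) = - \<chi> a"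
  using \<chi>_mult[of "inv a" a] inv_skew[of a] \<chi>_one by (simp add: eq_neg_iff_add_eq_0)

lemma minus_one_nonzero: "\<ominus> \<one> \<noteq> \<zero>"
  using one_neq_zero by (metis minus_minus minus_zero one_closed)

lemma \<chi>_minus_one: "\<chi> (\<ominus> \<one>) + \<chi> (\<ominus> \<one>) = 0"
  using \<chi>_mult[of "\<ominus> \<one>" "\<ominus> \<one>"] \<chi>_one minus_one_nonzero by (simp add: l_minus r_minus)

lemma \<chi>_minus: "a \<in> carrier R \<Longrightarrow> a \<noteq> \<zero> \<Longrightarrow> \<chi> (\<ominus> a) = \<chi> (\<ominus> \<one>) + \<chi> a"
  using \<chi>_mult[of "\<ominus> \<one>" a] minus_one_nonzero by (simp add: l_minus)

definition row_comb :: "nat \<Rightarrow> (nat \<Rightarrow> 'a) \<Rightarrow> (nat \<Rightarrow> nat \<Rightarrow> 'a) \<Rightarrow> nat \<Rightarrow> 'a" where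
  "row_comb n x M j = (\<Oplus>i\<in>{..<n}. x i \<otimes> M i j)"

text \<open>Only the upper left \<open>n \<times> n\<close> block matters. The condition says that \<open>x \<mapsto> x M\<close> is bijective on
  row vectors; both halves are carried along, which avoids dimension theory over the skew field.\<close>

definition nonsingular :: "nat \<Rightarrow> (nat \<Rightarrow> nat \<Rightarrow> 'a) \<Rightarrow> bool" where
  "nonsingular n M \<longleftrightarrow> (\<forall>i j. M i j \<in> carrier R) \<and>
     (\<forall>x. (\<forall>i. x i \<in> carrier R) \<longrightarrow> (\<forall>j<n. row_comb n x M j = \<zero>) \<longrightarrow> (\<forall>i<n. x i = \<zero>)) \<and>
     (\<forall>y. (\<forall>j. y j \<in> carrier R) \<longrightarrow>
        (\<exists>x. (\<forall>i. x i \<in> carrier R) \<and> (\<forall>j<n. row_comb n x M j = y j)))"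

text \<open>This is the last row of the inverse of the upper left \<open>(n + 1) \<times> (n + 1)\<close> block.\<close>

definition last_dual :: "nat \<Rightarrow> (nat \<Rightarrow> nat \<Rightarrow> 'a) \<Rightarrow> (nat \<Rightarrow> 'a) \<Rightarrow> bool" where
  "last_dual n M x \<longleftrightarrow> (\<forall>i. x i \<in> carrier R) \<and>
     (\<forall>j<Suc n. row_comb (Suc n) x M j = (if j = n then \<one> else \<zero>))"

text \<open>Removing row \<open>i\<close> and the last column. Row \<open>n\<close> is moved into the gap and negated, so that
  \<open>(M\<^sub>i, M\<^sub>n) \<mapsto> (-M\<^sub>n, M\<^sub>i)\<close> is a product of transvections and no sign depending on \<open>i\<close> is needed.
  For \<open>i = n\<close> only a row outside the remaining block is changed.\<close>

definition minor :: "nat \<Rightarrow> nat \<Rightarrow> (nat \<Rightarrow> nat \<Rightarrow> 'a) \<Rightarrow> nat \<Rightarrow> nat \<Rightarrow> 'a" where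
  "minor n i M = M(i := \<lambda>j. \<ominus> M n j)"

text \<open>Artin's recursion: if \<open>x M = e\<^sub>n\<close> and \<open>x\<^sub>i \<noteq> 0\<close>, replacing row \<open>i\<close> of \<open>M\<close> by \<open>x M\<close> multiplies the
  determinant by \<open>x\<^sub>i\<close> and leaves a matrix whose row \<open>i\<close> is the unit vector \<open>e\<^sub>n\<close>.\<close>

fun block_det :: "nat \<Rightarrow> (nat \<Rightarrow> nat \<Rightarrow> 'a) \<Rightarrow> 'c" where
  "block_det 0 M = 0"
| "block_det (Suc n) M =
     (let x = (SOME x. last_dual n M x); i = (SOME i. i < Suc n \<and> x i \<noteq> \<zero>)
      in block_det n (minor n i M) - \<chi> (x i))"

lemma nonsingular_entry: "nonsingular n M \<Longrightarrow> M i j \<in> carrier R"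
  by (simp add: nonsingular_def)

lemma nonsingular_zero:
  "nonsingular n M \<Longrightarrow> (\<And>i. x i \<in> carrier R) \<Longrightarrow> (\<And>j. j < n \<Longrightarrow> row_comb n x M j = \<zero>) \<Longrightarrow> i < n
    \<Longrightarrow> x i = \<zero>"
  unfolding nonsingular_def by blast

lemma nonsingular_solve:
  assumes "nonsingular n M" "\<And>j. y j \<in> carrier R"
  obtains x where "\<And>i. x i \<in> carrier R" "\<And>j. j < n \<Longrightarrow> row_comb n x M j = y j"
  using assms unfolding nonsingular_def by blast

lemma row_comb_closed[simp]:
  "(\<And>i. x i \<in> carrier R) \<Longrightarrow> (\<And>i j. M i j \<in> carrier R) \<Longrightarrow> row_comb n x M j \<in> carrier R"
  unfolding row_comb_def by (rule finsum_closed) auto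

lemma row_comb_cong:
  assumes "\<And>i. x' i \<in> carrier R" "\<And>i j. M' i j \<in> carrier R"
    and "\<And>i. i < n \<Longrightarrow> x i = x' i" "\<And>i. i < n \<Longrightarrow> M i j = M' i j"
  shows "row_comb n x M j = row_comb n x' M' j"
  unfolding row_comb_def by (rule add.finprod_cong') (use assms in auto)

lemma row_comb_split:
  assumes "\<And>i. x i \<in> carrier R" "\<And>i j. M i j \<in> carrier R" "p < n"
  shows "row_comb n x M j = x p \<otimes> M p j \<oplus> (\<Oplus>i\<in>{..<n} - {p}. x i \<otimes> M i j)"
proof -
  have "{..<n} = insert p ({..<n} - {p})" using assms(3) by auto
  then have "row_comb n x M j = (\<Oplus>i\<in>insert p ({..<n} - {p}). x i \<otimes> M i j)"
    by (simp add: row_comb_def)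
  also have "\<dots> = x p \<otimes> M p j \<oplus> (\<Oplus>i\<in>{..<n} - {p}. x i \<otimes> M i j)"
    by (rule finsum_insert) (use assms in auto)
  finally show ?thesis .
qed

lemma row_comb_add:
  assumes "\<And>i. x i \<in> carrier R" "\<And>i. y i \<in> carrier R" "\<And>i j. M i j \<in> carrier R"
  shows "row_comb n (\<lambda>i. x i \<oplus> y i) M j = row_comb n x M j \<oplus> row_comb n y M j"
  unfolding row_comb_def using assms by (simp add: l_distr finsum_addf Pi_def)

lemma row_comb_smult:
  assumes "c \<in> carrier R" "\<And>i. x i \<in> carrier R" "\<And>i j. M i j \<in> carrier R"
  shows "row_comb n (\<lambda>i. c \<otimes> x i) M j = c \<otimes> row_comb n x M j"
  unfolding row_comb_def using assms by (simp add: finsum_rdistr Pi_def m_assoc)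

lemma row_comb_add_row:
  assumes x: "\<And>i. x i \<in> carrier R" and M: "\<And>i j. M i j \<in> carrier R"
    and pq: "p < n" "q < n" "p \<noteq> q" and c: "c \<in> carrier R"
  shows "row_comb n x (add_row p q c M) j = row_comb n (x(q := x q \<oplus> x p \<otimes> c)) M j"
proof -
  define S where "S = (\<Oplus>i\<in>{..<n} - {p} - {q}. x i \<otimes> M i j)"
  have S: "S \<in> carrier R" unfolding S_def using x M by (intro finsum_closed) auto
  have split2: "row_comb n y N j = y p \<otimes> N p j \<oplus> (y q \<otimes> N q j \<oplus> S)"
    if "\<And>i. y i \<in> carrier R" "\<And>i j. N i j \<in> carrier R"
      "\<And>i. i \<noteq> p \<Longrightarrow> i \<noteq> q \<Longrightarrow> y i \<otimes> N i j = x i \<otimes> M i j" for y N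
  proof -
    have "{..<n} - {p} = insert q ({..<n} - {p} - {q})" using pq by auto
    then have "(\<Oplus>i\<in>{..<n} - {p}. y i \<otimes> N i j)
        = (\<Oplus>i\<in>insert q ({..<n} - {p} - {q}). y i \<otimes> N i j)" by simp
    also have "\<dots> = y q \<otimes> N q j \<oplus> (\<Oplus>i\<in>{..<n} - {p} - {q}. y i \<otimes> N i j)"
      by (rule finsum_insert) (use that in auto)
    also have "(\<Oplus>i\<in>{..<n} - {p} - {q}. y i \<otimes> N i j) = S"
      unfolding S_def by (rule add.finprod_cong') (use that x M in auto)
    finally show ?thesis using row_comb_split[of y N p n j] that pq by simp
  qed
  have "row_comb n x (add_row p q c M) j
      = x p \<otimes> (M p j \<oplus> c \<otimes> M q j) \<oplus> (x q \<otimes> M q j \<oplus> S)"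
    by (subst split2) (use x M c pq in \<open>auto simp: add_row_def\<close>)
  also have "\<dots> = x p \<otimes> M p j \<oplus> ((x q \<oplus> x p \<otimes> c) \<otimes> M q j \<oplus> S)"
    using x M c S by (simp add: r_distr l_distr m_assoc a_ac)
  also have "\<dots> = row_comb n (x(q := x q \<oplus> x p \<otimes> c)) M j"
    by (subst split2) (use x M c pq in auto)
  finally show ?thesis .
qed

lemma row_comb_scale_row:
  assumes x: "\<And>i. x i \<in> carrier R" and M: "\<And>i j. M i j \<in> carrier R"
    and c: "c \<in> carrier R"
  shows "row_comb n x (scale_row p c M) j = row_comb n (x(p := x p \<otimes> c)) M j"
  unfolding row_comb_def
  by (rule add.finprod_cong') (use x M c in \<open>auto simp: scale_row_def m_assoc\<close>)

lemma scale_row_closed: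
  "c \<in> carrier R \<Longrightarrow> (\<And>i j. M i j \<in> carrier R) \<Longrightarrow> scale_row i c M k l \<in> carrier R"
  by (simp add: scale_row_def)

lemma minor_closed: "(\<And>i j. M i j \<in> carrier R) \<Longrightarrow> minor n i M k l \<in> carrier R"
  by (simp add: minor_def)

lemma nonsingular_add_row:
  assumes M: "nonsingular n M" and pq: "p < n" "q < n" "p \<noteq> q" and c: "c \<in> carrier R"
  shows "nonsingular n (add_row p q c M)"
  unfolding nonsingular_def
proof (intro conjI allI impI)
  note e[simp] = nonsingular_entry[OF M]
  show "add_row p q c M i j \<in> carrier R" for i j using c by (simp add: add_row_closed)
  {
    fix x i assume x: "\<forall>i. x i \<in> carrier R" and 0: "\<forall>j<n. row_comb n x (add_row p q c M) j = \<zero>"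
      and i: "i < n"
    let ?x = "x(q := x q \<oplus> x p \<otimes> c)"
    have cl: "?x k \<in> carrier R" for k using x c by simp
    have "row_comb n ?x M j = \<zero>" if "j < n" for j
    proof -
      have "row_comb n ?x M j = row_comb n x (add_row p q c M) j"
        by (rule row_comb_add_row[symmetric]) (use x pq c in auto)
      with 0 that show ?thesis by simp
    qed
    then have *: "?x k = \<zero>" if "k < n" for k
      using nonsingular_zero[of n M ?x k, OF M cl] that by simp
    have "x p = \<zero>" using *[of p] pq by simp
    then show "x i = \<zero>" using *[OF i] *[of q] pq x c by (auto split: if_splits)
  }
  {
    fix y :: "nat \<Rightarrow> 'a" assume "\<forall>j. y j \<in> carrier R"
    then obtain x where x: "\<And>i. x i \<in> carrier R" "\<And>j. j < n \<Longrightarrow> row_comb n x M j = y j"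
      using nonsingular_solve[OF M, of y] by blast
    let ?x = "x(q := x q \<ominus> x p \<otimes> c)"
    have "?x(q := ?x q \<oplus> ?x p \<otimes> c) = x"
      using x c pq by (auto simp: fun_eq_iff minus_eq a_assoc l_neg)
    then have "row_comb n ?x (add_row p q c M) j = y j" if "j < n" for j
      using row_comb_add_row[of ?x M p n q c j] x pq c that by simp
    moreover have "?x i \<in> carrier R" for i using x c by simp
    ultimately show "\<exists>x. (\<forall>i. x i \<in> carrier R) \<and> (\<forall>j<n. row_comb n x (add_row p q c M) j = y j)"
      by blast
  }
qed

lemma nonsingular_scale_row:
  assumes M: "nonsingular n M" and c: "c \<in> carrier R" "c \<noteq> \<zero>"
  shows "nonsingular n (scale_row p c M)"
  unfolding nonsingular_def
proof (intro conjI allI impI)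
  note e[simp] = nonsingular_entry[OF M]
  note ic = inv_skew[OF c]
  show "scale_row p c M i j \<in> carrier R" for i j using c by (simp add: scale_row_closed)
  {
    fix x i assume x: "\<forall>i. x i \<in> carrier R" and 0: "\<forall>j<n. row_comb n x (scale_row p c M) j = \<zero>"
      and i: "i < n"
    let ?x = "x(p := x p \<otimes> c)"
    have cl: "?x k \<in> carrier R" for k using x c by simp
    have "row_comb n ?x M j = \<zero>" if "j < n" for j
    proof -
      have "row_comb n ?x M j = row_comb n x (scale_row p c M) j"
        by (rule row_comb_scale_row[symmetric]) (use x c in auto)
      with 0 that show ?thesis by simp
    qed
    then have "?x i = \<zero>"
      using nonsingular_zero[of n M ?x i, OF M cl] i by simp
    then show "x i = \<zero>" using x c skew_integral by (auto split: if_splits)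
  }
  {
    fix y :: "nat \<Rightarrow> 'a" assume "\<forall>j. y j \<in> carrier R"
    then obtain x where x: "\<And>i. x i \<in> carrier R" "\<And>j. j < n \<Longrightarrow> row_comb n x M j = y j"
      using nonsingular_solve[OF M, of y] by blast
    let ?x = "x(p := x p \<otimes> inv c)"
    have "?x(p := ?x p \<otimes> c) = x" using x c ic by (auto simp: fun_eq_iff m_assoc)
    then have "row_comb n ?x (scale_row p c M) j = y j" if "j < n" for j
      using row_comb_scale_row[of ?x M c n p j] x ic c that by simp
    moreover have "?x i \<in> carrier R" for i using x ic by simp
    ultimately show "\<exists>x. (\<forall>i. x i \<in> carrier R) \<and> (\<forall>j<n. row_comb n x (scale_row p c M) j = y j)"
      by blast
  }
qed

text \<open>A combination of the rows of \<open>M\<close> that omits row \<open>i\<close> is a combination of the rows of the minor.\<close>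

lemma row_comb_minor:
  assumes z: "\<And>i. z i \<in> carrier R" and M: "\<And>i j. M i j \<in> carrier R"
    and i: "i < Suc n" "z i = \<zero>"
  shows "row_comb (Suc n) z M j = row_comb n (z(i := \<ominus> z n)) (minor n i M) j"
proof (cases "i = n")
  case True
  have "row_comb (Suc n) z M j = row_comb n z M j"
    unfolding row_comb_def using z M i True
    by (simp add: Pi_def lessThan_Suc)
  also have "\<dots> = row_comb n (z(i := \<ominus> z n)) (minor n i M) j"
    by (rule row_comb_cong) (use z M True in \<open>auto simp: minor_def\<close>)
  finally show ?thesis .
next
  case False
  then have i': "i < n" using i by simp
  have "row_comb (Suc n) z M j = z n \<otimes> M n j \<oplus> row_comb n z M j"
    unfolding row_comb_def using z M by (simp add: Pi_def lessThan_Suc)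
  also have "row_comb n z M j = z i \<otimes> M i j \<oplus> (\<Oplus>k\<in>{..<n} - {i}. z k \<otimes> M k j)"
    by (rule row_comb_split) (use z M i' in auto)
  also have "(\<Oplus>k\<in>{..<n} - {i}. z k \<otimes> M k j)
     = (\<Oplus>k\<in>{..<n} - {i}. (z(i := \<ominus> z n)) k \<otimes> minor n i M k j)"
    by (rule add.finprod_cong') (use z M in \<open>auto simp: minor_def\<close>)
  finally have "row_comb (Suc n) z M j = (z(i := \<ominus> z n)) i \<otimes> minor n i M i j \<oplus>
      (\<Oplus>k\<in>{..<n} - {i}. (z(i := \<ominus> z n)) k \<otimes> minor n i M k j)"
    using z M i by (simp add: minor_def l_minus r_minus Pi_def)
  also have "\<dots> = row_comb n (z(i := \<ominus> z n)) (minor n i M) j"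
    by (rule row_comb_split[symmetric]) (use z M i' in \<open>auto simp: minor_def\<close>)
  finally show ?thesis .
qed

lemma last_dual_ex:
  assumes "nonsingular (Suc n) M" shows "\<exists>x. last_dual n M x"
proof -
  have "(if j = n then \<one> else \<zero>) \<in> carrier R" for j by simp
  then obtain x where "\<And>i. x i \<in> carrier R"
      "\<And>j. j < Suc n \<Longrightarrow> row_comb (Suc n) x M j = (if j = n then \<one> else \<zero>)"
    using nonsingular_solve[OF assms, of "\<lambda>j. if j = n then \<one> else \<zero>"] by metis
  then show ?thesis unfolding last_dual_def by blast
qed

lemma last_dual_closed: "last_dual n M x \<Longrightarrow> x i \<in> carrier R"
  by (simp add: last_dual_def)

lemma last_dual_nonzero:
  assumes "last_dual n M x" "\<And>i j. M i j \<in> carrier R"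
  shows "\<exists>i<Suc n. x i \<noteq> \<zero>"
proof (rule ccontr)
  assume *: "\<not> ?thesis"
  have "row_comb (Suc n) x M n = \<zero>"
    unfolding row_comb_def by (rule add.finprod_one_eqI) (use * assms(2) in auto)
  then show False using assms(1) one_neq_zero by (simp add: last_dual_def)
qed

text \<open>Vectors that vanish at coordinate \<open>i\<close> represent row vectors modulo the dual vector \<open>x\<close>, because
  \<open>x\<^sub>i \<noteq> 0\<close>, and \<open>x\<close> is mapped to the last unit vector, which disappears with the last column.\<close>

lemma nonsingular_minor:
  assumes M: "nonsingular (Suc n) M" and x: "last_dual n M x" and i: "i < Suc n" "x i \<noteq> \<zero>"
  shows "nonsingular n (minor n i M)"
  unfolding nonsingular_def
proof (intro conjI allI impI)
  note e[simp] = nonsingular_entry[OF M] and ex[simp] = last_dual_closed[OF x]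
  show "minor n i M k j \<in> carrier R" for k j by (simp add: minor_closed)
  {
    fix w k assume w: "\<forall>k. w k \<in> carrier R" and 0: "\<forall>j<n. row_comb n w (minor n i M) j = \<zero>"
      and k: "k < n"
    define z where "z = (w(i := \<zero>))(n := if i = n then \<zero> else \<ominus> w i)"
    have z: "z k \<in> carrier R" for k using w by (simp add: z_def)
    have zi: "z i = \<zero>" by (simp add: z_def)
    have cz: "row_comb (Suc n) z M j = row_comb n w (minor n i M) j" for j
      unfolding row_comb_minor[of z M i n j, OF z e i(1) zi]
      by (rule row_comb_cong) (use w in \<open>auto simp: z_def minor_closed\<close>)
    define c where "c = row_comb (Suc n) z M n"
    have c: "c \<in> carrier R" using z by (simp add: c_def)
    have z0: "z l \<oplus> (\<ominus> c) \<otimes> x l = \<zero>" if "l < Suc n" for l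
    proof (rule nonsingular_zero[of "Suc n" M "\<lambda>l. z l \<oplus> (\<ominus> c) \<otimes> x l" l, OF M _ _ that])
      show "z l \<oplus> (\<ominus> c) \<otimes> x l \<in> carrier R" for l using z c by simp
      fix j assume j: "j < Suc n"
      have "row_comb (Suc n) (\<lambda>l. z l \<oplus> (\<ominus> c) \<otimes> x l) M j
          = row_comb (Suc n) z M j \<oplus> (\<ominus> c) \<otimes> row_comb (Suc n) x M j"
        using z c by (simp add: row_comb_add row_comb_smult)
      also have "\<dots> = \<zero>"
      proof (cases "j = n")
        case True
        then have "row_comb (Suc n) x M j = \<one>" "row_comb (Suc n) z M j = c"
          using x by (auto simp: last_dual_def c_def)
        then show ?thesis using c by (simp add: r_neg)
      next
        case False
        then have "row_comb (Suc n) x M j = \<zero>" "row_comb (Suc n) z M j = \<zero>"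
          using x j 0 by (auto simp: last_dual_def cz)
        then show ?thesis using c by simp
      qed
      finally show "row_comb (Suc n) (\<lambda>l. z l \<oplus> (\<ominus> c) \<otimes> x l) M j = \<zero>" .
    qed
    have "(\<ominus> c) \<otimes> x i = \<zero>" using z0[OF i(1)] c by (simp add: zi)
    then have "\<ominus> c = \<zero>" using c i skew_integral[of "\<ominus> c" "x i"] by simp
    then have z0': "z l = \<zero>" if "l < Suc n" for l using z0[OF that] z by simp
    show "w k = \<zero>"
    proof (cases "k = i")
      case True
      then have "\<ominus> w i = \<zero>" using z0'[of n] k by (simp add: z_def)
      then have "\<ominus> (\<ominus> w i) = \<zero>" by simp
        then show ?thesis using w True by simp
    next
      case False
      then show ?thesis using z0'[of k] k by (simp add: z_def)
    qed
  }
  {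
    fix y :: "nat \<Rightarrow> 'a" assume y: "\<forall>j. y j \<in> carrier R"
    define y' where "y' = y(n := \<zero>)"
    have "y' j \<in> carrier R" for j using y by (simp add: y'_def)
    then obtain v where v: "\<And>i. v i \<in> carrier R" "\<And>j. j < Suc n \<Longrightarrow> row_comb (Suc n) v M j = y' j"
      using nonsingular_solve[OF M, of y'] by blast
    note ix = inv_skew[OF ex i(2)]
    define c where "c = \<ominus> (v i \<otimes> inv (x i))"
    have c: "c \<in> carrier R" using v ix by (simp add: c_def)
    define z where "z l = v l \<oplus> c \<otimes> x l" for l
    have z: "z l \<in> carrier R" for l using v c by (simp add: z_def)
    have zi: "z i = \<zero>" using v ix by (simp add: z_def c_def l_minus m_assoc r_neg)
    have "row_comb n (z(i := \<ominus> z n)) (minor n i M) j = y j" if j: "j < n" for j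
    proof -
      have "row_comb n (z(i := \<ominus> z n)) (minor n i M) j = row_comb (Suc n) z M j"
        by (rule row_comb_minor[symmetric]) (use z zi i in auto)
      also have "\<dots> = row_comb (Suc n) v M j \<oplus> c \<otimes> row_comb (Suc n) x M j"
        unfolding z_def using v c by (simp add: row_comb_add row_comb_smult)
      also have "\<dots> = y j" using v j x c y by (simp add: y'_def last_dual_def)
      finally show ?thesis .
    qed
    moreover have "(z(i := \<ominus> z n)) l \<in> carrier R" for l using z by simp
    ultimately show "\<exists>x. (\<forall>i. x i \<in> carrier R) \<and> (\<forall>j<n. row_comb n x (minor n i M) j = y j)"
      by blast
  }
qed

lemma last_dual_cong:
  assumes "\<And>i j. M i j \<in> carrier R" "\<And>i j. M' i j \<in> carrier R"
    and "\<And>i j. i < Suc n \<Longrightarrow> j < Suc n \<Longrightarrow> M i j = M' i j"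
  shows "last_dual n M = last_dual n M'"
proof
  fix x
  have "row_comb (Suc n) x M j = row_comb (Suc n) x M' j" if "\<forall>i. x i \<in> carrier R" "j < Suc n" for j
    by (rule row_comb_cong) (use assms that in auto)
  then show "last_dual n M x = last_dual n M' x" unfolding last_dual_def by auto
qed

lemma block_det_cong:
  assumes "\<And>i j. M i j \<in> carrier R" "\<And>i j. M' i j \<in> carrier R"
    and "\<And>i j. i < n \<Longrightarrow> j < n \<Longrightarrow> M i j = M' i j"
  shows "block_det n M = block_det n M'"
  using assms
proof (induction n arbitrary: M M')
  case 0 then show ?case by simp
next
  case (Suc n)
  have "last_dual n M = last_dual n M'" by (rule last_dual_cong) (use Suc.prems in auto)
  moreover have "block_det n (minor n i M) = block_det n (minor n i M')" for i
    by (rule Suc.IH) (use Suc.prems in \<open>auto simp: minor_def\<close>)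
  ultimately show ?case by (simp add: Let_def)
qed

end

context skew_field_character
begin

text \<open>Only the first \<open>n\<close> columns are compared, because a minor loses the last column.\<close>

definition in_row_span :: "nat \<Rightarrow> nat set \<Rightarrow> (nat \<Rightarrow> nat \<Rightarrow> 'a) \<Rightarrow> (nat \<Rightarrow> 'a) \<Rightarrow> bool" where
  "in_row_span n S M v \<longleftrightarrow>
     (\<exists>e. (\<forall>i. e i \<in> carrier R) \<and> (\<forall>j<n. v j = (\<Oplus>l\<in>S. e l \<otimes> M l j)))"

lemma in_row_span_add:
  assumes "in_row_span n S M v" "in_row_span n S M w" "\<And>i j. M i j \<in> carrier R"
  shows "in_row_span n S M (\<lambda>j. v j \<oplus> w j)"
proof -
  obtain e f where "\<forall>i. e i \<in> carrier R" "\<forall>j<n. v j = (\<Oplus>l\<in>S. e l \<otimes> M l j)"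
    "\<forall>i. f i \<in> carrier R" "\<forall>j<n. w j = (\<Oplus>l\<in>S. f l \<otimes> M l j)"
    using assms(1,2) by (auto simp: in_row_span_def)
  then show ?thesis unfolding in_row_span_def
    by (intro exI[of _ "\<lambda>i. e i \<oplus> f i"]) (use assms(3) in \<open>simp add: l_distr finsum_addf Pi_def\<close>)
qed

lemma in_row_span_smult:
  assumes "in_row_span n S M v" "c \<in> carrier R" "finite S" "\<And>i j. M i j \<in> carrier R"
  shows "in_row_span n S M (\<lambda>j. c \<otimes> v j)"
proof -
  obtain e where "\<forall>i. e i \<in> carrier R" "\<forall>j<n. v j = (\<Oplus>l\<in>S. e l \<otimes> M l j)"
    using assms(1) by (auto simp: in_row_span_def)
  then show ?thesis unfolding in_row_span_def
    by (intro exI[of _ "\<lambda>i. c \<otimes> e i"]) (use assms in \<open>simp add: finsum_rdistr m_assoc Pi_def\<close>)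
qed

lemma in_row_span_cong:
  "in_row_span n S M v \<Longrightarrow> (\<And>j. j < n \<Longrightarrow> v j = w j) \<Longrightarrow> in_row_span n S M w"
  by (auto simp: in_row_span_def)

lemma in_row_span_zero:
  assumes "\<And>i j. M i j \<in> carrier R" shows "in_row_span n S M (\<lambda>j. \<zero>)"
  unfolding in_row_span_def
  by (rule exI[of _ "\<lambda>_. \<zero>"]) (use assms in simp)

lemma in_row_span_row:
  assumes "finite S" "q \<in> S" "\<And>i j. M i j \<in> carrier R"
  shows "in_row_span n S M (M q)"
proof -
  have "M q j = (\<Oplus>l\<in>S. (if l = q then \<one> else \<zero>) \<otimes> M l j)" for j
    by (subst finsum_eq_single[of S q]) (use assms in auto)
  then show ?thesis unfolding in_row_span_def
    by (intro exI[of _ "\<lambda>l. if l = q then \<one> else \<zero>"]) auto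
qed

lemma in_row_span_sum:
  assumes "finite T" "finite S" "\<And>l. l \<in> T \<Longrightarrow> in_row_span n S M (v l)"
    "\<And>i j. M i j \<in> carrier R" "\<And>l j. v l j \<in> carrier R" "\<And>l. c l \<in> carrier R"
  shows "in_row_span n S M (\<lambda>j. \<Oplus>l\<in>T. c l \<otimes> v l j)"
  using assms(1,3)
proof (induction T)
  case empty
  then show ?case using in_row_span_zero[OF assms(4)] by simp
next
  case (insert l T)
  have "in_row_span n S M (\<lambda>j. c l \<otimes> v l j \<oplus> (\<Oplus>l\<in>T. c l \<otimes> v l j))"
    by (rule in_row_span_add[OF in_row_span_smult]) (use insert assms in auto)
  then show ?case using insert assms(5,6) by (simp add: Pi_def)
qed

text \<open>Row \<open>i\<close> is a combination of the other rows as soon as its coefficient in the dual vector is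
  nonzero, if one ignores the last column.\<close>

lemma last_dual_row:
  assumes M: "\<And>i j. M i j \<in> carrier R" and x: "last_dual n M x" and i: "i < Suc n" "x i \<noteq> \<zero>"
    and j: "j < n"
  shows "M i j = (\<Oplus>l\<in>{..<Suc n} - {i}. (\<ominus> (inv (x i) \<otimes> x l)) \<otimes> M l j)"
proof -
  note ex[simp] = last_dual_closed[OF x] and ix = inv_skew[OF ex i(2)]
  define s where "s = (\<Oplus>l\<in>{..<Suc n} - {i}. x l \<otimes> M l j)"
  have s: "s \<in> carrier R" unfolding s_def using M by (intro finsum_closed) auto
  have "row_comb (Suc n) x M j = \<zero>" using x j by (simp add: last_dual_def)
  then have "x i \<otimes> M i j \<oplus> s = \<zero>"
    using row_comb_split[of x M i "Suc n" j] M i by (simp add: s_def)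
  then have "x i \<otimes> M i j = \<ominus> s" using M s by (intro minus_equality[symmetric]) auto
  then have "inv (x i) \<otimes> (x i \<otimes> M i j) = (\<ominus> (inv (x i))) \<otimes> s"
    using ix s by (simp add: l_minus r_minus)
  also have "inv (x i) \<otimes> (x i \<otimes> M i j) = M i j" using ix M by (simp add: m_assoc[symmetric])
  also have "(\<ominus> (inv (x i))) \<otimes> s
      = (\<Oplus>l\<in>{..<Suc n} - {i}. (\<ominus> (inv (x i) \<otimes> x l)) \<otimes> M l j)"
    unfolding s_def using ix M by (simp add: finsum_rdistr m_assoc l_minus Pi_def)
  finally show ?thesis .
qed

text \<open>These two properties are proved for all \<open>n\<close> by a simultaneous induction. In the step, they are
  used for the minors: first to see that the recursion does not depend on the chosen row, then to
  transfer the properties themselves.\<close>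

definition add_invariant :: "nat \<Rightarrow> bool" where
  "add_invariant n \<longleftrightarrow> (\<forall>M p q c. nonsingular n M \<longrightarrow> p < n \<longrightarrow> q < n \<longrightarrow> p \<noteq> q \<longrightarrow>
     c \<in> carrier R \<longrightarrow> block_det n (add_row p q c M) = block_det n M)"

definition scale_covariant :: "nat \<Rightarrow> bool" where
  "scale_covariant n \<longleftrightarrow> (\<forall>M p c. nonsingular n M \<longrightarrow> p < n \<longrightarrow> c \<in> carrier R \<longrightarrow> c \<noteq> \<zero> \<longrightarrow>
     block_det n (scale_row p c M) = \<chi> c + block_det n M)"

text \<open>Invariance under single row additions extends to adding any combination of the other rows, one
  summand at a time.\<close>

lemma add_invariant_span:
  assumes inv: "add_invariant n" and M: "nonsingular n M" and p: "p < n"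
    and v: "in_row_span n ({..<n} - {p}) M v"
    and N: "\<And>i j. N i j \<in> carrier R" "\<And>i j. i < n \<Longrightarrow> i \<noteq> p \<Longrightarrow> j < n \<Longrightarrow> N i j = M i j"
      "\<And>j. j < n \<Longrightarrow> N p j = M p j \<oplus> v j"
  shows "block_det n N = block_det n M"
proof -
  note e[simp] = nonsingular_entry[OF M]
  obtain c where c: "\<And>i. c i \<in> carrier R"
      "\<And>j. j < n \<Longrightarrow> v j = (\<Oplus>l\<in>{..<n} - {p}. c l \<otimes> M l j)"
    using v by (auto simp: in_row_span_def)
  define add where "add S = M(p := \<lambda>j. M p j \<oplus> (\<Oplus>l\<in>S. c l \<otimes> M l j))" for S
  have eadd: "add S i j \<in> carrier R" for S i j
    using c by (auto simp: add_def intro!: a_closed finsum_closed)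
  have "nonsingular n (add S) \<and> block_det n (add S) = block_det n M"
    if "finite S" "S \<subseteq> {..<n} - {p}" for S
    using that
  proof (induction S)
    case empty
    have "add {} = M" by (auto simp: add_def fun_eq_iff)
    then show ?case using M by simp
  next
    case (insert q S)
    have "add (insert q S) = add_row p q (c q) (add S)"
    proof (intro ext)
      fix i j
      have "(\<Oplus>l\<in>insert q S. c l \<otimes> M l j) = c q \<otimes> M q j \<oplus> (\<Oplus>l\<in>S. c l \<otimes> M l j)"
        using insert c by (intro finsum_insert) auto
      moreover have "(\<Oplus>l\<in>S. c l \<otimes> M l j) \<in> carrier R" using c by (intro finsum_closed) auto
      ultimately show "add (insert q S) i j = add_row p q (c q) (add S) i j"
        using insert.prems c by (auto simp: add_def add_row_def a_ac)
    qed
    then show ?case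
      using insert inv nonsingular_add_row p c unfolding add_invariant_def by auto
  qed
  from this[of "{..<n} - {p}"] have "block_det n (add ({..<n} - {p})) = block_det n M" by simp
  moreover have "block_det n N = block_det n (add ({..<n} - {p}))"
  proof (rule block_det_cong)
    show "N i j = add ({..<n} - {p}) i j" if "i < n" "j < n" for i j
      using that N(2,3) c(2) by (cases "i = p") (auto simp: add_def)
  qed (use N(1) eadd in auto)
  ultimately show ?thesis by simp
qed

text \<open>An exchange of two rows is the product of three row additions and a change of sign.\<close>

lemma block_det_swap:
  assumes inv: "add_invariant n" "scale_covariant n" and M: "nonsingular n M"
    and pq: "p < n" "q < n" "p \<noteq> q"
  shows "nonsingular n (M(p := M q, q := M p))"
    "block_det n (M(p := M q, q := M p)) = \<chi> (\<ominus> \<one>) + block_det n M"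
proof -
  note e[simp] = nonsingular_entry[OF M]
  define M1 where "M1 = add_row p q \<one> M"
  define M2 where "M2 = add_row q p (\<ominus> \<one>) M1"
  define M3 where "M3 = add_row p q \<one> M2"
  have M1: "nonsingular n M1" unfolding M1_def by (rule nonsingular_add_row) (use M pq in auto)
  have M2: "nonsingular n M2" unfolding M2_def by (rule nonsingular_add_row) (use M1 pq in auto)
  have M3: "nonsingular n M3" unfolding M3_def by (rule nonsingular_add_row) (use M2 pq in auto)
  have eq: "M(p := M q, q := M p) = scale_row q (\<ominus> \<one>) M3"
    using pq by (auto simp: fun_eq_iff scale_row_def M3_def M2_def M1_def add_row_def l_minus
        minus_add r_neg r_neg1 r_neg2 l_neg a_ac)
  show "nonsingular n (M(p := M q, q := M p))"
    unfolding eq using nonsingular_scale_row[OF M3] minus_one_nonzero by simp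
  have "block_det n M3 = block_det n M"
    using inv(1) M M1 M2 pq unfolding add_invariant_def M3_def M2_def M1_def by auto
  then show "block_det n (M(p := M q, q := M p)) = \<chi> (\<ominus> \<one>) + block_det n M"
    unfolding eq using inv(2) M3 pq minus_one_nonzero unfolding scale_covariant_def by auto
qed

text \<open>Let \<open>x\<^sub>i\<close> and \<open>x\<^sub>k\<close> be nonzero. Modulo the other rows, and ignoring the last column, row \<open>i\<close> is
  \<open>-x\<^sub>i\<^sup>-\<^sup>1 x\<^sub>k\<close> times row \<open>k\<close>. This turns the minor for \<open>k\<close> into the one for \<open>i\<close>, up to a change
  of sign that comes from exchanging rows (or, for \<open>k = n\<close>, from the sign in the definition of the
  minor) and that cancels against the sign of the factor.\<close>

lemma minor_independent:
  assumes inv: "add_invariant n" "scale_covariant n" and M: "nonsingular (Suc n) M"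
    and x: "last_dual n M x" and i: "i < Suc n" "x i \<noteq> \<zero>" and k: "k < Suc n" "x k \<noteq> \<zero>"
  shows "block_det n (minor n i M) - \<chi> (x i) = block_det n (minor n k M) - \<chi> (x k)"
proof -
  note e[simp] = nonsingular_entry[OF M] and ex[simp] = last_dual_closed[OF x]
  have main: "block_det n (minor n i M) - \<chi> (x i) = block_det n (minor n k M) - \<chi> (x k)"
    if i: "i < n" "x i \<noteq> \<zero>" and k: "k < Suc n" "x k \<noteq> \<zero>" "i \<noteq> k" for i k
  proof -
    have i': "i < Suc n" using i by simp
    note ix = inv_skew[OF ex i(2)]
    define d where "d l = \<ominus> (inv (x i) \<otimes> x l)" for l
    have d[simp]: "d l \<in> carrier R" for l using ix by (simp add: d_def)
    have row: "M i j = (\<Oplus>l\<in>{..<Suc n} - {i}. d l \<otimes> M l j)" if "j < n" for j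
      unfolding d_def by (rule last_dual_row[OF e x]) (use i that in auto)
    have ik: "inv (x i) \<otimes> x k \<noteq> \<zero>" using ix ex k mult_nonzero by blast
    have dk: "d k \<noteq> \<zero>" using ik ix by (metis d_def ex m_closed minus_minus minus_zero)
    have \<chi>d: "\<chi> (d k) = \<chi> (\<ominus> \<one>) - \<chi> (x i) + \<chi> (x k)"
      using ix ik k i unfolding d_def by (subst \<chi>_minus) (auto simp: \<chi>_mult \<chi>_inv)
    let ?X = "minor n i M" and ?Y = "minor n k M"
    have X: "nonsingular n ?X" by (rule nonsingular_minor[OF M x i' i(2)])
    have Y: "nonsingular n ?Y" by (rule nonsingular_minor[OF M x k(1,2)])
    \<comment> \<open>\<open>W\<close> is \<open>Y\<close> with row \<open>i\<close> replaced by the row \<open>k\<close> of \<open>M\<close>\<close>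
    obtain W where W: "nonsingular n W" "\<And>l j. l \<noteq> i \<Longrightarrow> l < n \<Longrightarrow> W l j = ?Y l j" "\<And>j. W i j = M k j"
      "block_det n W = \<chi> (\<ominus> \<one>) + block_det n ?X"
    proof (cases "k = n")
      case True
      show ?thesis
      proof (rule that[of "scale_row i (\<ominus> \<one>) ?X"])
        show "nonsingular n (scale_row i (\<ominus> \<one>) ?X)"
          using nonsingular_scale_row[OF X] minus_one_nonzero by simp
        show "block_det n (scale_row i (\<ominus> \<one>) ?X) = \<chi> (\<ominus> \<one>) + block_det n ?X"
          using inv(2) X i minus_one_nonzero unfolding scale_covariant_def by simp
      qed (use True i in \<open>auto simp: scale_row_def minor_def l_minus\<close>)
    next
      case False
      then have kn: "k < n" using k by simp
      note sw = block_det_swap[OF inv X i(1) kn k(3)]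
      show ?thesis
        by (rule that[OF sw(1) _ _ sw(2)]) (use k(3) in \<open>auto simp: minor_def\<close>)
    qed
    note eW[simp] = nonsingular_entry[OF W(1)]
    define V where "V = scale_row i (d k) W"
    have V: "nonsingular n V" "block_det n V = \<chi> (d k) + block_det n W"
      using nonsingular_scale_row[OF W(1)] inv(2) W(1) dk i unfolding V_def scale_covariant_def by auto
    note eV[simp] = nonsingular_entry[OF V(1)]
    have Vl: "V l j = ?Y l j" if "l < n" "l \<noteq> i" for l j
      using that W(2) by (simp add: V_def scale_row_def)
    define T where "T = {..<Suc n} - {i} - {k}"
    have span: "in_row_span n ({..<n} - {i}) V (\<lambda>j. \<Oplus>l\<in>T. d l \<otimes> M l j)"
    proof (rule in_row_span_sum)
      fix l assume l: "l \<in> T"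
      show "in_row_span n ({..<n} - {i}) V (M l)"
      proof (cases "l = n")
        case True
        then have kn: "k < n" using k l by (auto simp: T_def)
        have "in_row_span n ({..<n} - {i}) V (\<lambda>j. (\<ominus> \<one>) \<otimes> V k j)"
          by (rule in_row_span_smult[OF in_row_span_row]) (use kn k(3) in auto)
        then show ?thesis
          by (rule in_row_span_cong) (use Vl[OF kn] k(3) True in \<open>simp add: minor_def l_minus\<close>)
      next
        case False
        then have "l < n" "l \<noteq> i" "l \<noteq> k" using l by (auto simp: T_def)
        moreover have "in_row_span n ({..<n} - {i}) V (V l)"
          by (rule in_row_span_row) (use \<open>l < n\<close> \<open>l \<noteq> i\<close> in auto)
        ultimately show ?thesis
          by (elim in_row_span_cong) (simp add: Vl minor_def)
      qed
    qed (auto simp: T_def)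
    have "block_det n ?Y = block_det n V"
    proof (rule add_invariant_span[OF inv(1) V(1) i(1) span])
      show "?Y i j = V i j \<oplus> (\<Oplus>l\<in>T. d l \<otimes> M l j)" if "j < n" for j
      proof -
        have "{..<Suc n} - {i} = insert k T" using k by (auto simp: T_def)
        then have "M i j = (\<Oplus>l\<in>insert k T. d l \<otimes> M l j)" using row[OF that] by simp
        also have "\<dots> = d k \<otimes> M k j \<oplus> (\<Oplus>l\<in>T. d l \<otimes> M l j)"
          by (rule finsum_insert) (auto simp: T_def)
        finally show ?thesis using k(3) W(3) by (simp add: V_def scale_row_def minor_def)
      qed
    qed (use Vl in \<open>auto simp: minor_closed\<close>)
    also have "\<dots> = (\<chi> (\<ominus> \<one>) + \<chi> (\<ominus> \<one>)) - \<chi> (x i) + \<chi> (x k) + block_det n ?X"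
      unfolding V(2) W(4) \<chi>d by (simp add: algebra_simps)
    finally show ?thesis unfolding \<chi>_minus_one by (simp add: algebra_simps)
  qed
  consider "i = k" | "i < n" "i \<noteq> k" | "k < n" "i \<noteq> k" using i(1) k(1) by linarith
  then show ?thesis
  proof cases
    case 2 then show ?thesis using main i k by blast
  next
    case 3 then show ?thesis using main[of k i] i k by simp
  qed simp
qed

text \<open>The choices in the recursion are immaterial: the dual vector is unique and the minor may be taken
  at any of its nonzero coordinates.\<close>

lemma block_det_Suc:
  assumes inv: "add_invariant n" "scale_covariant n" and M: "nonsingular (Suc n) M"
    and x: "last_dual n M x" and i: "i < Suc n" "x i \<noteq> \<zero>"
  shows "block_det (Suc n) M = block_det n (minor n i M) - \<chi> (x i)"
proof -
  define y where "y = (SOME x. last_dual n M x)"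
  define k where "k = (SOME i. i < Suc n \<and> y i \<noteq> \<zero>)"
  note e = nonsingular_entry[OF M]
  have y: "last_dual n M y" unfolding y_def by (rule someI_ex[OF last_dual_ex[OF M]])
  have k: "k < Suc n \<and> y k \<noteq> \<zero>" unfolding k_def
    by (rule someI_ex) (use last_dual_nonzero[OF y e] in blast)
  have eq: "x l = y l" if "l < Suc n" for l
  proof -
    note c[simp] = last_dual_closed[OF x] last_dual_closed[OF y]
    have "x l \<oplus> (\<ominus> \<one>) \<otimes> y l = \<zero>"
    proof (rule nonsingular_zero[of "Suc n" M "\<lambda>l. x l \<oplus> (\<ominus> \<one>) \<otimes> y l", OF M _ _ that])
      fix j assume "j < Suc n"
      moreover have "row_comb (Suc n) (\<lambda>l. x l \<oplus> (\<ominus> \<one>) \<otimes> y l) M j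
          = row_comb (Suc n) x M j \<oplus> (\<ominus> \<one>) \<otimes> row_comb (Suc n) y M j"
        using row_comb_add[of x "\<lambda>l. (\<ominus> \<one>) \<otimes> y l" M "Suc n" j]
          row_comb_smult[of "\<ominus> \<one>" y M "Suc n" j] e c by simp
      ultimately show "row_comb (Suc n) (\<lambda>l. x l \<oplus> (\<ominus> \<one>) \<otimes> y l) M j = \<zero>"
        using x y by (simp add: last_dual_def l_minus r_neg)
    qed simp
    then have "x l \<ominus> y l = \<zero>" by (simp add: l_minus minus_eq)
    then show ?thesis by simp
  qed
  have "block_det (Suc n) M = block_det n (minor n k M) - \<chi> (y k)"
    by (simp add: Let_def y_def k_def)
  also have "\<dots> = block_det n (minor n i M) - \<chi> (y i)"
    by (rule minor_independent[OF inv M y]) (use k i eq in auto)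
  finally show ?thesis using eq i by simp
qed

text \<open>Adding \<open>c\<close> times row \<open>q\<close> to row \<open>p\<close> changes only coordinate \<open>q\<close> of the dual vector, by
  \<open>-x\<^sub>p c\<close>. If \<open>x\<^sub>p \<noteq> 0\<close>, the minor at \<open>p\<close> is unaffected by the operation. If \<open>x\<^sub>p = 0\<close>, the dual
  vector is unaffected, and in a minor at some \<open>k \<noteq> p\<close> the operation adds to one row a
  combination of the others, as even row \<open>k\<close> of \<open>M\<close> is a combination of the rows of the minor
  other than the one coming from row \<open>p\<close>.\<close>

lemma add_invariant_Suc:
  assumes inv: "add_invariant n" "scale_covariant n"
  shows "add_invariant (Suc n)"
  unfolding add_invariant_def
proof (intro allI impI)
  fix M p q c assume M: "nonsingular (Suc n) M" and pq: "p < Suc n" "q < Suc n" "p \<noteq> q"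
    and c[simp]: "c \<in> carrier R"
  note e[simp] = nonsingular_entry[OF M]
  let ?N = "add_row p q c M"
  have N: "nonsingular (Suc n) ?N" by (rule nonsingular_add_row) (use M pq in auto)
  note eN[simp] = nonsingular_entry[OF N]
  obtain x where x: "last_dual n M x" using last_dual_ex[OF M] by blast
  note ex[simp] = last_dual_closed[OF x]
  let ?y = "x(q := x q \<ominus> x p \<otimes> c)"
  have "?y(q := ?y q \<oplus> ?y p \<otimes> c) = x"
    using pq by (auto simp: fun_eq_iff minus_eq a_assoc l_neg)
  then have y: "last_dual n ?N ?y"
    using x row_comb_add_row[of ?y M p "Suc n" q c] pq by (simp add: last_dual_def)
  show "block_det (Suc n) ?N = block_det (Suc n) M"
  proof (cases "x p = \<zero>")
    case False
    have "block_det n (minor n p ?N) = block_det n (minor n p M)"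
      by (rule block_det_cong) (use pq in \<open>auto simp: minor_def add_row_def\<close>)
    then show ?thesis
      using block_det_Suc[OF inv M x pq(1) False] block_det_Suc[OF inv N y pq(1)] False pq by simp
  next
    case True
    then have yx: "?y = x" by (auto simp: fun_eq_iff minus_eq)
    obtain k where k: "k < Suc n" "x k \<noteq> \<zero>" using last_dual_nonzero[OF x e] by blast
    have kp: "k \<noteq> p" using k True by blast
    let ?X = "minor n k M"
    have X: "nonsingular n ?X" by (rule nonsingular_minor[OF M x k])
    note eX[simp] = nonsingular_entry[OF X]
    \<comment> \<open>the row of the minor in which row \<open>p\<close> of \<open>M\<close> appears\<close>
    define p' where "p' = (if p = n then k else p)"
    have p': "p' < n" using pq k kp by (auto simp: p'_def)
    define S where "S = {..<n} - {p'}"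
    have fS[simp]: "finite S" by (simp add: S_def)
    have span1: "in_row_span n S ?X (M l)" if l: "l < Suc n" "l \<noteq> p" "l \<noteq> k" for l
    proof (cases "l = n")
      case True
      then have "k \<in> S" using l k kp by (auto simp: S_def p'_def)
      then have "in_row_span n S ?X (\<lambda>j. (\<ominus> \<one>) \<otimes> ?X k j)"
        by (intro in_row_span_smult[OF in_row_span_row]) auto
      then show ?thesis by (rule in_row_span_cong) (use True in \<open>simp add: minor_def l_minus\<close>)
    next
      case False
      then have "l \<in> S" using l by (auto simp: S_def p'_def)
      then have "in_row_span n S ?X (?X l)" by (intro in_row_span_row) auto
      then show ?thesis by (rule in_row_span_cong) (use l in \<open>simp add: minor_def\<close>)
    qed
    have span: "in_row_span n S ?X (M q)"
    proof (cases "q = k")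
      case False
      then show ?thesis using span1 pq by auto
    next
      case q: True
      define d where "d l = \<ominus> (inv (x k) \<otimes> x l)" for l
      have ik: "inv (x k) \<in> carrier R" using inv_skew[OF ex k(2)] by simp
      then have d[simp]: "d l \<in> carrier R" for l by (simp add: d_def)
      have dp: "d p = \<zero>" using True ik by (simp add: d_def)
      have "in_row_span n S ?X (\<lambda>j. \<Oplus>l\<in>{..<Suc n} - {k} - {p}. d l \<otimes> M l j)"
        by (rule in_row_span_sum) (use span1 in auto)
      then show ?thesis
      proof (rule in_row_span_cong)
        fix j assume j: "j < n"
        have "M k j = (\<Oplus>l\<in>{..<Suc n} - {k}. d l \<otimes> M l j)"
          unfolding d_def by (rule last_dual_row[OF e x k j])
        also have "\<dots> = (\<Oplus>l\<in>{..<Suc n} - {k} - {p}. d l \<otimes> M l j)"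
          by (rule add.finprod_mono_neutral_cong_right) (use dp in auto)
        finally show "(\<Oplus>l\<in>{..<Suc n} - {k} - {p}. d l \<otimes> M l j) = M q j" using q by simp
      qed
    qed
    have "block_det n (minor n k ?N) = block_det n ?X"
    proof (rule add_invariant_span[OF inv(1) X p'])
      let ?c = "if p = n then \<ominus> c else c"
      show "in_row_span n ({..<n} - {p'}) ?X (\<lambda>j. ?c \<otimes> M q j)"
        using in_row_span_smult[OF span, of ?c] by (simp add: S_def)
      show "minor n k ?N p' j = ?X p' j \<oplus> ?c \<otimes> M q j" if "j < n" for j
        using kp k by (auto simp: minor_def p'_def add_row_def minus_add l_minus a_comm)
    qed (use kp k in \<open>auto simp: minor_def p'_def add_row_def\<close>)
    then show ?thesis
      using block_det_Suc[OF inv M x k] block_det_Suc[OF inv N y k(1)] k unfolding yx by simp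
  qed
qed

lemma scale_covariant_Suc:
  assumes inv: "add_invariant n" "scale_covariant n"
  shows "scale_covariant (Suc n)"
  unfolding scale_covariant_def
proof (intro allI impI)
  fix M p c assume M: "nonsingular (Suc n) M" and p: "p < Suc n"
    and c[simp]: "c \<in> carrier R" and c0: "c \<noteq> \<zero>"
  note e[simp] = nonsingular_entry[OF M] and ic[simp] = inv_skew[OF c c0]
  let ?N = "scale_row p c M"
  have N: "nonsingular (Suc n) ?N" by (rule nonsingular_scale_row) (use M c0 in auto)
  note eN[simp] = nonsingular_entry[OF N]
  obtain x where x: "last_dual n M x" using last_dual_ex[OF M] by blast
  note ex[simp] = last_dual_closed[OF x]
  let ?y = "x(p := x p \<otimes> inv c)"
  have "?y(p := ?y p \<otimes> c) = x" by (auto simp: fun_eq_iff m_assoc)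
  then have y: "last_dual n ?N ?y"
    using x row_comb_scale_row[of ?y M c "Suc n" p] by (simp add: last_dual_def)
  obtain k where k: "k < Suc n" "x k \<noteq> \<zero>" using last_dual_nonzero[OF x e] by blast
  have yk: "?y k \<noteq> \<zero>" using k mult_nonzero[of "x k" "inv c"] by auto
  have X: "nonsingular n (minor n k M)" by (rule nonsingular_minor[OF M x k])
  note eq = block_det_Suc[OF inv M x k] block_det_Suc[OF inv N y k(1) yk]
  show "block_det (Suc n) ?N = \<chi> c + block_det (Suc n) M"
  proof (cases "k = p")
    case True
    have "block_det n (minor n k ?N) = block_det n (minor n k M)"
      by (rule block_det_cong) (use True p in \<open>auto simp: minor_def scale_row_def\<close>)
    moreover have "\<chi> (?y k) = \<chi> (x k) - \<chi> c" using True k c0 by (simp add: \<chi>_mult \<chi>_inv)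
    ultimately show ?thesis unfolding eq by (simp add: algebra_simps)
  next
    case False
    define p' where "p' = (if p = n then k else p)"
    have p': "p' < n" using p k False by (auto simp: p'_def)
    have "block_det n (minor n k ?N) = block_det n (scale_row p' c (minor n k M))"
      by (rule block_det_cong)
        (use False in \<open>auto simp: minor_def scale_row_def p'_def r_minus\<close>)
    also have "\<dots> = \<chi> c + block_det n (minor n k M)"
      using inv(2) X p' c0 unfolding scale_covariant_def by simp
    finally show ?thesis unfolding eq using False by simp
  qed
qed

lemma block_det_row_ops: "add_invariant n \<and> scale_covariant n"
proof (induction n)
  case 0 show ?case by (simp add: add_invariant_def scale_covariant_def)
next
  case (Suc n) then show ?case using add_invariant_Suc scale_covariant_Suc by blast
qed

lemma nonsingular_stable:
  assumes M: "stable_from R m M" and Nm: "stable_from R m N"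
    and N: "N \<otimes>\<^bsub>SM R\<^esub> M = \<one>\<^bsub>SM R\<^esub>" "M \<otimes>\<^bsub>SM R\<^esub> N = \<one>\<^bsub>SM R\<^esub>"
  shows "nonsingular m M"
proof -
    note e[simp] = stable_from_entry[OF M] stable_from_entry[OF Nm]
    have MN: "(\<Oplus>k\<in>{..<m}. A i k \<otimes> B k j) = (if i = j then \<one> else \<zero>)"
      if "A \<otimes>\<^bsub>SM R\<^esub> B = \<one>\<^bsub>SM R\<^esub>" "stable_from R m A" "stable_from R m B" "i < m" for A B i j
    proof -
      have "(A \<otimes>\<^bsub>SM R\<^esub> B) i j = (\<Oplus>k\<in>{..<m}. A i k \<otimes> B k j)"
        by (rule SM_mult_eq) (use that stable_from_entry stable_from_row_zero[OF that(2)] in auto)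
      then show ?thesis by (simp add: that(1) one_SM)
    qed
    \<comment> \<open>\<open>(x A) B = x\<close> on the first \<open>m\<close> coordinates when \<open>A B = 1\<close>\<close>
    have cancel: "row_comb m (row_comb m x A) B j = x j"
      if AB: "A \<otimes>\<^bsub>SM R\<^esub> B = \<one>\<^bsub>SM R\<^esub>" "stable_from R m A" "stable_from R m B"
        and x: "\<And>i. x i \<in> carrier R" and j: "j < m" for A B x j
    proof -
      note e[simp] = stable_from_entry[OF AB(2)] stable_from_entry[OF AB(3)] x
      have "row_comb m (row_comb m x A) B j = (\<Oplus>k\<in>{..<m}. \<Oplus>i\<in>{..<m}. x i \<otimes> (A i k \<otimes> B k j))"
        unfolding row_comb_def by (simp add: finsum_ldistr m_assoc Pi_def)
      also have "\<dots> = (\<Oplus>i\<in>{..<m}. \<Oplus>k\<in>{..<m}. x i \<otimes> (A i k \<otimes> B k j))"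
        by (rule finsum_swap) auto
      also have "\<dots> = (\<Oplus>i\<in>{..<m}. x i \<otimes> (if i = j then \<one> else \<zero>))"
        by (rule add.finprod_cong') (auto simp: finsum_rdistr[symmetric] MN[OF AB])
      also have "\<dots> = x j \<otimes> (if j = j then \<one> else \<zero>)"
        by (rule finsum_eq_single) (use j in auto)
      finally show ?thesis by simp
    qed
    show "nonsingular m M"
      unfolding nonsingular_def
    proof (intro conjI allI impI)
      show "M i j \<in> carrier R" for i j by simp
    next
      fix x i assume x: "\<forall>i. x i \<in> carrier R" "\<forall>j<m. row_comb m x M j = \<zero>" and i: "i < m"
      have "row_comb m (row_comb m x M) N i = \<zero>"
        unfolding row_comb_def[of m "row_comb m x M"]
        by (rule add.finprod_one_eqI) (use x in simp)
      then show "x i = \<zero>" using cancel[OF N(2) M Nm _ i, of x] x by simp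
    next
      fix y :: "nat \<Rightarrow> 'a" assume y: "\<forall>j. y j \<in> carrier R"
      show "\<exists>x. (\<forall>i. x i \<in> carrier R) \<and> (\<forall>j<m. row_comb m x M j = y j)"
        by (rule exI[of _ "row_comb m y N"]) (use cancel[OF N(1) Nm M, of y] y in auto)
    qed
qed

text \<open>The dual vector is the unit vector itself, so the recursion removes the last row and column.\<close>

lemma block_det_stable:
  assumes M: "nonsingular m M" "nonsingular (Suc m) M" "stable_from R m M"
  shows "block_det (Suc m) M = block_det m M"
proof -
  note e[simp] = stable_from_entry[OF M(3)]
  let ?x = "\<lambda>i. if i = m then \<one> else \<zero>"
  have "row_comb (Suc m) ?x M j = M m j" for j
    unfolding row_comb_def by (subst finsum_eq_single[of _ m]) auto
  then have "last_dual m M ?x" using M(3) by (auto simp: last_dual_def stable_from_def)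
  then have "block_det (Suc m) M = block_det m (minor m m M)"
    using block_det_Suc[of m M ?x m] block_det_row_ops M one_neq_zero \<chi>_one by simp
  also have "\<dots> = block_det m M"
    by (rule block_det_cong) (auto simp: minor_def)
  finally show ?thesis .
qed

text \<open>For an invertible stable matrix the determinant of the upper left \<open>n \<times> n\<close> block is eventually
  constant.\<close>

definition GL_det :: "(nat \<Rightarrow> nat \<Rightarrow> 'a) \<Rightarrow> 'c" where
  "GL_det M = (THE d. \<exists>n. \<forall>m\<ge>n. block_det m M = d)"

lemma GL_det_eqI:
  assumes "\<And>m. n \<le> m \<Longrightarrow> block_det m M = d" shows "GL_det M = d"
  unfolding GL_det_def
proof (rule the_equality)
  show "\<exists>n. \<forall>m\<ge>n. block_det m M = d" using assms by blast
  fix e assume "\<exists>k. \<forall>m\<ge>k. block_det m M = e"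
  then obtain k where "\<forall>m\<ge>k. block_det m M = e" by blast
  then have "block_det (max k n) M = e" by simp
  then show "e = d" using assms[of "max k n"] by simp
qed

lemma GL_det_eventually:
  assumes "M \<in> carrier (stable_GL R)"
  obtains n where "\<And>m. n \<le> m \<Longrightarrow> nonsingular m M" "\<And>m. n \<le> m \<Longrightarrow> block_det m M = GL_det M"
proof -
  obtain N where N: "N \<in> carrier (SM R)" "N \<otimes>\<^bsub>SM R\<^esub> M = \<one>\<^bsub>SM R\<^esub>" "M \<otimes>\<^bsub>SM R\<^esub> N = \<one>\<^bsub>SM R\<^esub>"
    using assms unfolding GL_carrier_iff by blast
  obtain a b where "stable_from R a M" "stable_from R b N"
    using assms N(1) by (auto simp: GL_carrier_iff carrier_SM)
  then have n: "nonsingular m M \<and> stable_from R m M" if "max a b \<le> m" for m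
    using that nonsingular_stable[of m M N] N(2,3) stable_from_mono by auto
  define n where "n = max a b"
  note n = n[folded n_def]
  have eq: "block_det m M = block_det n M" if "n \<le> m" for m
    using that by (induction m rule: dec_induct) (use n block_det_stable in auto)
  have "GL_det M = block_det n M" by (rule GL_det_eqI[OF eq])
  then show ?thesis using that n eq by metis
qed

lemma GL_det_scale_row:
  assumes M: "M \<in> carrier (stable_GL R)" and a: "a \<in> carrier R" "a \<noteq> \<zero>"
  shows "GL_det (scale_row p a M) = \<chi> a + GL_det M"
proof -
  obtain n where n: "\<And>m. n \<le> m \<Longrightarrow> nonsingular m M" "\<And>m. n \<le> m \<Longrightarrow> block_det m M = GL_det M"
    using GL_det_eventually[OF M] by blast
  show ?thesis
    by (rule GL_det_eqI[of "Suc (n + p)"])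
      (use n a block_det_row_ops in \<open>auto simp: scale_covariant_def\<close>)
qed

lemma GL_det_add_row:
  assumes M: "M \<in> carrier (stable_GL R)" and c: "c \<in> carrier R" "i \<noteq> j"
  shows "GL_det (add_row i j c M) = GL_det M"
proof -
  obtain n where n: "\<And>m. n \<le> m \<Longrightarrow> nonsingular m M" "\<And>m. n \<le> m \<Longrightarrow> block_det m M = GL_det M"
    using GL_det_eventually[OF M] by blast
  show ?thesis
    by (rule GL_det_eqI[of "Suc (n + i + j)"])
      (use n c block_det_row_ops in \<open>auto simp: add_invariant_def\<close>)
qed

lemma GL_det_transvection:
  assumes M: "M \<in> carrier (stable_GL R)" and c: "c \<in> carrier R" "i \<noteq> j"
  shows "GL_det (transvection i j c \<otimes>\<^bsub>SM R\<^esub> M) = GL_det M"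
  using GL_det_add_row[OF assms] transvection_mult[OF c GL_entry[OF M]] by simp

lemma GL_det_corner_mult:
  assumes M: "M \<in> carrier (stable_GL R)" and a: "a \<in> Units R"
  shows "GL_det (corner a \<otimes>\<^bsub>SM R\<^esub> M) = \<chi> a + GL_det M"
  using GL_det_scale_row[OF M, of a 0] corner_mult[OF _ GL_entry[OF M], of a] a skew_field_Units
  by simp

lemma GL_det_one: "GL_det \<one>\<^bsub>SM R\<^esub> = 0"
proof -
  interpret G: group "stable_GL R" by (rule GL_group)
  have o: "\<one>\<^bsub>SM R\<^esub> \<in> carrier (stable_GL R)" using G.one_closed by (simp add: GL_one)
  obtain n where n: "\<And>k. n \<le> k \<Longrightarrow> block_det k \<one>\<^bsub>SM R\<^esub> = GL_det \<one>\<^bsub>SM R\<^esub>"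
    using GL_det_eventually[OF o] by blast
  have st: "stable_from R m \<one>\<^bsub>SM R\<^esub>" for m by (simp add: stable_from_def one_SM)
  have ns: "nonsingular m \<one>\<^bsub>SM R\<^esub>" for m
    by (rule nonsingular_stable[OF st st]) (use G.l_one[OF G.one_closed] in \<open>auto simp: GL_mult GL_one\<close>)
  have "block_det m \<one>\<^bsub>SM R\<^esub> = 0" for m
    by (induction m) (use block_det_stable[OF ns ns st] in auto)
  then show ?thesis using n by auto
qed

text \<open>By elimination the left factor may be taken to be a transvection or \<open>diag(a, 1, 1, \<dots>)\<close>.\<close>

lemma GL_det_mult:
  assumes "M \<in> carrier (stable_GL R)" and N: "N \<in> carrier (stable_GL R)"
  shows "GL_det (M \<otimes>\<^bsub>SM R\<^esub> N) = GL_det M + GL_det N"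
  using assms(1)
proof (induction rule: GL_induct)
  interpret G: group "stable_GL R" by (rule GL_group)
  {
    case one
    then show ?case using G.l_one[OF N] GL_det_one by (simp add: GL_mult GL_one)
  next
    case (add M i j c)
    have "(transvection i j c \<otimes>\<^bsub>SM R\<^esub> M) \<otimes>\<^bsub>SM R\<^esub> N = transvection i j c \<otimes>\<^bsub>SM R\<^esub> (M \<otimes>\<^bsub>SM R\<^esub> N)"
      using G.m_assoc[OF transvection_GL] add N by (simp add: GL_mult)
    then show ?case using GL_det_transvection[of "M \<otimes>\<^bsub>SM R\<^esub> N"] GL_det_transvection[of M]
        G.m_closed[of M N] add N by (simp add: GL_mult)
  next
    case (scale M a)
    have "(corner a \<otimes>\<^bsub>SM R\<^esub> M) \<otimes>\<^bsub>SM R\<^esub> N = corner a \<otimes>\<^bsub>SM R\<^esub> (M \<otimes>\<^bsub>SM R\<^esub> N)"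
      using G.m_assoc[OF corner_GL] scale N by (simp add: GL_mult)
    then show ?case using GL_det_corner_mult[of "M \<otimes>\<^bsub>SM R\<^esub> N"] GL_det_corner_mult[of M]
        G.m_closed[of M N] scale N by (simp add: GL_mult add.assoc)
  }
qed

lemma GL_det_corner: "a \<in> Units R \<Longrightarrow> GL_det (corner a) = \<chi> a"
  using GL_det_corner_mult[of "\<one>\<^bsub>SM R\<^esub>" a] GL_det_one monoid.r_one[OF SM_monoid corner_SM]
    group.is_monoid[OF GL_group, THEN monoid.one_closed] by (auto simp: GL_one)

end

section \<open>Blocks of size two\<close>

lemma carrier_matrix_ring: "M \<in> carrier (matrix_ring n R) \<longleftrightarrow>
    (\<forall>i j. M i j \<in> carrier R) \<and> (\<forall>i j. n \<le> i \<or> n \<le> j \<longrightarrow> M i j = \<zero>\<^bsub>R\<^esub>)"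
  by (simp add: matrix_ring_def)

lemma matrix_ring_simps:
  "zero (matrix_ring n R) = (\<lambda>i j. \<zero>\<^bsub>R\<^esub>)"
  "one (matrix_ring n R) = (\<lambda>i j. if i = j \<and> i < n then \<one>\<^bsub>R\<^esub> else \<zero>\<^bsub>R\<^esub>)"
  "add (matrix_ring n R) M N = (\<lambda>i j. M i j \<oplus>\<^bsub>R\<^esub> N i j)"
  "mult (matrix_ring n R) M N = (\<lambda>i j. \<Oplus>\<^bsub>R\<^esub>k\<in>{..<n}. M i k \<otimes>\<^bsub>R\<^esub> N k j)"
  by (simp_all add: matrix_ring_def)

context ring
begin

lemma matrix_ring_ring: "ring (matrix_ring n R)"
proof (rule ringI)
  let ?A = "matrix_ring n R"
  note ms = carrier_matrix_ring matrix_ring_simps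
  show "abelian_group ?A"
  proof (rule abelian_groupI)
    fix M assume M: "M \<in> carrier ?A"
    then show "\<exists>N\<in>carrier ?A. N \<oplus>\<^bsub>?A\<^esub> M = \<zero>\<^bsub>?A\<^esub>"
      by (intro bexI[of _ "\<lambda>i j. \<ominus> M i j"]) (auto simp: ms fun_eq_iff l_neg)
  qed (auto simp: ms fun_eq_iff a_ac)
  show "monoid ?A"
  proof (rule monoidI)
    fix M N assume "M \<in> carrier ?A" "N \<in> carrier ?A"
    then show "M \<otimes>\<^bsub>?A\<^esub> N \<in> carrier ?A"
      by (auto simp: ms intro!: finsum_closed add.finprod_one_eqI)
  next
    fix M N P assume "M \<in> carrier ?A" "N \<in> carrier ?A" "P \<in> carrier ?A"
    then have e[simp]: "M i j \<in> carrier R" "N i j \<in> carrier R" "P i j \<in> carrier R" for i j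
      by (auto simp: ms)
    show "(M \<otimes>\<^bsub>?A\<^esub> N) \<otimes>\<^bsub>?A\<^esub> P = M \<otimes>\<^bsub>?A\<^esub> (N \<otimes>\<^bsub>?A\<^esub> P)"
    proof (intro ext)
      fix i j
      have "((M \<otimes>\<^bsub>?A\<^esub> N) \<otimes>\<^bsub>?A\<^esub> P) i j = (\<Oplus>l\<in>{..<n}. \<Oplus>k\<in>{..<n}. M i k \<otimes> (N k l \<otimes> P l j))"
        by (simp add: ms finsum_ldistr Pi_def m_assoc)
      also have "\<dots> = (\<Oplus>k\<in>{..<n}. \<Oplus>l\<in>{..<n}. M i k \<otimes> (N k l \<otimes> P l j))"
        by (rule finsum_swap) auto
      also have "\<dots> = (M \<otimes>\<^bsub>?A\<^esub> (N \<otimes>\<^bsub>?A\<^esub> P)) i j"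
        by (simp add: ms finsum_rdistr Pi_def)
      finally show "((M \<otimes>\<^bsub>?A\<^esub> N) \<otimes>\<^bsub>?A\<^esub> P) i j = (M \<otimes>\<^bsub>?A\<^esub> (N \<otimes>\<^bsub>?A\<^esub> P)) i j" .
    qed
  next
    fix M assume M: "M \<in> carrier ?A"
    then have e[simp]: "M i j \<in> carrier R" for i j by (auto simp: ms)
    have z: "M i j = \<zero>" if "n \<le> i \<or> n \<le> j" for i j using M that by (auto simp: ms)
    show "\<one>\<^bsub>?A\<^esub> \<otimes>\<^bsub>?A\<^esub> M = M"
    proof (intro ext)
      fix i j
      show "(\<one>\<^bsub>?A\<^esub> \<otimes>\<^bsub>?A\<^esub> M) i j = M i j"
      proof (cases "i < n")
        case True
        then show ?thesis unfolding ms by (subst finsum_eq_single[of _ i]) auto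
      next
        case False
        then show ?thesis unfolding ms using z by (subst add.finprod_one_eqI) auto
      qed
    qed
    show "M \<otimes>\<^bsub>?A\<^esub> \<one>\<^bsub>?A\<^esub> = M"
    proof (intro ext)
      fix i j
      show "(M \<otimes>\<^bsub>?A\<^esub> \<one>\<^bsub>?A\<^esub>) i j = M i j"
      proof (cases "j < n")
        case True
        then show ?thesis unfolding ms by (subst finsum_eq_single[of _ j]) auto
      next
        case False
        then show ?thesis unfolding ms using z by (subst add.finprod_one_eqI) auto
      qed
    qed
  qed (auto simp: ms)
qed (auto simp: carrier_matrix_ring matrix_ring_simps fun_eq_iff l_distr r_distr finsum_addf Pi_def)

lemma matrix_ring_finsum:
  assumes "finite S" "\<And>k. k \<in> S \<Longrightarrow> f k \<in> carrier (matrix_ring n R)"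
  shows "finsum (matrix_ring n R) f S i j = (\<Oplus>k\<in>S. f k i j)"
proof -
  interpret A: ring "matrix_ring n R" by (rule matrix_ring_ring)
  show ?thesis using assms
  proof (induction S)
    case empty then show ?case by (simp add: matrix_ring_simps)
  next
    case (insert x S)
    have e: "f k i j \<in> carrier R" if "k \<in> insert x S" for k
      using insert.prems[OF that] by (simp add: carrier_matrix_ring)
    have "finsum (matrix_ring n R) f (insert x S)
        = f x \<oplus>\<^bsub>matrix_ring n R\<^esub> finsum (matrix_ring n R) f S"
      by (rule A.finsum_insert) (use insert in auto)
    then have "finsum (matrix_ring n R) f (insert x S) i j = f x i j \<oplus> (\<Oplus>k\<in>S. f k i j)"
      using insert by (simp add: matrix_ring_simps)
    also have "\<dots> = (\<Oplus>k\<in>insert x S. f k i j)"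
      by (rule finsum_insert[symmetric]) (use insert e in auto)
    finally show ?case .
  qed
qed

text \<open>A stable matrix with \<open>2 \<times> 2\<close> matrices as entries is read as a stable matrix of scalars, the row
  index \<open>2 i + a\<close> standing for row \<open>a\<close> of block row \<open>i\<close>. The inverse map has to pad each block with
  zeros.\<close>

definition merge_blocks :: "(nat \<Rightarrow> nat \<Rightarrow> nat \<Rightarrow> nat \<Rightarrow> 'a) \<Rightarrow> nat \<Rightarrow> nat \<Rightarrow> 'a" where
  "merge_blocks M = (\<lambda>i j. M (i div 2) (j div 2) (i mod 2) (j mod 2))"

definition split_blocks :: "(nat \<Rightarrow> nat \<Rightarrow> 'a) \<Rightarrow> nat \<Rightarrow> nat \<Rightarrow> nat \<Rightarrow> nat \<Rightarrow> 'a" where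
  "split_blocks N = (\<lambda>i j a b. if a < 2 \<and> b < 2 then N (2 * i + a) (2 * j + b) else \<zero>)"

abbreviation M2 :: "(nat \<Rightarrow> nat \<Rightarrow> 'a) ring" where "M2 \<equiv> matrix_ring 2 R"

lemma merge_blocks_split_blocks: "merge_blocks (split_blocks N) = N"
  by (auto simp: merge_blocks_def split_blocks_def fun_eq_iff)

lemma split_blocks_merge_blocks:
  assumes "\<And>i j. M i j \<in> carrier M2" shows "split_blocks (merge_blocks M) = M"
proof (intro ext)
  fix i j a b
  show "split_blocks (merge_blocks M) i j a b = M i j a b"
    using assms[of i j] by (auto simp: merge_blocks_def split_blocks_def carrier_matrix_ring not_less)
qed

lemma merge_blocks_stable:
  assumes M: "stable_from M2 n M" shows "stable_from R (2 * n) (merge_blocks M)"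
  unfolding stable_from_def
proof (intro conjI allI impI)
  fix i j
  have "M (i div 2) (j div 2) \<in> carrier M2" using M by (rule stable_from_entry)
  then show "merge_blocks M i j \<in> carrier R" by (simp add: merge_blocks_def carrier_matrix_ring)
  assume "2 * n \<le> i \<or> 2 * n \<le> j"
  then have "n \<le> i div 2 \<or> n \<le> j div 2" by auto
  then have "M (i div 2) (j div 2) = (if i div 2 = j div 2 then \<one>\<^bsub>M2\<^esub> else \<zero>\<^bsub>M2\<^esub>)"
    using M by (auto simp: stable_from_def)
  moreover have "i = j \<longleftrightarrow> i div 2 = j div 2 \<and> i mod 2 = j mod 2"
    by (metis div_mult_mod_eq)
  ultimately show "merge_blocks M i j = (if i = j then \<one> else \<zero>)"
    by (simp add: merge_blocks_def matrix_ring_simps)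
qed

lemma split_blocks_stable:
  assumes N: "stable_from R n N" shows "stable_from M2 n (split_blocks N)"
  unfolding stable_from_def
proof (intro conjI allI impI)
  fix i j
  show "split_blocks N i j \<in> carrier M2"
    using stable_from_entry[OF N] by (simp add: split_blocks_def carrier_matrix_ring)
  assume "n \<le> i \<or> n \<le> j"
  then have *: "n \<le> 2 * i + a \<or> n \<le> 2 * j + b" for a b by auto
  have "split_blocks N i j a b = (if i = j then \<one>\<^bsub>M2\<^esub> else \<zero>\<^bsub>M2\<^esub>) a b" for a b
  proof (cases "a < 2 \<and> b < 2")
    case True
    then have "2 * i + a = 2 * j + b \<longleftrightarrow> i = j \<and> a = b" by presburger
    moreover have "N (2 * i + a) (2 * j + b) = (if 2 * i + a = 2 * j + b then \<one> else \<zero>)"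
      using N *[of a b] unfolding stable_from_def by blast
    ultimately show ?thesis using True by (simp add: split_blocks_def matrix_ring_simps)
  next
    case False
    then show ?thesis by (auto simp: split_blocks_def matrix_ring_simps)
  qed
  then show "split_blocks N i j = (if i = j then \<one>\<^bsub>M2\<^esub> else \<zero>\<^bsub>M2\<^esub>)" by blast
qed

lemma finsum_pairs:
  fixes m :: nat
  assumes "\<And>l. g l \<in> carrier R"
  shows "(\<Oplus>l\<in>{..<2 * m}. g l) = (\<Oplus>k\<in>{..<m}. \<Oplus>c\<in>{..<2}. g (2 * k + c))"
proof (induction m)
  case 0 show ?case by simp
next
  case (Suc m)
  have "{..<2 * Suc m} = insert (2 * m + 1) (insert (2 * m) {..<2 * m})" by auto
  then show ?case using Suc assms by (simp add: lessThan_Suc numeral_2_eq_2 Pi_def a_ac)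
qed

lemma merge_blocks_mult:
  assumes M: "M \<in> carrier (SM M2)" and N: "N \<in> carrier (SM M2)"
  shows "merge_blocks (M \<otimes>\<^bsub>SM M2\<^esub> N) = merge_blocks M \<otimes>\<^bsub>SM R\<^esub> merge_blocks N"
proof (intro ext)
  fix i j
  interpret A: ring M2 by (rule matrix_ring_ring)
  obtain n where n: "stable_from M2 n M" using M by (auto simp: carrier_SM)
  note eM[simp] = SM_entry[OF M] and eN[simp] = SM_entry[OF N]
  have eM'[simp]: "M i j a b \<in> carrier R" and eN'[simp]: "N i j a b \<in> carrier R" for i j a b
    using eM[of i j] eN[of i j] unfolding carrier_matrix_ring by blast+
  have f: "merge_blocks M i j \<in> carrier R" "merge_blocks N i j \<in> carrier R" for i j by (simp_all add: merge_blocks_def)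
  define m where "m = Suc (n + i)"
  have two: "{..<2::nat} = {0, 1}" by auto
  have "merge_blocks (M \<otimes>\<^bsub>SM M2\<^esub> N) i j
      = (finsum M2 (\<lambda>k. M (i div 2) k \<otimes>\<^bsub>M2\<^esub> N k (j div 2)) {..<m}) (i mod 2) (j mod 2)"
    unfolding merge_blocks_def
    by (subst A.SM_mult_eq[where m = m]) (auto simp: m_def intro: A.stable_from_row_zero[OF n])
  also have "\<dots> = (\<Oplus>k\<in>{..<m}. (M (i div 2) k \<otimes>\<^bsub>M2\<^esub> N k (j div 2)) (i mod 2) (j mod 2))"
    by (rule matrix_ring_finsum) auto
  also have "\<dots> = (\<Oplus>k\<in>{..<m}. \<Oplus>c\<in>{..<2}. merge_blocks M i (2 * k + c) \<otimes> merge_blocks N (2 * k + c) j)"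
    by (simp add: matrix_ring_simps merge_blocks_def Pi_def two)
  also have "\<dots> = (\<Oplus>l\<in>{..<2 * m}. merge_blocks M i l \<otimes> merge_blocks N l j)"
    by (rule finsum_pairs[symmetric]) (use f in simp)
  also have "\<dots> = (merge_blocks M \<otimes>\<^bsub>SM R\<^esub> merge_blocks N) i j"
    by (rule SM_mult_eq[symmetric])
      (use f stable_from_row_zero[OF merge_blocks_stable[OF n]] in \<open>auto simp: m_def\<close>)
  finally show "merge_blocks (M \<otimes>\<^bsub>SM M2\<^esub> N) i j = (merge_blocks M \<otimes>\<^bsub>SM R\<^esub> merge_blocks N) i j" .
qed

lemma merge_blocks_one: "merge_blocks \<one>\<^bsub>SM M2\<^esub> = \<one>\<^bsub>SM R\<^esub>"
proof (intro ext)
  fix i j :: nat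
  have "i = j \<longleftrightarrow> i div 2 = j div 2 \<and> i mod 2 = j mod 2" by (metis div_mult_mod_eq)
  then show "merge_blocks \<one>\<^bsub>SM M2\<^esub> i j = \<one>\<^bsub>SM R\<^esub> i j"
    by (simp add: merge_blocks_def one_SM matrix_ring_simps)
qed

lemma merge_blocks_SM: "M \<in> carrier (SM M2) \<Longrightarrow> merge_blocks M \<in> carrier (SM R)"
  unfolding carrier_SM by (metis merge_blocks_stable)

lemma split_blocks_SM: "N \<in> carrier (SM R) \<Longrightarrow> split_blocks N \<in> carrier (SM M2)"
  unfolding carrier_SM by (metis split_blocks_stable)

lemma split_blocks_mult:
  assumes "M \<in> carrier (SM R)" "N \<in> carrier (SM R)"
  shows "split_blocks (M \<otimes>\<^bsub>SM R\<^esub> N) = split_blocks M \<otimes>\<^bsub>SM M2\<^esub> split_blocks N"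
proof -
  interpret A: ring M2 by (rule matrix_ring_ring)
  let ?P = "split_blocks M \<otimes>\<^bsub>SM M2\<^esub> split_blocks N"
  have P: "?P \<in> carrier (SM M2)"
    using monoid.m_closed[OF A.SM_monoid] split_blocks_SM assms by blast
  have "merge_blocks ?P = M \<otimes>\<^bsub>SM R\<^esub> N"
    using merge_blocks_mult split_blocks_SM assms merge_blocks_split_blocks by metis
  then show ?thesis using split_blocks_merge_blocks[of ?P, OF SM_entry[OF P]] by simp
qed

lemma split_blocks_one: "split_blocks \<one>\<^bsub>SM R\<^esub> = \<one>\<^bsub>SM M2\<^esub>"
proof -
  interpret A: ring M2 by (rule matrix_ring_ring)
  show ?thesis
    using split_blocks_merge_blocks[of "\<one>\<^bsub>SM M2\<^esub>", OF SM_entry[OF monoid.one_closed[OF A.SM_monoid]]]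
      merge_blocks_one by simp
qed

lemma merge_blocks_GL: "M \<in> carrier (stable_GL M2) \<Longrightarrow> merge_blocks M \<in> carrier (stable_GL R)"
  unfolding GL_carrier_iff ring.GL_carrier_iff[OF matrix_ring_ring]
  using merge_blocks_SM merge_blocks_mult merge_blocks_one by metis

lemma split_blocks_GL: "M \<in> carrier (stable_GL R) \<Longrightarrow> split_blocks M \<in> carrier (stable_GL M2)"
  unfolding GL_carrier_iff ring.GL_carrier_iff[OF matrix_ring_ring]
  using split_blocks_SM split_blocks_mult split_blocks_one by metis

lemma split_blocks_group_hom: "group_hom (stable_GL R) (stable_GL M2) split_blocks"
  using GL_group ring.GL_group[OF matrix_ring_ring] split_blocks_GL split_blocks_mult
  by (auto simp: group_hom_def group_hom_axioms_def hom_def GL_mult ring.GL_mult[OF matrix_ring_ring]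
      GL_carrier_iff)

lemma split_blocks_commutators:
  "C \<in> GL_commutators R \<Longrightarrow> split_blocks C \<in> GL_commutators M2"
proof -
  assume C: "C \<in> GL_commutators R"
  interpret h: group_hom "stable_GL R" "stable_GL M2" split_blocks by (rule split_blocks_group_hom)
  have "split_blocks C \<in> split_blocks ` GL_commutators R" using C by blast
  also have "\<dots> = derived (stable_GL M2) (split_blocks ` carrier (stable_GL R))"
    by (rule h.derived_img[symmetric]) simp
  also have "\<dots> \<subseteq> GL_commutators M2" by (rule h.H.mono_derived) (use split_blocks_GL in blast)
  finally show ?thesis .
qed

section \<open>Matrices over the center and \<open>CK\<^sub>1\<close>\<close>

lemma center_subring: "subring (ring_center R) R"
proof (rule subringI)
  fix h assume h: "h \<in> ring_center R"
  then show "\<ominus> h \<in> ring_center R" by (auto simp: ring_center_def l_minus r_minus)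
  fix k assume k: "k \<in> ring_center R"
  show "h \<oplus> k \<in> ring_center R" using h k by (auto simp: ring_center_def l_distr r_distr)
  have c: "h \<in> carrier R" "k \<in> carrier R" using h k unfolding ring_center_def by blast+
  have "h \<otimes> k \<otimes> x = x \<otimes> (h \<otimes> k)" if x: "x \<in> carrier R" for x
  proof -
    have hx: "h \<otimes> x = x \<otimes> h" and kx: "k \<otimes> x = x \<otimes> k" using h k x by (auto simp: ring_center_def)
    have "h \<otimes> k \<otimes> x = h \<otimes> x \<otimes> k" unfolding m_assoc[OF c x] kx m_assoc[OF c(1) x c(2)] ..
    then show ?thesis unfolding hx m_assoc[OF x c] .
  qed
  then show "h \<otimes> k \<in> ring_center R" using m_closed[OF c] unfolding ring_center_def by blast
qed (auto simp: ring_center_def)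

lemma center_ring_ring: "ring (center_ring R)"
  by (rule subring_is_ring[OF center_subring])

lemma center_closed: "z \<in> ring_center R \<Longrightarrow> z \<in> carrier R"
  by (simp add: ring_center_def)

text \<open>The sums in the product of stable matrices do not depend on whether they are formed in the ring or
  in its center, so that stable matrices over the center form a submonoid.\<close>

lemma finsum_center:
  assumes "finite S" "\<And>k. k \<in> S \<Longrightarrow> f k \<in> ring_center R"
  shows "finsum (center_ring R) f S = finsum R f S"
proof -
  interpret Z: ring "center_ring R" by (rule center_ring_ring)
  show ?thesis using assms
  proof (induction S)
    case empty then show ?case using Z.finsum_empty finsum_empty by simp
  next
    case (insert x S)
    have "finsum (center_ring R) f (insert x S) = f x \<oplus>\<^bsub>center_ring R\<^esub> finsum (center_ring R) f S"
      by (rule Z.finsum_insert) (use insert in auto)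
    also have "\<dots> = f x \<oplus> finsum R f S" using insert by simp
    also have "\<dots> = finsum R f (insert x S)"
      by (rule finsum_insert[symmetric]) (use insert center_closed in auto)
    finally show ?case .
  qed
qed

lemma SM_center_closed: "M \<in> carrier (SM (center_ring R)) \<Longrightarrow> M \<in> carrier (SM R)"
  unfolding carrier_SM
proof (elim exE)
  fix n assume n: "stable_from (center_ring R) n M"
  have "stable_from R n M"
    unfolding stable_from_def
  proof (intro conjI allI impI)
    show "M i j \<in> carrier R" for i j
      using stable_from_entry[OF n, of i j] center_closed by simp
    show "M i j = (if i = j then \<one> else \<zero>)" if "n \<le> i \<or> n \<le> j" for i j
      using n that unfolding stable_from_def by auto
  qed
  then show "\<exists>n. stable_from R n M" ..
qed

lemma SM_center_mult:
  assumes M: "M \<in> carrier (SM (center_ring R))" and N: "N \<in> carrier (SM (center_ring R))"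
  shows "M \<otimes>\<^bsub>SM (center_ring R)\<^esub> N = M \<otimes>\<^bsub>SM R\<^esub> N"
proof (intro ext)
  fix i j
  interpret Z: ring "center_ring R" by (rule center_ring_ring)
  obtain n where n: "stable_from (center_ring R) n M" using M by (auto simp: carrier_SM)
  have z: "M i k = \<zero>" if "n + i < k" for k
    using Z.stable_from_row_zero[OF n, of k i] that by simp
  have fin: "finite {k. M i k \<noteq> \<zero>}"
    by (rule finite_subset[of _ "{..n + i}"]) (use z in \<open>auto simp: not_less[symmetric]\<close>)
  have e: "M i j \<in> ring_center R" "N i j \<in> ring_center R" for i j
    using SM_entry[OF M] SM_entry[OF N] by simp_all
  show "(M \<otimes>\<^bsub>SM (center_ring R)\<^esub> N) i j = (M \<otimes>\<^bsub>SM R\<^esub> N) i j"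
    using finsum_center[OF fin, of "\<lambda>k. M i k \<otimes> N k j"] e Z.m_closed
    by (simp add: stable_matrix_monoid_def)
qed

lemma SM_center_one: "\<one>\<^bsub>SM (center_ring R)\<^esub> = \<one>\<^bsub>SM R\<^esub>"
  by (auto simp: one_SM fun_eq_iff)

lemma GL_center_closed: "M \<in> carrier (stable_GL (center_ring R)) \<Longrightarrow> M \<in> carrier (stable_GL R)"
  unfolding GL_carrier_iff ring.GL_carrier_iff[OF center_ring_ring]
  using SM_center_closed SM_center_mult SM_center_one by metis

lemma GL_center_group_hom: "group_hom (stable_GL (center_ring R)) (stable_GL R) (\<lambda>x. x)"
proof (intro group_hom.intro group_hom_axioms.intro homI)
  fix M N assume "M \<in> carrier (stable_GL (center_ring R))" "N \<in> carrier (stable_GL (center_ring R))"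
  then show "M \<otimes>\<^bsub>stable_GL (center_ring R)\<^esub> N = M \<otimes>\<^bsub>stable_GL R\<^esub> N"
    using SM_center_mult
    by (simp add: GL_mult ring.GL_mult[OF center_ring_ring] ring.GL_carrier_iff[OF center_ring_ring])
qed (use GL_group ring.GL_group[OF center_ring_ring] GL_center_closed in auto)

lemma GL_center_commutators: "GL_commutators (center_ring R) \<subseteq> GL_commutators R"
proof -
  interpret h: group_hom "stable_GL (center_ring R)" "stable_GL R" "\<lambda>x. x"
    by (rule GL_center_group_hom)
  have "GL_commutators (center_ring R) = derived (stable_GL R) (carrier (stable_GL (center_ring R)))"
    using h.derived_img[of "carrier (stable_GL (center_ring R))"] by simp
  also have "\<dots> \<subseteq> GL_commutators R" by (rule h.H.mono_derived) (use GL_center_closed in blast)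
  finally show ?thesis .
qed

text \<open>All representatives of a class over the center give the same coset, since commutators over the
  center are commutators over the ring.\<close>

lemma K1_map_center:
  assumes M: "M \<in> carrier (stable_GL (center_ring R))"
  shows "K1_map R (\<lambda>x. x) (GL_commutators (center_ring R) #>\<^bsub>stable_GL (center_ring R)\<^esub> M)
     = GL_commutators R #>\<^bsub>stable_GL R\<^esub> M"
proof -
  interpret h: group_hom "stable_GL (center_ring R)" "stable_GL R" "\<lambda>x. x"
    by (rule GL_center_group_hom)
  interpret D: subgroup "GL_commutators R" "stable_GL R" by (rule h.H.derived_is_subgroup) simp
  interpret E: subgroup "GL_commutators (center_ring R)" "stable_GL (center_ring R)"
    by (rule h.G.derived_is_subgroup) simp
  have c: "GL_commutators R #>\<^bsub>stable_GL R\<^esub> (C \<otimes>\<^bsub>stable_GL (center_ring R)\<^esub> M)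
      = GL_commutators R #>\<^bsub>stable_GL R\<^esub> M" if C: "C \<in> GL_commutators (center_ring R)" for C
  proof -
    have C': "C \<in> GL_commutators R" using C GL_center_commutators by blast
    have "GL_commutators R #>\<^bsub>stable_GL R\<^esub> (C \<otimes>\<^bsub>stable_GL (center_ring R)\<^esub> M)
        = GL_commutators R #>\<^bsub>stable_GL R\<^esub> C #>\<^bsub>stable_GL R\<^esub> M"
      using C M E.mem_carrier by (simp add: h.H.coset_mult_assoc GL_center_closed D.subset)
    then show ?thesis using h.H.coset_join2[OF _ D.subgroup_axioms C'] D.mem_carrier[OF C'] by simp
  qed
  show ?thesis
    unfolding K1_map_def r_coset_def[of "stable_GL (center_ring R)"] using c E.one_closed by auto
qed

text \<open>The quotient of \<open>K\<^sub>1\<close> by the image of the center is trivial exactly if that image is all of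
  \<open>K\<^sub>1\<close>.\<close>

lemma trivial_CK1_iff:
  "trivial_group (CK1 R) \<longleftrightarrow> (\<forall>g\<in>carrier (stable_GL R). \<exists>C\<in>GL_commutators R.
     \<exists>M\<in>carrier (stable_GL (center_ring R)). g = C \<otimes>\<^bsub>stable_GL R\<^esub> M)"
proof -
  let ?G = "stable_GL R" and ?D = "GL_commutators R"
  interpret G: group ?G by (rule GL_group)
  interpret Z: group "stable_GL (center_ring R)" by (rule ring.GL_group[OF center_ring_ring])
  interpret D: normal ?D ?G by (rule G.derived_self_is_normal)
  interpret K: comm_group "K1 R" unfolding K1_def by (rule G.derived_quot_is_comm_group)
  define S where "S = K1_map R (\<lambda>x. x) ` carrier (K1 (center_ring R))"
  have CK: "CK1 R = K1 R Mod S" by (simp add: CK1_def S_def)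
  have S: "S = (\<lambda>M. ?D #>\<^bsub>?G\<^esub> M) ` carrier (stable_GL (center_ring R))"
    unfolding S_def K1_def carrier_FactGroup image_image using K1_map_center by (auto cong: image_cong)
  have cK: "carrier (K1 R) = (\<lambda>M. ?D #>\<^bsub>?G\<^esub> M) ` carrier ?G"
    unfolding K1_def carrier_FactGroup ..
  have sub: "S \<subseteq> carrier (K1 R)" unfolding S cK using GL_center_closed by blast
  have oneS: "\<one>\<^bsub>K1 R\<^esub> \<in> S"
  proof -
    have "?D #>\<^bsub>?G\<^esub> \<one>\<^bsub>?G\<^esub> = ?D" by (rule G.coset_mult_one) (rule D.subset)
    then have "?D \<in> S" unfolding S using Z.one_closed
      by (metis GL_one SM_center_one imageI ring.GL_one[OF center_ring_ring])
    then show ?thesis by (simp add: K1_def)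
  qed
  have "trivial_group (CK1 R) \<longleftrightarrow> S = carrier (K1 R)"
  proof
    assume "trivial_group (CK1 R)"
    then have t: "S #>\<^bsub>K1 R\<^esub> X = S" if "X \<in> carrier (K1 R)" for X
      using that unfolding trivial_group_def CK carrier_FactGroup by auto
    have "X \<in> S" if X: "X \<in> carrier (K1 R)" for X
    proof -
      have "\<one>\<^bsub>K1 R\<^esub> \<otimes>\<^bsub>K1 R\<^esub> X \<in> S #>\<^bsub>K1 R\<^esub> X" using oneS by (auto simp: r_coset_def)
      then show ?thesis using t[OF X] X by simp
    qed
    then show "S = carrier (K1 R)" using sub by blast
  next
    assume eq: "S = carrier (K1 R)"
    have n: "normal S (K1 R)" unfolding eq using K.normal_iff_subgroup K.subgroup_self by blast
    have "S #>\<^bsub>K1 R\<^esub> X = S" if "X \<in> carrier (K1 R)" for X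
      using that K.coset_join2[OF that] n eq by (simp add: normal_imp_subgroup)
    then show "trivial_group (CK1 R)"
      unfolding trivial_group_def CK using normal.factorgroup_is_group[OF n] K.one_closed
      by (auto simp: carrier_FactGroup)
  qed
  also have "S = carrier (K1 R) \<longleftrightarrow>
      (\<forall>g\<in>carrier ?G. \<exists>M\<in>carrier (stable_GL (center_ring R)). ?D #>\<^bsub>?G\<^esub> g = ?D #>\<^bsub>?G\<^esub> M)"
  proof -
    have "S = carrier (K1 R) \<longleftrightarrow> (\<forall>X\<in>carrier (K1 R). X \<in> S)" using sub by blast
    also have "\<dots> \<longleftrightarrow> (\<forall>g\<in>carrier ?G. ?D #>\<^bsub>?G\<^esub> g \<in> S)" unfolding cK by blast
    finally show ?thesis unfolding S by (simp add: image_iff)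
  qed
  also have "\<dots> \<longleftrightarrow> (\<forall>g\<in>carrier ?G. \<exists>C\<in>?D. \<exists>M\<in>carrier (stable_GL (center_ring R)). g = C \<otimes>\<^bsub>?G\<^esub> M)"
  proof (intro ball_cong refl)
    fix g assume g: "g \<in> carrier ?G"
    have "?D #>\<^bsub>?G\<^esub> g = ?D #>\<^bsub>?G\<^esub> M \<longleftrightarrow> (\<exists>C\<in>?D. g = C \<otimes>\<^bsub>?G\<^esub> M)"
      if M: "M \<in> carrier (stable_GL (center_ring R))" for M
    proof -
      have "(\<exists>C\<in>?D. g = C \<otimes>\<^bsub>?G\<^esub> M) \<longleftrightarrow> g \<in> ?D #>\<^bsub>?G\<^esub> M" by (auto simp: r_coset_def)
      also have "\<dots> \<longleftrightarrow> ?D #>\<^bsub>?G\<^esub> g = ?D #>\<^bsub>?G\<^esub> M"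
        using G.repr_independence[OF _ GL_center_closed[OF M] D.subgroup_axioms, of g]
          G.rcos_self[OF g D.subgroup_axioms] by metis
      finally show ?thesis ..
    qed
    then show "(\<exists>M\<in>carrier (stable_GL (center_ring R)). ?D #>\<^bsub>?G\<^esub> g = ?D #>\<^bsub>?G\<^esub> M)
        \<longleftrightarrow> (\<exists>C\<in>?D. \<exists>M\<in>carrier (stable_GL (center_ring R)). g = C \<otimes>\<^bsub>?G\<^esub> M)" by blast
  qed
  finally show ?thesis .
qed

end

section \<open>Reduction to the multiplicative group\<close>

context skew_field
begin

lemma mult_of_units: "mult_of R = units_of R"
  using skew_field_Units by (simp add: mult_of_def units_of_def)

lemma mult_of_group: "group (mult_of R)"
  unfolding mult_of_units by (rule units_group)

lemma inv_mult_of: "a \<in> carrier R \<Longrightarrow> a \<noteq> \<zero> \<Longrightarrow> inv\<^bsub>mult_of R\<^esub> a = inv a"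
  unfolding mult_of_units by (rule units_of_inv) (simp add: skew_field_Units)

lemma center_inv:
  assumes "c \<in> ring_center R" "c \<noteq> \<zero>" shows "inv c \<in> ring_center R"
proof -
  have c: "c \<in> carrier R" "\<And>x. x \<in> carrier R \<Longrightarrow> c \<otimes> x = x \<otimes> c"
    using assms(1) unfolding ring_center_def by blast+
  note ic = inv_skew[OF c(1) assms(2)]
  have "inv c \<otimes> x = x \<otimes> inv c" if x: "x \<in> carrier R" for x
  proof -
    have "inv c \<otimes> x = inv c \<otimes> (x \<otimes> c) \<otimes> inv c" using ic c(1) x by (simp add: m_assoc)
    also have "\<dots> = x \<otimes> inv c" using ic c(1) x unfolding c(2)[OF x, symmetric]
      by (simp add: m_assoc[symmetric])
    finally show ?thesis .
  qed
  then show ?thesis using ic(2) unfolding ring_center_def by blast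
qed

definition scal :: "'a \<Rightarrow> nat \<Rightarrow> nat \<Rightarrow> 'a" where
  "scal c = (\<lambda>i j. if i = j \<and> i < 2 then c else \<zero>)"

lemma sum2: "f 0 \<in> carrier R \<Longrightarrow> f (1::nat) \<in> carrier R \<Longrightarrow> (\<Oplus>k\<in>{..<2}. f k) = f 0 \<oplus> f 1"
proof -
  assume f: "f 0 \<in> carrier R" "f 1 \<in> carrier R"
  have two: "{..<2::nat} = {0, 1}" by auto
  show ?thesis unfolding two using f by simp
qed

lemma M2_mult:
  assumes "\<And>i j. M i j \<in> carrier R" "\<And>i j. N i j \<in> carrier R"
  shows "(M \<otimes>\<^bsub>M2\<^esub> N) i j = M i 0 \<otimes> N 0 j \<oplus> M i 1 \<otimes> N 1 j"
  unfolding matrix_ring_simps by (rule sum2) (use assms in auto)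

text \<open>Commuting with the matrix units forces a matrix to be scalar, and commuting with the matrices
  \<open>d E\<^sub>0\<^sub>0\<close> forces the scalar to be central.\<close>

lemma center_M2: "ring_center M2 = scal ` ring_center R"
proof (intro equalityI subsetI)
  fix z assume z: "z \<in> ring_center M2"
  have zM: "z \<in> carrier M2" and zc: "\<And>x. x \<in> carrier M2 \<Longrightarrow> z \<otimes>\<^bsub>M2\<^esub> x = x \<otimes>\<^bsub>M2\<^esub> z"
    using z unfolding ring_center_def by blast+
  have e[simp]: "z i j \<in> carrier R" for i j using zM by (simp add: carrier_matrix_ring)
  have zero: "z i j = \<zero>" if "2 \<le> i \<or> 2 \<le> j" for i j using zM that by (auto simp: carrier_matrix_ring)
  define E where "E d p q = (\<lambda>i j. if i = p \<and> j = q then d else \<zero>)" for d and p q :: nat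
  have eq: "(if q = j then z i p \<otimes> d else \<zero>) = (if p = i then d \<otimes> z q j else \<zero>)"
    if d: "d \<in> carrier R" and pq: "p < 2" "q < 2" and ij: "i < 2" "j < 2" for d p q i j
  proof -
    have "E d p q \<in> carrier M2" using d pq by (auto simp: E_def carrier_matrix_ring)
    then have "(z \<otimes>\<^bsub>M2\<^esub> E d p q) i j = (E d p q \<otimes>\<^bsub>M2\<^esub> z) i j" using zc by simp
    moreover have "p = 0 \<or> p = 1" "q = 0 \<or> q = 1" using pq by auto
    ultimately show ?thesis
      using d by (subst (asm) (1 2) M2_mult) (auto simp: E_def split: if_splits)
  qed
  define c where "c = z 0 0"
  have "z 0 1 = \<zero>" using eq[of \<one> 1 0 0 0] by simp
  moreover have "z 1 0 = \<zero>" using eq[of \<one> 0 1 1 1] by simp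
  moreover have "z 1 1 = c" using eq[of \<one> 0 1 0 1] by (simp add: c_def)
  ultimately have "z i j = scal c i j" for i j
    using zero[of i j] by (cases "i < 2 \<and> j < 2") (auto simp: scal_def c_def less_2_cases_iff)
  then have "z = scal c" by blast
  moreover have "c \<in> ring_center R"
    unfolding ring_center_def using eq[of _ 0 0 0 0] by (simp add: c_def)
  ultimately show "z \<in> scal ` ring_center R" by blast
next
  fix z assume "z \<in> scal ` ring_center R"
  then obtain c where z: "z = scal c" and "c \<in> ring_center R" by blast
  then have c: "c \<in> carrier R" "\<And>x. x \<in> carrier R \<Longrightarrow> c \<otimes> x = x \<otimes> c"
    unfolding ring_center_def by blast+
  have s: "scal c i j \<in> carrier R" for i j using c by (simp add: scal_def)
  have "scal c \<otimes>\<^bsub>M2\<^esub> x = x \<otimes>\<^bsub>M2\<^esub> scal c" if x: "x \<in> carrier M2" for x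
  proof (intro ext)
    fix i j
    have e[simp]: "x i j \<in> carrier R" for i j using x by (simp add: carrier_matrix_ring)
    have x0: "x i j = \<zero>" if "2 \<le> i \<or> 2 \<le> j" for i j using x that by (auto simp: carrier_matrix_ring)
    show "(scal c \<otimes>\<^bsub>M2\<^esub> x) i j = (x \<otimes>\<^bsub>M2\<^esub> scal c) i j"
      using c s x0[of i j] by (subst (1 2) M2_mult) (auto simp: scal_def less_2_cases_iff not_less)
  qed
  moreover have "scal c \<in> carrier M2" using c by (auto simp: scal_def carrier_matrix_ring)
  ultimately show "z \<in> ring_center M2" unfolding z ring_center_def by blast
qed

lemma scal_mult:
  "c \<in> carrier R \<Longrightarrow> d \<in> carrier R \<Longrightarrow> scal c \<otimes>\<^bsub>M2\<^esub> scal d = scal (c \<otimes> d)"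
  by (intro ext, subst M2_mult) (auto simp: scal_def less_2_cases_iff)

lemma scal_one: "scal \<one> = \<one>\<^bsub>M2\<^esub>"
  by (simp add: scal_def matrix_ring_simps)

text \<open>This makes elimination available over the center of \<open>M\<^sub>2(Q)\<close>, so that the invertible stable
  matrices over the center need not be described further.\<close>

lemma center_M2_skew_field: "skew_field (center_ring M2)"
proof -
  interpret Z: ring "center_ring M2" by (rule ring.center_ring_ring[OF matrix_ring_ring])
  have "Units (center_ring M2) = ring_center M2 - {\<zero>\<^bsub>M2\<^esub>}"
  proof (intro equalityI subsetI)
    fix z assume z: "z \<in> Units (center_ring M2)"
    have "z \<noteq> \<zero>\<^bsub>M2\<^esub>"
    proof
      assume "z = \<zero>\<^bsub>M2\<^esub>"
      then have "\<one>\<^bsub>center_ring M2\<^esub> = \<zero>\<^bsub>center_ring M2\<^esub>"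
        using z Z.Units_r_inv[OF z] Z.Units_inv_closed[OF z] Z.l_null by simp
      then have "scal \<one> 0 0 = \<zero>" by (simp add: scal_one matrix_ring_simps)
      then show False using one_neq_zero by (simp add: scal_def)
    qed
    then show "z \<in> ring_center M2 - {\<zero>\<^bsub>M2\<^esub>}" using Z.Units_closed[OF z] by simp
  next
    fix z assume z: "z \<in> ring_center M2 - {\<zero>\<^bsub>M2\<^esub>}"
    then obtain c where c: "c \<in> ring_center R" "z = scal c" by (auto simp: center_M2)
    then have "c \<noteq> \<zero>" using z by (auto simp: matrix_ring_simps scal_def)
    moreover have cR: "c \<in> carrier R" using c center_closed by blast
    ultimately have "scal (inv c) \<in> ring_center M2" "scal c \<otimes>\<^bsub>M2\<^esub> scal (inv c) = \<one>\<^bsub>M2\<^esub>"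
      "scal (inv c) \<otimes>\<^bsub>M2\<^esub> scal c = \<one>\<^bsub>M2\<^esub>"
      using inv_skew[OF cR] center_inv[OF c(1)] by (auto simp: center_M2 scal_mult scal_one)
    then show "z \<in> Units (center_ring M2)" using c z by (auto simp: Units_def)
  qed
  then show ?thesis by (intro skew_field.intro skew_field_axioms.intro Z.ring_axioms) simp
qed

lemma corner_center_M2: "ring.corner (center_ring M2) z = ring.corner M2 z"
  unfolding ring.corner_def[OF ring.center_ring_ring[OF matrix_ring_ring]]
    ring.corner_def[OF matrix_ring_ring] by (auto simp: fun_eq_iff)

lemma merge_corner_scal: "merge_blocks (ring.corner M2 (scal c)) = scale_row 1 c (corner c)"
  if "c \<in> carrier R"
proof (intro ext)
  fix i j :: nat
  have ij: "i = j \<longleftrightarrow> i div 2 = j div 2 \<and> i mod 2 = j mod 2" by (metis div_mult_mod_eq)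
  note defs = merge_blocks_def ring.corner_def[OF matrix_ring_ring] scal_def scale_row_def
    corner_def matrix_ring_simps
  show "merge_blocks (ring.corner M2 (scal c)) i j = scale_row 1 c (corner c) i j"
  proof (cases "i < 2")
    case True
    then have i: "i = 0 \<or> i = 1" by auto
    consider "j = 0" | "j = 1" | "2 \<le> j" by linarith
    then show ?thesis
    proof cases
      case 3
      then have "j div 2 \<noteq> 0" "j \<noteq> 0" "j \<noteq> 1" by auto
      then show ?thesis using i that by (auto simp: defs)
    qed (use i that in \<open>auto simp: defs\<close>)
  next
    case False
    then have i: "i div 2 \<noteq> 0" "i \<noteq> 0" "i \<noteq> 1" by auto
    have "merge_blocks (ring.corner M2 (scal c)) i j
        = (if i div 2 = j div 2 \<and> i mod 2 = j mod 2 then \<one> else \<zero>)"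
      using i by (auto simp: defs)
    also have "\<dots> = (if i = j then \<one> else \<zero>)" by (simp only: ij[symmetric])
    also have "\<dots> = scale_row 1 c (corner c) i j" using i by (simp add: defs)
    finally show ?thesis .
  qed
qed

text \<open>Whitehead's lemma. The first three operations turn the rows \<open>(u, v)\<close> into \<open>(-v, u)\<close>, the
  last three turn this into \<open>(f u, f\<^sup>-\<^sup>1 v)\<close>.\<close>

lemma whitehead:
  assumes M: "\<And>i j. M i j \<in> carrier R" and f: "f \<in> carrier R" "f \<noteq> \<zero>"
  shows "add_row 0 1 f (add_row 1 0 (\<ominus> (inv f)) (add_row 0 1 f
     (add_row 0 1 (\<ominus> \<one>) (add_row 1 0 \<one> (add_row 0 1 (\<ominus> \<one>) M)))))
     = scale_row 0 f (scale_row 1 (inv f) M)"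
proof (intro ext)
  fix k l :: nat
  note i = inv_skew[OF f]
  let ?x = "M 0 l" and ?y = "M 1 l"
  have 1: "?x \<oplus> (\<ominus> \<one>) \<otimes> ?y = ?x \<ominus> ?y" using M by (simp add: l_minus minus_eq)
  have 2: "?y \<oplus> \<one> \<otimes> (?x \<ominus> ?y) = ?x" using M by (simp add: minus_eq a_ac r_neg2 r_neg r_neg1)
  have 3: "(?x \<ominus> ?y) \<oplus> (\<ominus> \<one>) \<otimes> ?x = \<ominus> ?y" using M by (simp add: l_minus minus_eq a_ac r_neg2 r_neg r_neg1)
  have a: "f \<otimes> (inv f \<otimes> ?y) = ?y" and b: "inv f \<otimes> (f \<otimes> ?x) = ?x"
    using M f i by (simp_all add: m_assoc[symmetric])
  have 4: "?x \<oplus> (\<ominus> (inv f)) \<otimes> (\<ominus> ?y \<oplus> f \<otimes> ?x) = inv f \<otimes> ?y"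
    using M f i b by (simp add: l_minus r_minus r_distr minus_add a_ac r_neg2 r_neg r_neg1)
  have 5: "\<ominus> ?y \<oplus> f \<otimes> ?x \<oplus> f \<otimes> (inv f \<otimes> ?y) = f \<otimes> ?x"
    using M f unfolding a by (simp add: a_comm[of "\<ominus> M (Suc 0) l"] a_assoc l_neg)
  consider "k = 0" | "k = 1" | "k \<noteq> 0" "k \<noteq> 1" by blast
  then show "add_row 0 1 f (add_row 1 0 (\<ominus> (inv f)) (add_row 0 1 f
     (add_row 0 1 (\<ominus> \<one>) (add_row 1 0 \<one> (add_row 0 1 (\<ominus> \<one>) M))))) k l
     = scale_row 0 f (scale_row 1 (inv f) M) k l"
    by cases (simp_all add: add_row_def scale_row_def 1[simplified] 2[simplified] 3[simplified] 4[simplified] 5[simplified])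
qed

text \<open>Multiplying \<open>diag(f, f)\<close> by \<open>diag(f, f\<^sup>-\<^sup>1)\<close> gives \<open>diag(f\<^sup>2, 1)\<close>.\<close>

lemma corner_square_commutators:
  assumes f: "f \<in> carrier R" "f \<noteq> \<zero>" and D: "scale_row 1 f (corner f) \<in> carrier (stable_GL R)"
  shows "\<exists>W\<in>GL_commutators R. corner (f \<otimes> f) = W \<otimes>\<^bsub>stable_GL R\<^esub> scale_row 1 f (corner f)"
proof -
  let ?G = "stable_GL R"
  interpret G: group ?G by (rule GL_group)
  interpret S: normal "GL_commutators R" ?G by (rule G.derived_self_is_normal)
  note i = inv_skew[OF f]
  have step: "\<exists>W\<in>GL_commutators R. add_row p q c N = W \<otimes>\<^bsub>?G\<^esub> scale_row 1 f (corner f)"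
    if N: "\<exists>W\<in>GL_commutators R. N = W \<otimes>\<^bsub>?G\<^esub> scale_row 1 f (corner f)" and c: "c \<in> carrier R" "p \<noteq> q"
    for p q c N
  proof -
    obtain W where W: "W \<in> GL_commutators R" "N = W \<otimes>\<^bsub>?G\<^esub> scale_row 1 f (corner f)" using N by blast
    have NG: "N \<in> carrier ?G" using W D S.mem_carrier by simp
    have e: "N i j \<in> carrier R" for i j using NG SM_entry unfolding GL_carrier_iff by blast
    have T: "transvection p q c \<in> GL_commutators R" using transvection_commutator c by blast
    have "add_row p q c N = transvection p q c \<otimes>\<^bsub>?G\<^esub> N"
      using transvection_mult[OF c e] by (simp add: GL_mult)
    also have "\<dots> = (transvection p q c \<otimes>\<^bsub>?G\<^esub> W) \<otimes>\<^bsub>?G\<^esub> scale_row 1 f (corner f)"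
      using W T D S.mem_carrier by (simp add: G.m_assoc)
    finally show ?thesis using S.m_closed[OF T W(1)] by blast
  qed
  have e: "scale_row 1 f (corner f) i j \<in> carrier R" for i j
    using f by (simp add: scale_row_def corner_def)
  have "corner (f \<otimes> f) = scale_row 0 f (scale_row 1 (inv f) (scale_row 1 f (corner f)))"
    using f i by (auto simp: fun_eq_iff corner_def scale_row_def)
  also have "\<dots> = add_row 0 1 f (add_row 1 0 (\<ominus> (inv f)) (add_row 0 1 f
     (add_row 0 1 (\<ominus> \<one>) (add_row 1 0 \<one> (add_row 0 1 (\<ominus> \<one>) (scale_row 1 f (corner f)))))))"
    by (rule whitehead[symmetric]) (use e f in auto)
  finally have eq: "corner (f \<otimes> f) = \<dots>" .
  have "\<exists>W\<in>GL_commutators R. scale_row 1 f (corner f) = W \<otimes>\<^bsub>?G\<^esub> scale_row 1 f (corner f)"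
    using S.one_closed G.l_one[OF D] by metis
  then show ?thesis unfolding eq using f i by (intro step) auto
qed

lemma corner_commutators:
  assumes q: "q \<in> derived (mult_of R) (carrier (mult_of R))"
  shows "corner q \<in> GL_commutators R"
proof -
  interpret h: group_hom "mult_of R" "stable_GL R" corner
  proof (intro group_hom.intro group_hom_axioms.intro homI)
    fix a b assume "a \<in> carrier (mult_of R)" "b \<in> carrier (mult_of R)"
    then show "corner (a \<otimes>\<^bsub>mult_of R\<^esub> b) = corner a \<otimes>\<^bsub>stable_GL R\<^esub> corner b"
      by (simp add: GL_mult corner_corner)
  qed (use mult_of_group GL_group corner_GL skew_field_Units in auto)
  have "corner q \<in> derived (stable_GL R) (corner ` carrier (mult_of R))"
    using h.derived_img[of "carrier (mult_of R)"] q by auto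
  also have "\<dots> \<subseteq> GL_commutators R" by (rule h.H.mono_derived) (use h.hom_closed in blast)
  finally show ?thesis .
qed

text \<open>By elimination an invertible matrix over \<open>M\<^sub>2\<close>, read as a matrix over the skew field, is
  \<open>diag(a, 1, \<dots>)\<close> up to commutators. With \<open>a = q f\<^sup>2\<close> this is \<open>diag(f, f, 1, \<dots>)\<close> up to
  commutators, which is the image of a scalar.\<close>

theorem trivial_CK1_if_central_squares:
  assumes sq: "\<And>a. a \<in> carrier R \<Longrightarrow> a \<noteq> \<zero> \<Longrightarrow>
    \<exists>f\<in>ring_center R - {\<zero>}. \<exists>q\<in>derived (mult_of R) (carrier (mult_of R)). a = q \<otimes> (f \<otimes> f)"
  shows "trivial_group (CK1 M2)"
proof -
  interpret A: ring M2 by (rule matrix_ring_ring)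
  interpret Z: skew_field "center_ring M2" by (rule center_M2_skew_field)
  let ?G = "stable_GL R" and ?GA = "stable_GL M2"
  interpret G: group ?G by (rule GL_group)
  interpret S: normal "GL_commutators R" ?G by (rule G.derived_self_is_normal)
  interpret u: group_hom ?G ?GA split_blocks by (rule split_blocks_group_hom)
  show ?thesis unfolding A.trivial_CK1_iff
  proof
    fix g assume g: "g \<in> carrier ?GA"
    have h: "merge_blocks g \<in> carrier ?G" by (rule merge_blocks_GL[OF g])
    obtain C a where C: "C \<in> GL_commutators R" "a \<in> Units R" "merge_blocks g = C \<otimes>\<^bsub>?G\<^esub> corner a"
      using GL_eq_commutator_corner[OF h] by blast
    have "a \<in> carrier R" "a \<noteq> \<zero>" using C(2) skew_field_Units by auto
    then obtain f q where f: "f \<in> ring_center R" "f \<noteq> \<zero>"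
      and q: "q \<in> derived (mult_of R) (carrier (mult_of R))" and a: "a = q \<otimes> (f \<otimes> f)"
      using sq by blast
    have fR: "f \<in> carrier R" using f center_closed by blast
    have qR: "q \<in> carrier R" using q group.derived_in_carrier[OF mult_of_group, of "carrier (mult_of R)"] by auto
    have z: "scal f \<in> Units (center_ring M2)"
    proof -
      have "scal f \<in> carrier (center_ring M2)" using f(1) by (simp add: center_M2)
      moreover have "scal f \<noteq> \<zero>\<^bsub>center_ring M2\<^esub>"
      proof
        assume "scal f = \<zero>\<^bsub>center_ring M2\<^esub>"
        then have "scal f 0 0 = \<zero>" by (simp add: matrix_ring_simps)
        then show False using f(2) by (simp add: scal_def)
      qed
      ultimately show ?thesis unfolding Z.skew_field_Units by blast
    qed
    have MZ: "A.corner (scal f) \<in> carrier (stable_GL (center_ring M2))"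
      using Z.corner_GL[OF z] corner_center_M2 by simp
    have MA: "A.corner (scal f) \<in> carrier ?GA" by (rule A.GL_center_closed[OF MZ])
    let ?D = "scale_row 1 f (corner f)"
    have D: "merge_blocks (A.corner (scal f)) = ?D" by (rule merge_corner_scal[OF fR])
    have DG: "?D \<in> carrier ?G" using merge_blocks_GL[OF MA] D by simp
    obtain W where W: "W \<in> GL_commutators R" "corner (f \<otimes> f) = W \<otimes>\<^bsub>?G\<^esub> ?D"
      using corner_square_commutators[OF fR f(2) DG] by blast
    define X where "X = C \<otimes>\<^bsub>?G\<^esub> (corner q \<otimes>\<^bsub>?G\<^esub> W)"
    have cq: "corner q \<in> GL_commutators R" by (rule corner_commutators[OF q])
    have X: "X \<in> GL_commutators R" unfolding X_def using C(1) W(1) cq by simp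
    have "corner a = corner q \<otimes>\<^bsub>?G\<^esub> corner (f \<otimes> f)"
      using a qR fR by (simp add: GL_mult corner_corner)
    then have "merge_blocks g = X \<otimes>\<^bsub>?G\<^esub> ?D"
      unfolding C(3) X_def W(2) using C(1) cq W(1) DG S.mem_carrier by (simp add: G.m_assoc)
    then have "split_blocks (merge_blocks g) = split_blocks X \<otimes>\<^bsub>?GA\<^esub> split_blocks ?D"
      using X S.mem_carrier DG by simp
    moreover have e: "split_blocks (merge_blocks N) = N" if "N \<in> carrier ?GA" for N
      by (rule split_blocks_merge_blocks) (use that SM_entry A.GL_carrier_iff in blast)
    ultimately have "g = split_blocks X \<otimes>\<^bsub>?GA\<^esub> A.corner (scal f)"
      unfolding D[symmetric] e[OF g] e[OF MA] by blast
    then show "\<exists>C\<in>GL_commutators M2. \<exists>M\<in>carrier (stable_GL (center_ring M2)). g = C \<otimes>\<^bsub>?GA\<^esub> M"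
      using split_blocks_commutators[OF X] MZ by blast
  qed
qed

end

context skew_field_character
begin

lemma GL_det_commutators:
  assumes "C \<in> GL_commutators M2"
  shows "GL_det (merge_blocks C) = 0"
proof -
  interpret A: ring M2 by (rule matrix_ring_ring)
  let ?GA = "stable_GL M2" and ?d = "\<lambda>g. GL_det (merge_blocks g)"
  interpret G: group ?GA by (rule A.GL_group)
  have mult: "?d (g \<otimes>\<^bsub>?GA\<^esub> h) = ?d g + ?d h" if "g \<in> carrier ?GA" "h \<in> carrier ?GA" for g h
    using that GL_det_mult[OF merge_blocks_GL merge_blocks_GL] merge_blocks_mult
    by (simp add: A.GL_mult A.GL_carrier_iff)
  have det_one: "?d \<one>\<^bsub>?GA\<^esub> = 0" using GL_det_one merge_blocks_one by (simp add: A.GL_one)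
  have det_inv: "?d (inv\<^bsub>?GA\<^esub> g) = - ?d g" if "g \<in> carrier ?GA" for g
    using mult[of "inv\<^bsub>?GA\<^esub> g" g] that det_one by (simp add: eq_neg_iff_add_eq_0)
  have comm: "?d h = 0" if "h \<in> derived_set ?GA (carrier ?GA)" for h
    using that mult det_inv by auto
  have inc: "derived_set ?GA (carrier ?GA) \<subseteq> carrier ?GA" by (rule G.derived_set_in_carrier) simp
  from assms show ?thesis unfolding derived_def
  proof (induction rule: generate.induct)
    case (eng h1 h2)
    have "h1 \<in> carrier ?GA" "h2 \<in> carrier ?GA"
      by (rule G.generate_in_carrier[OF inc eng(1)], rule G.generate_in_carrier[OF inc eng(2)])
    then show ?case using mult[of h1 h2] eng.IH by simp
  next
    case (inv h)
    have "h \<in> carrier ?GA" using inc inv by blast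
    then show ?case using det_inv[of h] comm[OF inv] by simp
  next
    case one show ?case by (rule det_one)
  next
    case (incl h) then show ?case by (rule comm)
  qed
qed

end

text \<open>The determinant for \<open>\<chi>\<close> kills commutators and, \<open>\<chi>\<close> having order two, all matrices coming from the
  center: by elimination over the center these are \<open>diag(c, c, 1, \<dots>)\<close> up to commutators. If
  \<open>CK\<^sub>1\<close> is trivial, it thus kills everything, in particular \<open>diag(a, 1, \<dots>)\<close>.\<close>

theorem (in skew_field) character_trivial_if_trivial_CK1:
  fixes \<chi> :: "'a \<Rightarrow> bit"
  assumes \<chi>: "skew_field_character R \<chi>" and t: "trivial_group (CK1 M2)"
    and a: "a \<in> carrier R" "a \<noteq> \<zero>"
  shows "\<chi> a = 0"
proof -
  interpret C: skew_field_character R \<chi> by (rule \<chi>)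
  interpret A: ring M2 by (rule matrix_ring_ring)
  interpret Z: skew_field "center_ring M2" by (rule center_M2_skew_field)
  let ?GA = "stable_GL M2" and ?d = "\<lambda>g. C.GL_det (merge_blocks g)"
  interpret G: group ?GA by (rule A.GL_group)
  have sub: "GL_commutators M2 \<subseteq> carrier ?GA" by (rule G.derived_in_carrier) simp
  have mult: "?d (g \<otimes>\<^bsub>?GA\<^esub> h) = ?d g + ?d h" if "g \<in> carrier ?GA" "h \<in> carrier ?GA" for g h
    using that C.GL_det_mult[OF merge_blocks_GL merge_blocks_GL] merge_blocks_mult
    by (simp add: A.GL_mult A.GL_carrier_iff)
  have aU: "a \<in> Units R" using inv_skew a by blast
  have ca: "corner a \<in> carrier (stable_GL R)" by (rule corner_GL[OF aU])
  obtain K M where K: "K \<in> GL_commutators M2" and M: "M \<in> carrier (stable_GL (center_ring M2))"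
    and g: "split_blocks (corner a) = K \<otimes>\<^bsub>?GA\<^esub> M"
    using t split_blocks_GL[OF ca] unfolding A.trivial_CK1_iff by blast
  obtain K' z where K': "K' \<in> GL_commutators (center_ring M2)" and z: "z \<in> Units (center_ring M2)"
    and M': "M = K' \<otimes>\<^bsub>stable_GL (center_ring M2)\<^esub> Z.corner z"
    using Z.GL_eq_commutator_corner[OF M] by blast
  obtain c where c: "c \<in> ring_center R" "z = scal c"
    using Z.Units_closed[OF z] by (auto simp: center_M2)
  have cR: "c \<in> carrier R" using c center_closed by blast
  have c0: "c \<noteq> \<zero>"
  proof
    assume "c = \<zero>"
    then have "z = \<zero>\<^bsub>center_ring M2\<^esub>" by (simp add: c(2) scal_def matrix_ring_simps)
    then show False using z unfolding Z.skew_field_Units by blast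
  qed
  have MZ: "Z.corner z \<in> carrier (stable_GL (center_ring M2))" by (rule Z.corner_GL[OF z])
  have K'A: "K' \<in> GL_commutators M2" using K' A.GL_center_commutators by blast
  have "K' \<in> carrier (stable_GL (center_ring M2))"
    using K' group.derived_in_carrier[OF Z.GL_group, of "carrier (stable_GL (center_ring M2))"] by blast
  then have M'': "M = K' \<otimes>\<^bsub>?GA\<^esub> Z.corner z"
    using M' MZ A.SM_center_mult by (simp add: Z.GL_mult A.GL_mult Z.GL_carrier_iff)
  have "?d (Z.corner z) = C.GL_det (scale_row 1 c (corner c))"
    using merge_corner_scal[OF cR] c(2) corner_center_M2 by simp
  also have "\<dots> = \<chi> c + \<chi> c"
    using C.GL_det_scale_row[OF corner_GL cR c0] C.GL_det_corner[of c] inv_skew(1)[OF cR c0] by simp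
  finally have dz: "?d (Z.corner z) = 0" by simp
  have inGA: "K \<in> carrier ?GA" "K' \<in> carrier ?GA" using K K'A sub by blast+
  have "?d (split_blocks (corner a)) = ?d K + ?d M"
    unfolding g by (rule mult[OF inGA(1) A.GL_center_closed[OF M]])
  also have "?d M = ?d K' + ?d (Z.corner z)"
    unfolding M'' by (rule mult[OF inGA(2) A.GL_center_closed[OF MZ]])
  finally have "?d (split_blocks (corner a)) = 0"
    using dz C.GL_det_commutators K K'A by simp
  then show ?thesis using C.GL_det_corner[OF aU] by (simp add: merge_blocks_split_blocks)
qed

section \<open>Subgroups of index two\<close>

context group
begin

text \<open>The cosets of \<open>a\<close> and of \<open>b\<^sup>-\<^sup>1\<close> are both the nontrivial one, hence equal.\<close>

lemma index_two_mult:
  assumes H: "subgroup H G" and two: "card (rcosets H) = 2"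
    and a: "a \<in> carrier G" "a \<notin> H" and b: "b \<in> carrier G" "b \<notin> H"
  shows "a \<otimes> b \<in> H"
proof -
  interpret H: subgroup H G by (rule H)
  have ib: "inv b \<in> carrier G" "inv b \<notin> H"
    using b H.m_inv_closed[of "inv b"] by auto
  have nH: "H #> g \<noteq> H" if "g \<in> carrier G" "g \<notin> H" for g
    using that coset_join1[of H g] H by auto
  have "{H, H #> a, H #> inv b} \<subseteq> rcosets H"
    using H.subgroup_in_rcosets[OF is_group] a ib by (auto intro: rcosetsI[OF H.subset])
  moreover have "finite (rcosets H)" using two card.infinite by fastforce
  ultimately have "card {H, H #> a, H #> inv b} \<le> 2" using card_mono two by metis
  then have "H #> a = H #> inv b"
    using nH[OF a] nH[OF ib] by (auto simp: card_insert_if split: if_splits)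
  then have "a \<in> H #> inv b" using rcos_self[OF a(1) H] by simp
  then obtain h where h: "h \<in> H" "a = h \<otimes> inv b" by (auto simp: r_coset_def)
  then have "a \<otimes> b = h" using b by (simp add: m_assoc H.mem_carrier)
  then show ?thesis using h by simp
qed

lemma index_two_proper:
  assumes H: "subgroup H G" and two: "card (rcosets H) = 2"
  shows "\<exists>a\<in>carrier G. a \<notin> H"
proof (rule ccontr)
  assume *: "\<not> ?thesis"
  have "rcosets H \<subseteq> {H}" 
    using * coset_join2[OF _ H] by (auto simp: RCOSETS_def)
  then have "card (rcosets H) \<le> 1" using card_mono[of "{H}" "rcosets H"] by simp
  then show False using two by simp
qed

text \<open>A subgroup \<open>H\<close> that is maximal among those containing all squares but not \<open>g\<close> has index
  two: it is normal with a quotient of exponent two, so for \<open>a \<notin> H\<close> the set \<open>H \<union> Ha\<close> is a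
  subgroup, which by maximality contains \<open>g\<close>, that is \<open>Ha = Hg\<close>.\<close>

lemma exists_index_two:
  assumes S: "subgroup S G" and sq: "\<And>a. a \<in> carrier G \<Longrightarrow> a \<otimes> a \<in> S"
    and g: "g \<in> carrier G" "g \<notin> S"
  shows "\<exists>H. subgroup H G \<and> card (rcosets H) = 2"
proof -
  define C where "C = {H. subgroup H G \<and> S \<subseteq> H \<and> g \<notin> H}"
  have "\<exists>M\<in>C. \<forall>X\<in>C. M \<subseteq> X \<longrightarrow> X = M"
  proof (rule subset_Zorn_nonempty)
    show "C \<noteq> {}" using S g by (auto simp: C_def)
    fix \<C> assume ne: "\<C> \<noteq> {}" and ch: "subset.chain C \<C>"
    have sub: "subgroup (\<Union>\<C>) G"
    proof (rule subgroupI)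
      show "\<Union>\<C> \<subseteq> carrier G" using ch by (auto simp: subset.chain_def C_def dest!: subgroup.subset)
      obtain A where "A \<in> \<C>" using ne by blast
      then have "\<one> \<in> \<Union>\<C>" using ch by (auto simp: subset.chain_def C_def dest: subgroup.one_closed)
      then show "\<Union>\<C> \<noteq> {}" by blast
      show "inv a \<in> \<Union>\<C>" if "a \<in> \<Union>\<C>" for a
        using that ch by (auto simp: subset.chain_def C_def intro: subgroup.m_inv_closed)
      fix a b assume "a \<in> \<Union>\<C>" "b \<in> \<Union>\<C>"
      then obtain A B where AB: "A \<in> \<C>" "B \<in> \<C>" "a \<in> A" "b \<in> B" by blast
      then have "A \<subseteq> B \<or> B \<subseteq> A" using ch by (auto simp: subset.chain_def)
      then obtain D where "D \<in> \<C>" "a \<in> D" "b \<in> D" using AB by blast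
      then show "a \<otimes> b \<in> \<Union>\<C>"
        using ch by (auto simp: subset.chain_def C_def intro: subgroup.m_closed)
    qed
    then show "\<Union>\<C> \<in> C" using ne ch by (auto simp: subset.chain_def C_def)
  qed
  then obtain H where H: "subgroup H G" "S \<subseteq> H" "g \<notin> H"
    and max: "\<And>X. subgroup X G \<Longrightarrow> H \<subseteq> X \<Longrightarrow> g \<notin> X \<Longrightarrow> X = H"
    by (auto simp: C_def)
  interpret H: subgroup H G by (rule H(1))
  have sqH: "a \<otimes> a \<in> H" if "a \<in> carrier G" for a using sq H(2) that by blast
  \<comment> \<open>\<open>a h a\<^sup>-\<^sup>1 = (a h)\<^sup>2 h\<^sup>-\<^sup>1 a\<^sup>-\<^sup>2\<close>, so \<open>H\<close> is normal\<close>
  have conj: "a \<otimes> h \<otimes> inv a \<in> H" if a: "a \<in> carrier G" and h: "h \<in> H" for a h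
  proof -
    have hG: "h \<in> carrier G" using h H.mem_carrier by blast
    have "a \<otimes> h \<otimes> inv a = ((a \<otimes> h) \<otimes> (a \<otimes> h)) \<otimes> inv h \<otimes> (inv a \<otimes> inv a)"
      using a hG by (simp add: m_assoc inv_solve_left) (simp add: m_assoc[symmetric])
    moreover have "inv a \<otimes> inv a \<in> H" using sqH[of "inv a"] a by simp
    ultimately show ?thesis using sqH[of "a \<otimes> h"] a h hG by simp
  qed
  have swap: "\<exists>k\<in>H. a \<otimes> h = k \<otimes> a" if a: "a \<in> carrier G" and h: "h \<in> H" for a h
    using conj[OF that] a h by (intro bexI[of _ "a \<otimes> h \<otimes> inv a"]) (simp_all add: m_assoc H.mem_carrier)
  have in_g: "a \<in> H #> g" if a: "a \<in> carrier G" "a \<notin> H" for a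
  proof -
    let ?X = "H \<union> (H #> a)"
    have ha: "x \<in> H #> a \<longleftrightarrow> (\<exists>h\<in>H. x = h \<otimes> a)" for x by (auto simp: r_coset_def)
    have aa: "a \<otimes> a \<in> H" using sqH a by blast
    have X: "subgroup ?X G"
    proof (rule subgroupI)
      show "?X \<subseteq> carrier G" using a by (auto simp: ha)
      show "?X \<noteq> {}" using H.one_closed by blast
      fix u assume u: "u \<in> ?X"
      show "inv u \<in> ?X"
      proof (cases "u \<in> H")
        case False
        then obtain h where h: "h \<in> H" "u = h \<otimes> a" using u ha by blast
        obtain k where k: "k \<in> H" "a \<otimes> inv h = k \<otimes> a" using swap[OF a(1)] h by (metis H.m_inv_closed)
        have hG: "h \<in> carrier G" using h H.mem_carrier by blast
        have c: "inv a \<otimes> (a \<otimes> inv h) = inv h" using a hG by (simp add: m_assoc[symmetric])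
        have "inv u = inv a \<otimes> inv h" using h(2) hG a by (simp add: inv_mult_group)
        also have "\<dots> = inv (a \<otimes> a) \<otimes> (a \<otimes> inv h)"
          using hG a c by (simp add: inv_mult_group m_assoc)
        also have "\<dots> = (inv (a \<otimes> a) \<otimes> k) \<otimes> a" using k a by (simp add: m_assoc)
        finally have "inv u \<in> H #> a" using aa k ha by auto
        then show ?thesis by blast
      qed simp
      fix v assume v: "v \<in> ?X"
      show "u \<otimes> v \<in> ?X"
      proof (cases "u \<in> H")
        case True
        show ?thesis
        proof (cases "v \<in> H")
          case False
          then obtain h where "h \<in> H" "v = h \<otimes> a" using v ha by blast
          then have "u \<otimes> v = (u \<otimes> h) \<otimes> a" "u \<otimes> h \<in> H" using True a by (auto simp: m_assoc)
          then show ?thesis using ha by blast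
        qed (use True in simp)
      next
        case False
        then obtain h where h: "h \<in> H" "u = h \<otimes> a" using u ha by blast
        show ?thesis
        proof (cases "v \<in> H")
          case True
          obtain k where k: "k \<in> H" "a \<otimes> v = k \<otimes> a" using swap[OF a(1) True] by blast
          have "u \<otimes> v = h \<otimes> (a \<otimes> v)" using h a True by (simp add: m_assoc)
          also have "\<dots> = (h \<otimes> k) \<otimes> a" unfolding k(2) using h k a by (simp add: m_assoc)
          finally show ?thesis using h k ha by blast
        next
          case False
          then obtain h' where h': "h' \<in> H" "v = h' \<otimes> a" using v ha by blast
          obtain k where k: "k \<in> H" "a \<otimes> h' = k \<otimes> a" using swap[OF a(1) h'(1)] by blast
          have "u \<otimes> v = h \<otimes> ((a \<otimes> h') \<otimes> a)" using h h' a by (simp add: m_assoc)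
          also have "\<dots> = h \<otimes> (k \<otimes> (a \<otimes> a))" unfolding k(2) using h k a by (simp add: m_assoc)
          finally show ?thesis using h k aa by simp
        qed
      qed
    qed
    have "a \<in> ?X" using rcos_self[OF a(1) H(1)] by blast
    then have "g \<in> ?X" using max[OF X] a by blast
    then have "g \<in> H #> a" using H(3) by blast
    then have "H #> g = H #> a" using repr_independence[OF _ a(1) H(1)] by metis
    then show ?thesis using rcos_self[OF a(1) H(1)] by simp
  qed
  have "rcosets H = {H, H #> g}"
  proof
    show "{H, H #> g} \<subseteq> rcosets H"
      using H.subgroup_in_rcosets[OF is_group] g by (auto intro: rcosetsI[OF H.subset])
    show "rcosets H \<subseteq> {H, H #> g}"
    proof
      fix X assume "X \<in> rcosets H"
      then obtain a where a: "a \<in> carrier G" "X = H #> a" by (auto simp: RCOSETS_def)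
      show "X \<in> {H, H #> g}"
      proof (cases "a \<in> H")
        case True then show ?thesis using a coset_join2[OF _ H(1)] by simp
      next
        case False
        then have "a \<in> H #> g" using a in_g by blast
        then have "H #> g = H #> a" by (rule repr_independence[OF _ g(1) H(1)])
        then show ?thesis using a(2) by simp
      qed
    qed
  qed
  moreover have "H \<noteq> H #> g" using rcos_self[OF g(1) H(1)] H(3) by blast
  ultimately have "card (rcosets H) = 2" by simp
  then show ?thesis using H(1) by blast
qed

end

section \<open>Euclidean fields\<close>

text \<open>The positive elements of a euclidean field are the nonzero squares, so the ordering can be
  expressed by the squares alone. Conversely \<open>a \<le> b\<close> is defined to mean that \<open>b - a\<close> is a square:
  the three conditions give totality, transitivity and antisymmetry, respectively.\<close>

lemma euclidean_field_iff:
  fixes K (structure)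
  assumes "field K"
  shows "euclidean_field K \<longleftrightarrow>
    (\<forall>a\<in>carrier K. \<exists>b\<in>carrier K. a = b \<otimes> b \<or> \<ominus> a = b \<otimes> b) \<and>
    (\<forall>a\<in>carrier K. \<forall>b\<in>carrier K. \<exists>c\<in>carrier K. a \<otimes> a \<oplus> b \<otimes> b = c \<otimes> c) \<and>
    (\<forall>a\<in>carrier K. \<forall>b\<in>carrier K. a \<otimes> a \<oplus> b \<otimes> b = \<zero> \<longrightarrow> a = \<zero> \<and> b = \<zero>)"
    (is "_ \<longleftrightarrow> ?E1 \<and> ?E2 \<and> ?E3")
proof -
  interpret field K by (rule assms)
  show ?thesis
  proof
    assume "euclidean_field K"
    then obtain r where r: "field_ordering K r" and
      sq: "\<And>a. a \<in> carrier K \<Longrightarrow> (\<zero>, a) \<in> r \<Longrightarrow> a \<noteq> \<zero> \<Longrightarrow> \<exists>b\<in>carrier K. a = b \<otimes> b"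
      unfolding euclidean_field_def by blast
    have lin: "linear_order_on (carrier K) r" using r by (simp add: field_ordering_def)
    have add: "(a \<oplus> c, b \<oplus> c) \<in> r" if "(a, b) \<in> r" "a \<in> carrier K" "b \<in> carrier K" "c \<in> carrier K"
      for a b c using r that by (simp add: field_ordering_def)
    have mult: "(\<zero>, a \<otimes> b) \<in> r" if "(\<zero>, a) \<in> r" "(\<zero>, b) \<in> r" "a \<in> carrier K" "b \<in> carrier K"
      for a b using r that by (simp add: field_ordering_def)
    have rf: "(a, a) \<in> r" if "a \<in> carrier K" for a
      using lin that by (auto simp: order_on_defs refl_on_def)
    have tr: "(a, c) \<in> r" if "(a, b) \<in> r" "(b, c) \<in> r" for a b c
      using lin that by (auto simp: order_on_defs dest: transD)
    have an: "a = b" if "(a, b) \<in> r" "(b, a) \<in> r" for a b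
      using lin that by (auto simp: order_on_defs dest: antisymD)
    have tot: "(a, b) \<in> r \<or> (b, a) \<in> r" if "a \<in> carrier K" "b \<in> carrier K" for a b
      using lin that rf by (cases "a = b") (auto simp: order_on_defs total_on_def)
    have neg: "(\<zero>, \<ominus> a) \<in> r" if "(a, \<zero>) \<in> r" "a \<in> carrier K" for a
      using add[OF that(1,2) zero_closed, of "\<ominus> a"] that by (simp add: r_neg)
    have pos: "(\<zero>, a) \<in> r \<or> (\<zero>, \<ominus> a) \<in> r" if "a \<in> carrier K" for a
      using tot[OF that zero_closed] neg that by blast
    have nonneg_sq: "\<exists>b\<in>carrier K. a = b \<otimes> b" if "(\<zero>, a) \<in> r" "a \<in> carrier K" for a
    proof (cases "a = \<zero>")
      case True then show ?thesis by (intro bexI[of _ \<zero>]) auto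
    qed (use sq that in auto)
    have sq_nonneg: "(\<zero>, a \<otimes> a) \<in> r" if "a \<in> carrier K" for a
      using pos[OF that] mult[of a a] mult[of "\<ominus> a" "\<ominus> a"] that by (auto simp: l_minus r_minus)
    have sum_nonneg: "(\<zero>, a \<oplus> b) \<in> r" if "(\<zero>, a) \<in> r" "(\<zero>, b) \<in> r" "a \<in> carrier K" "b \<in> carrier K" for a b
    proof -
      have "(b, a \<oplus> b) \<in> r" using add[OF that(1) zero_closed that(3,4)] that by simp
      then show ?thesis using tr that by blast
    qed
    have ?E1 using pos nonneg_sq by (meson a_inv_closed)
    moreover have ?E2 using nonneg_sq sum_nonneg sq_nonneg by simp
    moreover have ?E3
    proof (intro ballI impI)
      fix a b assume a: "a \<in> carrier K" and b: "b \<in> carrier K" and 0: "a \<otimes> a \<oplus> b \<otimes> b = \<zero>"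
      have "(b \<otimes> b, a \<otimes> a \<oplus> b \<otimes> b) \<in> r"
        using add[OF sq_nonneg[OF a], of "b \<otimes> b"] a b by simp
      then have "b \<otimes> b = \<zero>" using an[OF _ sq_nonneg[OF b]] 0 by simp
      then show "a = \<zero> \<and> b = \<zero>" using 0 a b integral by auto
    qed
    ultimately show "?E1 \<and> ?E2 \<and> ?E3" by blast
  next
    assume E: "?E1 \<and> ?E2 \<and> ?E3"
    define r where "r = {(a, b). a \<in> carrier K \<and> b \<in> carrier K \<and> (\<exists>s\<in>carrier K. b \<ominus> a = s \<otimes> s)}"
    have rI: "(a, b) \<in> r" if "a \<in> carrier K" "b \<in> carrier K" "s \<in> carrier K" "b \<ominus> a = s \<otimes> s" for a b s
      using that by (auto simp: r_def)
    have "linear_order_on (carrier K) r"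
      unfolding order_on_defs
    proof (intro conjI)
      show "r \<subseteq> carrier K \<times> carrier K" by (auto simp: r_def)
      show "refl_on (carrier K) r"
        by (auto simp: refl_on_def r_def minus_eq r_neg intro!: bexI[of _ \<zero>])
      show "trans r"
      proof (rule transI)
        fix a b c assume "(a, b) \<in> r" "(b, c) \<in> r"
        then obtain s u where *: "a \<in> carrier K" "b \<in> carrier K" "c \<in> carrier K" "s \<in> carrier K"
          "u \<in> carrier K" "b \<ominus> a = s \<otimes> s" "c \<ominus> b = u \<otimes> u" by (auto simp: r_def)
        then obtain v where v: "v \<in> carrier K" "s \<otimes> s \<oplus> u \<otimes> u = v \<otimes> v" using E by blast
        have "c \<ominus> a = (b \<ominus> a) \<oplus> (c \<ominus> b)" using *(1-3) by algebra
        then show "(a, c) \<in> r" using * v rI[of a c v] by simp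
      qed
      show "antisym r"
      proof (rule antisymI)
        fix a b assume "(a, b) \<in> r" "(b, a) \<in> r"
        then obtain s u where *: "a \<in> carrier K" "b \<in> carrier K" "s \<in> carrier K"
          "u \<in> carrier K" "b \<ominus> a = s \<otimes> s" "a \<ominus> b = u \<otimes> u" by (auto simp: r_def)
        have "(b \<ominus> a) \<oplus> (a \<ominus> b) = \<zero>" using *(1,2) by algebra
        then have "s \<otimes> s \<oplus> u \<otimes> u = \<zero>" unfolding *(5,6) .
        then have "s = \<zero>" using E *(3,4) by blast
        then have "b \<ominus> a = \<zero>" using *(5) by simp
        then show "a = b" using *(1,2) by simp
      qed
      show "total_on (carrier K) r"
        unfolding total_on_def
      proof (intro ballI impI)
        fix a b assume ab: "a \<in> carrier K" "b \<in> carrier K"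
        have "\<ominus> (b \<ominus> a) = a \<ominus> b" using ab by algebra
        moreover have "b \<ominus> a \<in> carrier K" using ab by simp
        then obtain s where "s \<in> carrier K" "b \<ominus> a = s \<otimes> s \<or> \<ominus> (b \<ominus> a) = s \<otimes> s"
          using E by blast
        ultimately show "(a, b) \<in> r \<or> (b, a) \<in> r" using ab rI by auto
      qed
    qed
    moreover have "(a \<oplus> c, b \<oplus> c) \<in> r" if "a \<in> carrier K" "b \<in> carrier K" "c \<in> carrier K" "(a, b) \<in> r" for a b c
    proof -
      have "b \<oplus> c \<ominus> (a \<oplus> c) = b \<ominus> a" using that(1-3) by algebra
      then show ?thesis using that by (auto simp: r_def)
    qed
    moreover have nn: "(\<zero>, a) \<in> r \<longleftrightarrow> (\<exists>s\<in>carrier K. a = s \<otimes> s)" if "a \<in> carrier K" for a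
      using that by (auto simp: r_def minus_eq)
    moreover have "(\<zero>, a \<otimes> b) \<in> r" if ab: "a \<in> carrier K" "b \<in> carrier K" and p: "(\<zero>, a) \<in> r" "(\<zero>, b) \<in> r" for a b
    proof -
      obtain s u where su: "s \<in> carrier K" "u \<in> carrier K" "a = s \<otimes> s" "b = u \<otimes> u"
        using p nn[OF ab(1)] nn[OF ab(2)] by blast
      have "a \<otimes> b = (s \<otimes> u) \<otimes> (s \<otimes> u)" unfolding su(3,4) using su(1,2) by algebra
      then have "\<exists>s\<in>carrier K. a \<otimes> b = s \<otimes> s" using su(1,2) by (intro bexI[of _ "s \<otimes> u"]) auto
      then show ?thesis using nn[of "a \<otimes> b"] ab by simp
    qed
    ultimately have "field_ordering K r" unfolding field_ordering_def by blast
    then show "euclidean_field K" unfolding euclidean_field_def using assms nn by blast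
  qed
qed

text \<open>Every Hamilton quaternion over a euclidean field is a square. A quaternion \<open>x\<close> with real
  part \<open>x\<^sub>0\<close> and norm \<open>s\<^sup>2\<close> satisfies \<open>(x + s)\<^sup>2 = 2 (x\<^sub>0 + s) x\<close>, so \<open>x\<close> is a square if
  \<open>2 (x\<^sub>0 + s)\<close> is a nonzero square in the field. This holds for one of the two signs of \<open>s\<close>
  unless \<open>x\<close> is real.\<close>

lemma hamilton_square:
  fixes K (structure)
  assumes E: "euclidean_field K" and x: "x \<in> carrier (quaternion_algebra (\<ominus> \<one>) (\<ominus> \<one>) K)"
  shows "\<exists>p\<in>carrier (quaternion_algebra (\<ominus> \<one>) (\<ominus> \<one>) K).
    p \<otimes>\<^bsub>quaternion_algebra (\<ominus> \<one>) (\<ominus> \<one>) K\<^esub> p = x"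
proof -
  interpret field K using E by (simp add: euclidean_field_def)
  have E1: "\<exists>b\<in>carrier K. a = b \<otimes> b \<or> \<ominus> a = b \<otimes> b" if "a \<in> carrier K" for a
    using E that unfolding euclidean_field_iff[OF field_axioms] by blast
  have E2: "\<exists>c\<in>carrier K. a \<otimes> a \<oplus> b \<otimes> b = c \<otimes> c" if "a \<in> carrier K" "b \<in> carrier K" for a b
    using E that unfolding euclidean_field_iff[OF field_axioms] by blast
  have E3: "a = \<zero> \<and> b = \<zero>" if "a \<in> carrier K" "b \<in> carrier K" "a \<otimes> a \<oplus> b \<otimes> b = \<zero>" for a b
    using E that unfolding euclidean_field_iff[OF field_axioms] by blast
  obtain x0 x1 x2 x3 where xs: "x = (x0, x1, x2, x3)" "x0 \<in> carrier K" "x1 \<in> carrier K"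
      "x2 \<in> carrier K" "x3 \<in> carrier K"
    using x by (cases x) (auto simp: quaternion_algebra_def)
  let ?Q = "quaternion_algebra (\<ominus> \<one>) (\<ominus> \<one>) K"
  have goalI: ?thesis if p: "p0 \<in> carrier K" "p1 \<in> carrier K" "p2 \<in> carrier K" "p3 \<in> carrier K"
    and eq: "x0 = p0 \<otimes> p0 \<ominus> p1 \<otimes> p1 \<ominus> p2 \<otimes> p2 \<ominus> p3 \<otimes> p3"
      "x1 = p0 \<otimes> p1 \<oplus> p0 \<otimes> p1" "x2 = p0 \<otimes> p2 \<oplus> p0 \<otimes> p2" "x3 = p0 \<otimes> p3 \<oplus> p0 \<otimes> p3" for p0 p1 p2 p3
  proof (rule bexI[of _ "(p0, p1, p2, p3)"])
    have "p0 \<otimes> p0 \<oplus> (\<ominus> \<one>) \<otimes> (p1 \<otimes> p1) \<oplus> (\<ominus> \<one>) \<otimes> (p2 \<otimes> p2) \<ominus> (\<ominus> \<one>) \<otimes> (\<ominus> \<one>) \<otimes> (p3 \<otimes> p3) = x0"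
      unfolding eq using p by algebra
    moreover have "p0 \<otimes> p1 \<oplus> p1 \<otimes> p0 \<oplus> (\<ominus> \<one>) \<otimes> (p3 \<otimes> p2 \<ominus> p2 \<otimes> p3) = x1" unfolding eq using p by algebra
    moreover have "p0 \<otimes> p2 \<oplus> p2 \<otimes> p0 \<oplus> (\<ominus> \<one>) \<otimes> (p1 \<otimes> p3 \<ominus> p3 \<otimes> p1) = x2" unfolding eq using p by algebra
    moreover have "p0 \<otimes> p3 \<oplus> p3 \<otimes> p0 \<oplus> p1 \<otimes> p2 \<ominus> p2 \<otimes> p1 = x3" unfolding eq using p by algebra
    ultimately show "(p0, p1, p2, p3) \<otimes>\<^bsub>?Q\<^esub> (p0, p1, p2, p3) = x"
      unfolding xs(1) by (simp add: quaternion_algebra_def)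
  qed (use p in \<open>simp add: quaternion_algebra_def\<close>)
  show ?thesis
  proof (cases "x1 = \<zero> \<and> x2 = \<zero> \<and> x3 = \<zero>")
    case True
    obtain u where u: "u \<in> carrier K" "x0 = u \<otimes> u \<or> \<ominus> x0 = u \<otimes> u" using E1[OF xs(2)] by blast
    from u(2) show ?thesis
    proof
      assume "x0 = u \<otimes> u"
      then show ?thesis by (intro goalI[of u \<zero> \<zero> \<zero>]) (use u True in \<open>auto simp: minus_eq\<close>)
    next
      assume "\<ominus> x0 = u \<otimes> u"
      then have "x0 = \<ominus> (u \<otimes> u)" using xs by (metis minus_minus)
      then show ?thesis by (intro goalI[of \<zero> u \<zero> \<zero>]) (use u True in \<open>auto simp: minus_eq\<close>)
    qed
  next
    case False
    obtain m where m: "m \<in> carrier K" "x1 \<otimes> x1 \<oplus> x2 \<otimes> x2 = m \<otimes> m" using E2 xs by blast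
    obtain n where n: "n \<in> carrier K" "m \<otimes> m \<oplus> x3 \<otimes> x3 = n \<otimes> n" using E2 xs m by blast
    obtain s where s: "s \<in> carrier K" "x0 \<otimes> x0 \<oplus> n \<otimes> n = s \<otimes> s" using E2 xs n by blast
    have n0: "n \<noteq> \<zero>"
    proof
      assume "n = \<zero>"
      then have "m = \<zero> \<and> x3 = \<zero>" using E3[OF m(1) xs(5)] n by simp
      then show False using E3[OF xs(3,4)] m False by simp
    qed
    have N: "s \<otimes> s = x0 \<otimes> x0 \<oplus> x1 \<otimes> x1 \<oplus> x2 \<otimes> x2 \<oplus> x3 \<otimes> x3"
      unfolding s(2)[symmetric] n(2)[symmetric] m(2)[symmetric] using xs by algebra
    have dbl: "y = \<zero>" if "y \<in> carrier K" "y \<oplus> y = \<zero>" for y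
    proof -
      have "y \<otimes> y \<oplus> y \<otimes> y = y \<otimes> (y \<oplus> y)" using that(1) by algebra
      then show ?thesis using E3[of y y] that by simp
    qed
    \<comment> \<open>with \<open>2 (x\<^sub>0 + s') = c\<^sup>2\<close> the root is \<open>(x + s') c\<^sup>-\<^sup>1\<close>\<close>
    have main: ?thesis if s': "s' \<in> carrier K" "s' \<otimes> s' = s \<otimes> s" and c: "c \<in> carrier K"
        "(x0 \<oplus> s') \<oplus> (x0 \<oplus> s') = c \<otimes> c" for s' c
    proof -
      have "c \<noteq> \<zero>"
      proof
        assume "c = \<zero>"
        then have "x0 \<oplus> s' = \<zero>" using dbl[of "x0 \<oplus> s'"] c s' xs by simp
        then have "(x0 \<oplus> s') \<otimes> (x0 \<ominus> s') = \<zero>" using xs s' by simp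
        moreover have "(x0 \<oplus> s') \<otimes> (x0 \<ominus> s') = x0 \<otimes> x0 \<ominus> s' \<otimes> s'" using xs(2) s'(1) by algebra
        ultimately have "x0 \<otimes> x0 \<ominus> (x0 \<otimes> x0 \<oplus> n \<otimes> n) = \<zero>" using s'(2) s(2) by simp
        moreover have "x0 \<otimes> x0 \<ominus> (x0 \<otimes> x0 \<oplus> n \<otimes> n) = \<ominus> (n \<otimes> n)" using xs(2) n(1) by algebra
        ultimately have "n \<otimes> n = \<zero>" using n(1) by (metis m_closed minus_minus minus_zero)
        then show False using n0 n(1) integral by blast
      qed
      then have "c \<in> Units K" using c(1) by (simp add: field_Units)
      define w where "w = inv c"
      have w: "w \<in> carrier K" "c \<otimes> w = \<one>" using \<open>c \<in> Units K\<close> by (auto simp: w_def)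
      have "(w \<otimes> w) \<otimes> (c \<otimes> c) = (c \<otimes> w) \<otimes> (c \<otimes> w)" using w(1) c(1) by algebra
      then have ww: "(w \<otimes> w) \<otimes> (c \<otimes> c) = \<one>" using w(2) by simp
      show ?thesis
      proof (rule goalI[of "(x0 \<oplus> s') \<otimes> w" "x1 \<otimes> w" "x2 \<otimes> w" "x3 \<otimes> w"])
        have "(x0 \<oplus> s') \<otimes> (x0 \<oplus> s') \<ominus> x1 \<otimes> x1 \<ominus> x2 \<otimes> x2 \<ominus> x3 \<otimes> x3
            = s' \<otimes> s' \<oplus> x0 \<otimes> x0 \<oplus> x0 \<otimes> s' \<oplus> x0 \<otimes> s' \<ominus> x1 \<otimes> x1 \<ominus> x2 \<otimes> x2 \<ominus> x3 \<otimes> x3"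
          using xs(2-) s'(1) by algebra
        also have "\<dots> = x0 \<otimes> ((x0 \<oplus> s') \<oplus> (x0 \<oplus> s'))"
          unfolding s'(2) N using xs(2-) s'(1) by algebra
        finally have e: "(x0 \<oplus> s') \<otimes> (x0 \<oplus> s') \<ominus> x1 \<otimes> x1 \<ominus> x2 \<otimes> x2 \<ominus> x3 \<otimes> x3 = x0 \<otimes> (c \<otimes> c)"
          unfolding c(2) .
        have "(x0 \<oplus> s') \<otimes> w \<otimes> ((x0 \<oplus> s') \<otimes> w) \<ominus> x1 \<otimes> w \<otimes> (x1 \<otimes> w) \<ominus> x2 \<otimes> w \<otimes> (x2 \<otimes> w)
            \<ominus> x3 \<otimes> w \<otimes> (x3 \<otimes> w)
           = ((x0 \<oplus> s') \<otimes> (x0 \<oplus> s') \<ominus> x1 \<otimes> x1 \<ominus> x2 \<otimes> x2 \<ominus> x3 \<otimes> x3) \<otimes> (w \<otimes> w)"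
          using xs(2-) s'(1) w(1) by algebra
        also have "\<dots> = x0 \<otimes> ((w \<otimes> w) \<otimes> (c \<otimes> c))" unfolding e using xs(2) c(1) w(1) by algebra
        finally show "x0 = (x0 \<oplus> s') \<otimes> w \<otimes> ((x0 \<oplus> s') \<otimes> w) \<ominus> x1 \<otimes> w \<otimes> (x1 \<otimes> w) \<ominus> x2 \<otimes> w \<otimes> (x2 \<otimes> w)
            \<ominus> x3 \<otimes> w \<otimes> (x3 \<otimes> w)" unfolding ww using xs(2) by simp
        have pure: "y = (x0 \<oplus> s') \<otimes> w \<otimes> (y \<otimes> w) \<oplus> (x0 \<oplus> s') \<otimes> w \<otimes> (y \<otimes> w)" if y: "y \<in> carrier K" for y
        proof -
          have "(x0 \<oplus> s') \<otimes> w \<otimes> (y \<otimes> w) \<oplus> (x0 \<oplus> s') \<otimes> w \<otimes> (y \<otimes> w)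
              = y \<otimes> ((w \<otimes> w) \<otimes> ((x0 \<oplus> s') \<oplus> (x0 \<oplus> s')))"
            using xs(2) s'(1) w(1) y by algebra
          then show ?thesis unfolding c(2) ww using y by simp
        qed
        show "x1 = (x0 \<oplus> s') \<otimes> w \<otimes> (x1 \<otimes> w) \<oplus> (x0 \<oplus> s') \<otimes> w \<otimes> (x1 \<otimes> w)"
          "x2 = (x0 \<oplus> s') \<otimes> w \<otimes> (x2 \<otimes> w) \<oplus> (x0 \<oplus> s') \<otimes> w \<otimes> (x2 \<otimes> w)"
          "x3 = (x0 \<oplus> s') \<otimes> w \<otimes> (x3 \<otimes> w) \<oplus> (x0 \<oplus> s') \<otimes> w \<otimes> (x3 \<otimes> w)"
          by (rule pure, fact)+
      qed (use xs s' w in auto)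
    qed
    let ?a = "(x0 \<oplus> s) \<oplus> (x0 \<oplus> s)" and ?b = "(x0 \<oplus> \<ominus> s) \<oplus> (x0 \<oplus> \<ominus> s)"
    have ab: "?a \<in> carrier K" "?b \<in> carrier K" using xs(2) s(1) by auto
    obtain c where c: "c \<in> carrier K" "?a = c \<otimes> c \<or> \<ominus> ?a = c \<otimes> c" using E1[OF ab(1)] by blast
    obtain d where d: "d \<in> carrier K" "?b = d \<otimes> d \<or> \<ominus> ?b = d \<otimes> d" using E1[OF ab(2)] by blast
    \<comment> \<open>otherwise \<open>(c d)\<^sup>2 = 4 (x\<^sub>0\<^sup>2 - s\<^sup>2) = -(2 n)\<^sup>2\<close>, where \<open>n\<^sup>2\<close> is the norm of the pure part\<close>
    have "?a = c \<otimes> c \<or> ?b = d \<otimes> d"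
    proof (rule ccontr)
      assume "\<not> ?thesis"
      then have neg: "c \<otimes> c = \<ominus> ?a" "d \<otimes> d = \<ominus> ?b" using c(2) d(2) by auto
      have "(c \<otimes> d) \<otimes> (c \<otimes> d) = (c \<otimes> c) \<otimes> (d \<otimes> d)" using c(1) d(1) by algebra
      also have "\<dots> = (x0 \<otimes> x0 \<oplus> x0 \<otimes> x0 \<oplus> x0 \<otimes> x0 \<oplus> x0 \<otimes> x0)
          \<ominus> (s \<otimes> s \<oplus> s \<otimes> s \<oplus> s \<otimes> s \<oplus> s \<otimes> s)"
        unfolding neg using xs(2) s(1) by algebra
      also have "\<dots> = \<ominus> ((n \<oplus> n) \<otimes> (n \<oplus> n))"
        unfolding s(2)[symmetric] using xs(2) n(1) by algebra
      finally have "(c \<otimes> d) \<otimes> (c \<otimes> d) \<oplus> (n \<oplus> n) \<otimes> (n \<oplus> n) = \<zero>" using n(1) by (simp add: l_neg)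
      then have "n \<oplus> n = \<zero>" using E3[of "c \<otimes> d" "n \<oplus> n"] c(1) d(1) n(1) by simp
      then show False using dbl n(1) n0 by blast
    qed
    then show ?thesis
    proof
      assume "?a = c \<otimes> c"
      then show ?thesis using main[of s c] s c by simp
    next
      assume "?b = d \<otimes> d"
      moreover have "(\<ominus> s) \<otimes> (\<ominus> s) = s \<otimes> s" using s(1) by algebra
      ultimately show ?thesis using main[of "\<ominus> s" d] s d by simp
    qed
  qed
qed

section \<open>The structure of quaternion division algebras\<close>

context ring
begin

definition centralizer_of :: "'a \<Rightarrow> 'a set" where
  "centralizer_of x = {z \<in> carrier R. z \<otimes> x = x \<otimes> z}"

lemma centralizer_sub: "z \<in> centralizer_of x \<Longrightarrow> z \<in> carrier R"
  and centralizer_comm: "z \<in> centralizer_of x \<Longrightarrow> z \<otimes> x = x \<otimes> z"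
  by (simp_all add: centralizer_of_def)

lemma centralizer_subring:
  assumes x: "x \<in> carrier R" shows "subring (centralizer_of x) R"
proof (rule subringI)
  fix h k assume h: "h \<in> centralizer_of x" and k: "k \<in> centralizer_of x"
  note c = centralizer_sub[OF h] centralizer_sub[OF k] and e = centralizer_comm[OF h] centralizer_comm[OF k]
  show "h \<oplus> k \<in> centralizer_of x" using c e x by (simp add: centralizer_of_def l_distr r_distr)
  have "h \<otimes> k \<otimes> x = h \<otimes> (x \<otimes> k)" using c x e(2) by (simp add: m_assoc)
  also have "\<dots> = x \<otimes> (h \<otimes> k)" using c x e(1) by (simp add: m_assoc[symmetric])
  finally show "h \<otimes> k \<in> centralizer_of x" using c by (simp add: centralizer_of_def)
next
  fix h assume h: "h \<in> centralizer_of x"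
  then show "\<ominus> h \<in> centralizer_of x" using x by (auto simp: centralizer_of_def l_minus r_minus)
qed (use x in \<open>auto simp: centralizer_of_def\<close>)

lemma center_iff: "z \<in> ring_center R \<longleftrightarrow> z \<in> carrier R \<and> (\<forall>x\<in>carrier R. z \<in> centralizer_of x)"
  by (auto simp: ring_center_def centralizer_of_def)

lemma center_comm: "c \<in> ring_center R \<Longrightarrow> x \<in> carrier R \<Longrightarrow> x \<otimes> c = c \<otimes> x"
  unfolding ring_center_def by simp

lemma center_minus: "c \<in> ring_center R \<Longrightarrow> \<ominus> c \<in> ring_center R"
  and center_add: "c \<in> ring_center R \<Longrightarrow> d \<in> ring_center R \<Longrightarrow> c \<oplus> d \<in> ring_center R"
  and center_mult: "c \<in> ring_center R \<Longrightarrow> d \<in> ring_center R \<Longrightarrow> c \<otimes> d \<in> ring_center R"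
  and center_one: "\<one> \<in> ring_center R" and center_zero: "\<zero> \<in> ring_center R"
  using subringE[OF center_subring] by auto

lemma center_sub: "c \<in> ring_center R \<Longrightarrow> d \<in> ring_center R \<Longrightarrow> c \<ominus> d \<in> ring_center R"
  by (simp add: minus_eq center_add center_minus)

text \<open>If \<open>x\<close> is a root of \<open>X\<^sup>2 - t X + n\<close> with central coefficients, then every additive
  commutator of \<open>x\<close> intertwines \<open>x\<close> with its conjugate \<open>t - x\<close>.\<close>

lemma commutator_intertwines:
  assumes x: "x \<in> carrier R" and z: "z \<in> carrier R" and t: "t \<in> ring_center R" and n: "n \<in> ring_center R"
    and q: "x \<otimes> x = t \<otimes> x \<ominus> n"
  shows "x \<otimes> (x \<otimes> z \<ominus> z \<otimes> x) = (x \<otimes> z \<ominus> z \<otimes> x) \<otimes> (t \<ominus> x)"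
proof -
  note c = center_closed[OF t] center_closed[OF n]
  have "x \<otimes> (x \<otimes> z \<ominus> z \<otimes> x) = (x \<otimes> x) \<otimes> z \<ominus> x \<otimes> z \<otimes> x" using x z by algebra
  also have "\<dots> = t \<otimes> (x \<otimes> z) \<ominus> n \<otimes> z \<ominus> x \<otimes> z \<otimes> x" unfolding q using x z c by algebra
  finally have 1: "x \<otimes> (x \<otimes> z \<ominus> z \<otimes> x) = t \<otimes> (x \<otimes> z) \<ominus> n \<otimes> z \<ominus> x \<otimes> z \<otimes> x" .
  have "(x \<otimes> z \<ominus> z \<otimes> x) \<otimes> (t \<ominus> x) = x \<otimes> z \<otimes> t \<ominus> z \<otimes> (x \<otimes> t) \<ominus> x \<otimes> z \<otimes> x \<oplus> z \<otimes> (x \<otimes> x)"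
    using x z c by algebra
  also have "\<dots> = t \<otimes> (x \<otimes> z) \<ominus> z \<otimes> (t \<otimes> x) \<ominus> x \<otimes> z \<otimes> x \<oplus> z \<otimes> (t \<otimes> x \<ominus> n)"
    unfolding q using center_comm[OF t, of "x \<otimes> z"] center_comm[OF t x] x z by simp
  also have "\<dots> = t \<otimes> (x \<otimes> z) \<ominus> z \<otimes> n \<ominus> x \<otimes> z \<otimes> x" using x z c by algebra
  also have "z \<otimes> n = n \<otimes> z" by (rule center_comm[OF n z])
  finally show ?thesis unfolding 1 ..
qed

end

context skew_field
begin

lemma center_subfield: "subfield (ring_center R) R"
proof (rule subfieldI)
  show "subcring (ring_center R) R"
    by (rule subcringI[OF center_subring]) (use center_comm center_closed in auto)
  show "Units (R\<lparr>carrier := ring_center R\<rparr>) = ring_center R - {\<zero>}"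
  proof (intro equalityI subsetI)
    fix c assume "c \<in> Units (R\<lparr>carrier := ring_center R\<rparr>)"
    then obtain d where "c \<in> ring_center R" "d \<in> ring_center R" "c \<otimes> d = \<one>" by (auto simp: Units_def)
    then show "c \<in> ring_center R - {\<zero>}" using one_neq_zero center_closed by auto
  next
    fix c assume c: "c \<in> ring_center R - {\<zero>}"
    then have "inv c \<in> ring_center R" "c \<otimes> inv c = \<one>" "inv c \<otimes> c = \<one>"
      using center_inv inv_skew[OF center_closed] by auto
    then show "c \<in> Units (R\<lparr>carrier := ring_center R\<rparr>)" using c by (auto simp: Units_def)
  qed
qed

lemma centralizer_inv:
  assumes z: "z \<in> centralizer_of x" "z \<noteq> \<zero>" and x: "x \<in> carrier R"
  shows "inv z \<in> centralizer_of x"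
proof -
  note zc = centralizer_sub[OF z(1)]
  note iz = inv_skew[OF zc z(2)]
  have "inv z \<otimes> x = inv z \<otimes> (x \<otimes> z) \<otimes> inv z" using iz zc x by (simp add: m_assoc)
  also have "\<dots> = inv z \<otimes> z \<otimes> x \<otimes> inv z"
    unfolding centralizer_comm[OF z(1), symmetric] using iz(2) zc x by (simp only: m_assoc m_closed)
  also have "\<dots> = x \<otimes> inv z" using iz x by simp
  finally show ?thesis using iz by (simp add: centralizer_of_def)
qed

end

locale quaternion_skew_field = skew_field +
  assumes dim4: "dimension 4 (ring_center R) (carrier R)"
begin

abbreviation F :: "'a set" where "F \<equiv> ring_center R"

text \<open>Together with the existence of noncentral elements this is all that is used about the dimension.\<close>

lemma five_dependent:
  assumes "set [a0, a1, a2, a3, a4] \<subseteq> carrier R"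
  shows "\<exists>c0\<in>F. \<exists>c1\<in>F. \<exists>c2\<in>F. \<exists>c3\<in>F. \<exists>c4\<in>F. \<not> (c0 = \<zero> \<and> c1 = \<zero> \<and> c2 = \<zero> \<and> c3 = \<zero> \<and> c4 = \<zero>) \<and>
    c0 \<otimes> a0 \<oplus> (c1 \<otimes> a1 \<oplus> (c2 \<otimes> a2 \<oplus> (c3 \<otimes> a3 \<oplus> c4 \<otimes> a4))) = \<zero>"
proof -
  have "dependent F [a0, a1, a2, a3, a4]"
    using independent_length_le_dimension[OF center_subfield dim4 _ assms] by auto
  then obtain Ks where Ks: "length Ks = length [a0, a1, a2, a3, a4]" "combine Ks [a0, a1, a2, a3, a4] = \<zero>"
      "set Ks \<subseteq> F" "set Ks \<noteq> {\<zero>}"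
    using dependent_imp_non_trivial_combine[OF center_subfield assms] by blast
  from Ks(1) obtain c0 c1 c2 c3 c4 where K: "Ks = [c0, c1, c2, c3, c4]"
    by (auto simp: length_Suc_conv)
  have c: "c0 \<in> F" "c1 \<in> F" "c2 \<in> F" "c3 \<in> F" "c4 \<in> F" using Ks(3) K by simp_all
  have "\<not> (c0 = \<zero> \<and> c1 = \<zero> \<and> c2 = \<zero> \<and> c3 = \<zero> \<and> c4 = \<zero>)" using Ks(4) K by auto
  moreover have "c0 \<otimes> a0 \<oplus> (c1 \<otimes> a1 \<oplus> (c2 \<otimes> a2 \<oplus> (c3 \<otimes> a3 \<oplus> c4 \<otimes> a4))) = \<zero>"
    using Ks(2) assms c[THEN center_closed] by (simp add: K)
  ultimately show ?thesis using c by blast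
qed

lemma not_central: "\<exists>x\<in>carrier R. x \<notin> F"
proof (rule ccontr)
  assume "\<not> ?thesis"
  then have "F = carrier R" using center_closed by auto
  then have "dimension 4 F F" using dim4 by simp
  then have "(4::nat) = 1"
    using dimension_is_inj[OF center_subfield] dimension_one[OF center_subfield] by blast
  then show False by simp
qed

lemma not_central_noncommuting:
  "x \<in> carrier R \<Longrightarrow> x \<notin> F \<Longrightarrow> \<exists>y\<in>carrier R. x \<otimes> y \<noteq> y \<otimes> x"
  by (auto simp: ring_center_def)

lemma affine_zero:
  assumes x: "x \<in> carrier R" "x \<notin> F" and c: "c \<in> F" "d \<in> F" and 0: "c \<oplus> d \<otimes> x = \<zero>"
  shows "c = \<zero> \<and> d = \<zero>"
proof -
  have d0: "d = \<zero>"
  proof (rule ccontr)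
    assume d0: "d \<noteq> \<zero>"
    note id = inv_skew[OF center_closed[OF c(2)] d0]
    have "d \<otimes> x = \<ominus> c" using 0 c x center_closed by (metis a_comm m_closed minus_equality minus_minus)
    then have "inv d \<otimes> (d \<otimes> x) = inv d \<otimes> (\<ominus> c)" by simp
    then have "x = inv d \<otimes> (\<ominus> c)" using id x c center_closed by (simp add: m_assoc[symmetric])
    then show False using x(2) center_mult center_inv[OF c(2) d0] center_minus c(1) by simp
  qed
  then show ?thesis using 0 x c center_closed by simp
qed

lemma affine_centralizer:
  assumes x: "x \<in> carrier R" and c: "c \<in> F" "d \<in> F"
  shows "c \<oplus> d \<otimes> x \<in> centralizer_of x"
proof -
  have "c \<in> centralizer_of x" "d \<in> centralizer_of x" using c x center_iff by blast+
  moreover have "x \<in> centralizer_of x" using x by (simp add: centralizer_of_def)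
  ultimately show ?thesis using subringE(6,7)[OF centralizer_subring[OF x]] by blast
qed

text \<open>Otherwise \<open>y = -b\<^sup>-\<^sup>1 a\<close> would commute with \<open>x\<close>.\<close>

lemma centralizer_pair_zero:
  assumes x: "x \<in> carrier R" and y: "y \<in> carrier R" and nc: "x \<otimes> y \<noteq> y \<otimes> x"
    and ab: "a \<in> centralizer_of x" "b \<in> centralizer_of x" and 0: "a \<oplus> b \<otimes> y = \<zero>"
  shows "a = \<zero> \<and> b = \<zero>"
proof -
  note S = subringE[OF centralizer_subring[OF x]]
  note abc = ab[THEN centralizer_sub]
  have b0: "b = \<zero>"
  proof (rule ccontr)
    assume b0: "b \<noteq> \<zero>"
    note ib = inv_skew[OF abc(2) b0]
    have "b \<otimes> y = \<ominus> a" using 0 abc y by (metis a_comm m_closed minus_equality minus_minus)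
    then have "inv b \<otimes> (b \<otimes> y) = inv b \<otimes> (\<ominus> a)" by simp
    then have "y = inv b \<otimes> (\<ominus> a)" using ib y abc by (simp add: m_assoc[symmetric])
    then have "y \<in> centralizer_of x" using S(5,6) centralizer_inv[OF ab(2) b0 x] ab(1) by simp
    then show False using nc centralizer_comm by metis
  qed
  then show ?thesis using 0 y abc by simp
qed

text \<open>The elements \<open>1, x, y, x y\<close> are independent over the center, and together with \<open>z\<close> they are
  dependent.\<close>

lemma quaternion_coordinates:
  assumes x: "x \<in> carrier R" and y: "y \<in> carrier R" and nc: "x \<otimes> y \<noteq> y \<otimes> x" and z: "z \<in> carrier R"
  shows "\<exists>a\<in>F. \<exists>b\<in>F. \<exists>c\<in>F. \<exists>d\<in>F. z = (a \<oplus> b \<otimes> x) \<oplus> (c \<oplus> d \<otimes> x) \<otimes> y"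
proof -
  have xF: "x \<notin> F" using nc y center_comm by metis
  obtain k a b c d where k: "k \<in> F" "a \<in> F" "b \<in> F" "c \<in> F" "d \<in> F"
    and nz: "\<not> (k = \<zero> \<and> a = \<zero> \<and> b = \<zero> \<and> c = \<zero> \<and> d = \<zero>)"
    and eq: "k \<otimes> z \<oplus> (a \<otimes> \<one> \<oplus> (b \<otimes> x \<oplus> (c \<otimes> y \<oplus> d \<otimes> (x \<otimes> y)))) = \<zero>"
    using five_dependent[of z \<one> x y "x \<otimes> y"] x y z by auto
  note kc = k[THEN center_closed]
  define w where "w = (a \<oplus> b \<otimes> x) \<oplus> (c \<oplus> d \<otimes> x) \<otimes> y"
  have wc: "w \<in> carrier R" using kc x y by (simp add: w_def)
  have "a \<otimes> \<one> \<oplus> (b \<otimes> x \<oplus> (c \<otimes> y \<oplus> d \<otimes> (x \<otimes> y))) = w"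
    unfolding w_def using kc x y by (simp add: l_distr m_assoc a_assoc)
  then have eq: "k \<otimes> z \<oplus> w = \<zero>" using eq by simp
  have k0: "k \<noteq> \<zero>"
  proof
    assume k0: "k = \<zero>"
    then have "w = \<zero>" using eq z wc by simp
    then have "a \<oplus> b \<otimes> x = \<zero> \<and> c \<oplus> d \<otimes> x = \<zero>"
      unfolding w_def using centralizer_pair_zero[OF x y nc] affine_centralizer[OF x] k by blast
    then show False using affine_zero[OF x xF] k nz k0 by blast
  qed
  note ik = inv_skew[OF kc(1) k0]
  have "k \<otimes> z = \<ominus> w" using eq kc z wc by (metis m_closed minus_equality)
  then have "inv k \<otimes> (k \<otimes> z) = inv k \<otimes> (\<ominus> w)" by simp
  then have zw: "z = inv k \<otimes> (\<ominus> w)" using ik z kc by (simp add: m_assoc[symmetric])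
  define l where "l = \<ominus> (inv k)"
  have l: "l \<in> F" "l \<in> carrier R"
    using center_minus center_inv[OF k(1) k0] ik by (auto simp: l_def)
  have "z = l \<otimes> w" unfolding zw l_def using ik(2) wc by (simp add: l_minus r_minus)
  also have "\<dots> = (l \<otimes> a \<oplus> l \<otimes> b \<otimes> x) \<oplus> (l \<otimes> c \<oplus> l \<otimes> d \<otimes> x) \<otimes> y"
    unfolding w_def using l(2) kc x y by algebra
  finally show ?thesis using l(1) k center_mult by blast
qed

text \<open>In the coordinates with respect to \<open>x\<close> and some \<open>y\<close> that does not commute with \<open>x\<close>, the part
  involving \<open>y\<close> must vanish.\<close>

lemma centralizer_affine:
  assumes x: "x \<in> carrier R" "x \<notin> F" and z: "z \<in> centralizer_of x"
  shows "\<exists>a\<in>F. \<exists>b\<in>F. z = a \<oplus> b \<otimes> x"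
proof -
  obtain y where y: "y \<in> carrier R" "x \<otimes> y \<noteq> y \<otimes> x" using not_central_noncommuting x by blast
  obtain a b c d where abcd: "a \<in> F" "b \<in> F" "c \<in> F" "d \<in> F"
    and zeq: "z = (a \<oplus> b \<otimes> x) \<oplus> (c \<oplus> d \<otimes> x) \<otimes> y"
    using quaternion_coordinates[OF x(1) y centralizer_sub[OF z]] by blast
  note cc = abcd[THEN center_closed] and zc = centralizer_sub[OF z]
  note S = subringE[OF centralizer_subring[OF x(1)]]
  have "(a \<oplus> b \<otimes> x) \<oplus> \<ominus> z \<in> centralizer_of x"
    using S(5,7) affine_centralizer[OF x(1)] abcd z by blast
  moreover have e: "((a \<oplus> b \<otimes> x) \<oplus> \<ominus> z) \<oplus> (c \<oplus> d \<otimes> x) \<otimes> y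
      = ((a \<oplus> b \<otimes> x) \<oplus> (c \<oplus> d \<otimes> x) \<otimes> y) \<ominus> z" using cc x(1) y(1) zc by algebra
  moreover have "((a \<oplus> b \<otimes> x) \<oplus> \<ominus> z) \<oplus> (c \<oplus> d \<otimes> x) \<otimes> y = \<zero>"
    unfolding e zeq[symmetric] using zc by (simp add: minus_eq r_neg)
  ultimately have "(a \<oplus> b \<otimes> x) \<oplus> \<ominus> z = \<zero>"
    using centralizer_pair_zero[OF x(1) y, of "(a \<oplus> b \<otimes> x) \<oplus> \<ominus> z" "c \<oplus> d \<otimes> x"]
      affine_centralizer[OF x(1) abcd(3,4)] by blast
  then have "a \<oplus> b \<otimes> x = z" using cc x zc by (metis a_closed m_closed minus_eq r_right_minus_eq)
  then show ?thesis using abcd by blast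
qed

text \<open>The square of \<open>x\<close> commutes with \<open>x\<close>.\<close>

lemma quadratic:
  assumes x: "x \<in> carrier R" "x \<notin> F"
  obtains t n where "t \<in> F" "n \<in> F" "x \<otimes> x = t \<otimes> x \<ominus> n"
proof -
  have "x \<otimes> x \<in> centralizer_of x" using x by (simp add: centralizer_of_def m_assoc)
  then obtain a b where ab: "a \<in> F" "b \<in> F" "x \<otimes> x = a \<oplus> b \<otimes> x" using centralizer_affine[OF x] by blast
  note cc = ab(1,2)[THEN center_closed]
  have "a \<oplus> b \<otimes> x = b \<otimes> x \<ominus> (\<ominus> a)" using cc x(1) by algebra
  then show thesis using that[OF ab(2) center_minus[OF ab(1)]] ab(3) by simp
qed

lemma center_if_commutes:
  assumes x: "x \<in> carrier R" and y: "y \<in> carrier R" and nc: "x \<otimes> y \<noteq> y \<otimes> x"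
    and z: "z \<in> carrier R" "z \<otimes> x = x \<otimes> z" "z \<otimes> y = y \<otimes> z"
  shows "z \<in> F"
proof -
  have "w \<in> centralizer_of z" if w: "w \<in> carrier R" for w
  proof -
    note S = subringE[OF centralizer_subring[OF z(1)]]
    obtain a b c d where abcd: "a \<in> F" "b \<in> F" "c \<in> F" "d \<in> F"
      and weq: "w = (a \<oplus> b \<otimes> x) \<oplus> (c \<oplus> d \<otimes> x) \<otimes> y"
      using quaternion_coordinates[OF x y nc w] by blast
    have "a \<in> centralizer_of z" "b \<in> centralizer_of z" "c \<in> centralizer_of z" "d \<in> centralizer_of z"
      using abcd z(1) center_iff by blast+
    moreover have "x \<in> centralizer_of z" "y \<in> centralizer_of z" using x y z by (simp_all add: centralizer_of_def)
    ultimately show ?thesis unfolding weq by (intro S(6,7))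
  qed
  then have "z \<otimes> w = w \<otimes> z" if "w \<in> carrier R" for w using centralizer_comm[of w z] that by simp
  then show ?thesis using z(1) unfolding ring_center_def by blast
qed

lemma double_zero:
  assumes two: "\<one> \<oplus> \<one> = \<zero>" and a: "a \<in> carrier R" shows "\<ominus> a = a"
proof -
  have "a \<oplus> a = (\<one> \<oplus> \<one>) \<otimes> a" using a by algebra
  then show ?thesis using two a by (simp add: minus_equality)
qed

text \<open>A separable generator exists. Otherwise every additive commutator of \<open>x\<close> commutes with
  \<open>x\<close>, so that \<open>x\<close> equals its conjugate: the characteristic is two and all squares are central.
  But then \<open>x z + z x\<close> and \<open>x (x z + z x)\<close> are both central, hence so is \<open>x\<close>.\<close>

lemma separable_generator:
  obtains x y t where "x \<in> carrier R" "y \<in> carrier R" "t \<in> F" "x \<otimes> y \<noteq> y \<otimes> x"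
    "x \<otimes> y = y \<otimes> (t \<ominus> x)"
proof (rule ccontr)
  note witness = that
  assume no: "\<not> thesis"
  have noncent: "x \<notin> F" if "x \<otimes> z \<noteq> z \<otimes> x" "z \<in> carrier R" for x z using that center_comm by metis
  have key: "\<one> \<oplus> \<one> = \<zero> \<and> x \<otimes> x \<in> F" if x: "x \<in> carrier R" "x \<notin> F" for x
  proof -
    obtain z where z: "z \<in> carrier R" "x \<otimes> z \<noteq> z \<otimes> x" using not_central_noncommuting x by blast
    obtain t n where tn: "t \<in> F" "n \<in> F" "x \<otimes> x = t \<otimes> x \<ominus> n" using quadratic[OF x] by blast
    note tc = center_closed[OF tn(1)] center_closed[OF tn(2)]
    define w where "w = x \<otimes> z \<ominus> z \<otimes> x"
    have w: "w \<in> carrier R" "w \<noteq> \<zero>" using x z by (auto simp: w_def)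
    have xw: "x \<otimes> w = w \<otimes> (t \<ominus> x)" unfolding w_def by (rule commutator_intertwines[OF x(1) z(1) tn])
    then have "x \<otimes> w = w \<otimes> x" using no witness[OF x(1) w(1) tn(1) _ xw] by blast
    then have "w \<otimes> x = w \<otimes> (t \<ominus> x)" using xw by simp
    then have "w \<otimes> (x \<ominus> (t \<ominus> x)) = \<zero>" using w(1) x(1) tc by (simp add: minus_eq r_distr r_minus r_neg)
    then have "x \<ominus> (t \<ominus> x) = \<zero>" using skew_integral[OF w(1)] w(2) x(1) tc by simp
    moreover have "x \<ominus> (t \<ominus> x) = (\<ominus> t) \<oplus> (\<one> \<oplus> \<one>) \<otimes> x" using x(1) tc by algebra
    ultimately have "\<ominus> t = \<zero> \<and> \<one> \<oplus> \<one> = \<zero>"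
      using affine_zero[OF x] center_minus[OF tn(1)] center_add[OF center_one center_one] by simp
    moreover from this have "t = \<zero>" using tc by (metis minus_minus minus_zero)
    ultimately show ?thesis using tn x tc center_minus by (simp add: minus_eq)
  qed
  obtain x where x: "x \<in> carrier R" "x \<notin> F" using not_central by blast
  obtain z where z: "z \<in> carrier R" "x \<otimes> z \<noteq> z \<otimes> x" using not_central_noncommuting x by blast
  have two: "\<one> \<oplus> \<one> = \<zero>" using key[OF x] by blast
  have sq: "u \<otimes> u \<in> F" if "u \<in> carrier R" for u using key that center_mult by blast
  have anti: "u \<otimes> v \<oplus> v \<otimes> u \<in> F" if u: "u \<in> carrier R" and v: "v \<in> carrier R" for u v
  proof -
    have "u \<otimes> v \<oplus> v \<otimes> u = (u \<oplus> v) \<otimes> (u \<oplus> v) \<ominus> u \<otimes> u \<ominus> v \<otimes> v" using u v by algebra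
    then show ?thesis using sq u v center_sub by simp
  qed
  define w where "w = x \<otimes> z \<oplus> z \<otimes> x"
  have wF: "w \<in> F" unfolding w_def by (rule anti[OF x(1) z(1)])
  have w0: "w \<noteq> \<zero>"
  proof
    assume "w = \<zero>"
    then have "x \<otimes> z = \<ominus> (z \<otimes> x)" using x(1) z(1) unfolding w_def by (metis m_closed minus_equality)
    then show False using z x double_zero[OF two, of "z \<otimes> x"] by simp
  qed
  have "x \<otimes> w = x \<otimes> (x \<otimes> z) \<oplus> (x \<otimes> z) \<otimes> x" unfolding w_def using x(1) z(1) by algebra
  then have "x \<otimes> w \<in> F" using anti[of x "x \<otimes> z"] x(1) z(1) by simp
  then have "(x \<otimes> w) \<otimes> inv w \<in> F" using center_mult center_inv[OF wF w0] by blast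
  then show False using x inv_skew[OF center_closed[OF wF] w0] center_closed[OF wF] by (simp add: m_assoc)
qed

end

section \<open>The reduced norm\<close>

text \<open>The composition law of the norm form, with independent variables in place of conjugates.\<close>

lemma (in cring) norm_form_mult:
  assumes "a \<in> carrier R" "a' \<in> carrier R" "b \<in> carrier R" "b' \<in> carrier R"
    "c \<in> carrier R" "c' \<in> carrier R" "d \<in> carrier R" "d' \<in> carrier R" "e \<in> carrier R"
  shows "(a \<otimes> c \<oplus> e \<otimes> (b \<otimes> d')) \<otimes> (a' \<otimes> c' \<oplus> e \<otimes> (b' \<otimes> d))
      \<oplus> \<ominus> (e \<otimes> ((a \<otimes> d \<oplus> b \<otimes> c') \<otimes> (a' \<otimes> d' \<oplus> b' \<otimes> c)))
    = (a \<otimes> a' \<oplus> \<ominus> (e \<otimes> (b \<otimes> b'))) \<otimes> (c \<otimes> c' \<oplus> \<ominus> (e \<otimes> (d \<otimes> d')))"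
  using assms by algebra

text \<open>The algebra is \<open>K \<oplus> K y\<close> with the quadratic extension \<open>K = F(x)\<close>. It is separable in every
  characteristic: \<open>x\<close> differs from its conjugate \<open>t - x\<close>, because it does not commute with \<open>y\<close>.\<close>

locale quaternion_generators = quaternion_skew_field +
  fixes x y t
  assumes x: "x \<in> carrier R" and y: "y \<in> carrier R" and t: "t \<in> ring_center R"
    and nc: "x \<otimes> y \<noteq> y \<otimes> x" and xy: "x \<otimes> y = y \<otimes> (t \<ominus> x)"
begin

abbreviation K :: "'a set" where "K \<equiv> centralizer_of x"

definition \<beta> :: 'a where "\<beta> = y \<otimes> y"

text \<open>On \<open>K\<close> this is the nontrivial automorphism over \<open>F\<close>. Being an inner automorphism of the whole
  algebra, it is additive and multiplicative for free.\<close>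

definition bar :: "'a \<Rightarrow> 'a" where "bar a = y \<otimes> a \<otimes> inv y"

text \<open>The reduced norm of \<open>a + b y\<close> is \<open>a a' - y\<^sup>2 b b'\<close>, where the prime is conjugation in \<open>K\<close>.\<close>

definition nrd :: "'a \<Rightarrow> 'a" where
  "nrd z = (THE v. \<exists>a\<in>K. \<exists>b\<in>K. z = a \<oplus> b \<otimes> y \<and> v = a \<otimes> bar a \<oplus> \<ominus> (\<beta> \<otimes> (b \<otimes> bar b)))"

lemma xF: "x \<notin> F" and yF: "y \<notin> F"
  using nc center_comm x y by metis+

lemma y0: "y \<noteq> \<zero>"
  using nc x by auto

lemmas iy = inv_skew[OF y y0]
lemmas tc = center_closed[OF t]

lemma yx: "y \<otimes> x = (t \<ominus> x) \<otimes> y"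
proof -
  have "(t \<ominus> x) \<otimes> y = t \<otimes> y \<ominus> y \<otimes> (t \<ominus> x)" unfolding xy[symmetric] using x y tc by algebra
  also have "\<dots> = t \<otimes> y \<ominus> y \<otimes> t \<oplus> y \<otimes> x" using x y tc by algebra
  also have "\<dots> = y \<otimes> x" using center_comm[OF t y] x y tc by (simp add: minus_eq r_neg)
  finally show ?thesis ..
qed

text \<open>The conjugation has order two, so \<open>y\<^sup>2\<close> commutes with \<open>x\<close>, and it commutes with \<open>y\<close>.\<close>

lemma \<beta>_center: "\<beta> \<in> F"
proof (rule center_if_commutes[OF x y nc])
  show "\<beta> \<in> carrier R" using y by (simp add: \<beta>_def)
  show "\<beta> \<otimes> y = y \<otimes> \<beta>" using y by (simp add: \<beta>_def m_assoc)
  have "\<beta> \<otimes> x = y \<otimes> (t \<ominus> x) \<otimes> y" using x y tc by (simp add: \<beta>_def m_assoc yx)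
  also have "\<dots> = x \<otimes> \<beta>" using x y by (simp add: xy[symmetric] \<beta>_def m_assoc)
  finally show "\<beta> \<otimes> x = x \<otimes> \<beta>" .
qed

lemmas \<beta>c = center_closed[OF \<beta>_center]

lemma K_closed: "a \<in> K \<Longrightarrow> a \<in> carrier R"
  by (rule centralizer_sub)

lemma F_K: "c \<in> F \<Longrightarrow> c \<in> K"
  using center_iff x by blast

lemma K_commute:
  assumes a: "a \<in> K" and b: "b \<in> K" shows "a \<otimes> b = b \<otimes> a"
proof -
  obtain c d where b': "c \<in> F" "d \<in> F" "b = c \<oplus> d \<otimes> x" using centralizer_affine[OF x xF b] by blast
  note S = subringE[OF centralizer_subring[OF K_closed[OF a]]]
  have "x \<in> centralizer_of a" using a x by (simp add: centralizer_of_def)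
  moreover have "c \<in> centralizer_of a" "d \<in> centralizer_of a" using b' K_closed[OF a] center_iff by blast+
  ultimately have "b \<in> centralizer_of a" unfolding b'(3) by (intro S(6,7))
  then show ?thesis by (simp add: centralizer_of_def)
qed

lemma K_ops: "a \<in> K \<Longrightarrow> b \<in> K \<Longrightarrow> a \<oplus> b \<in> K" "a \<in> K \<Longrightarrow> b \<in> K \<Longrightarrow> a \<otimes> b \<in> K" "a \<in> K \<Longrightarrow> \<ominus> a \<in> K"
  by (rule subringE[OF centralizer_subring[OF x]], assumption+)+

lemma bar_closed: "a \<in> carrier R \<Longrightarrow> bar a \<in> carrier R"
  using y iy by (simp add: bar_def)

lemma y_bar: "a \<in> carrier R \<Longrightarrow> y \<otimes> a = bar a \<otimes> y"
  using y iy by (simp add: bar_def m_assoc)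

lemma bar_eqI: "a \<in> carrier R \<Longrightarrow> b \<in> carrier R \<Longrightarrow> y \<otimes> a = b \<otimes> y \<Longrightarrow> bar a = b"
  using y iy by (simp add: bar_def m_assoc)

lemma bar_add: "a \<in> carrier R \<Longrightarrow> b \<in> carrier R \<Longrightarrow> bar (a \<oplus> b) = bar a \<oplus> bar b"
  using y iy by (simp add: bar_def l_distr r_distr)

lemma bar_mult:
  assumes "a \<in> carrier R" "b \<in> carrier R" shows "bar (a \<otimes> b) = bar a \<otimes> bar b"
proof (rule bar_eqI)
  have "y \<otimes> (a \<otimes> b) = (y \<otimes> a) \<otimes> b" using assms y by (simp add: m_assoc)
  also have "\<dots> = bar a \<otimes> (y \<otimes> b)" unfolding y_bar[OF assms(1)] using assms y bar_closed by (simp add: m_assoc)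
  finally show "y \<otimes> (a \<otimes> b) = bar a \<otimes> bar b \<otimes> y"
    unfolding y_bar[OF assms(2)] using assms y bar_closed by (simp add: m_assoc)
qed (use assms bar_closed in auto)

lemma bar_center: "c \<in> F \<Longrightarrow> bar c = c"
  by (rule bar_eqI) (use center_comm y center_closed in auto)

lemma bar_K:
  assumes a: "a \<in> K" shows "bar a \<in> K"
proof -
  obtain c d where a': "c \<in> F" "d \<in> F" "a = c \<oplus> d \<otimes> x" using centralizer_affine[OF x xF a] by blast
  have "bar x = t \<ominus> x" by (rule bar_eqI) (use x yx tc in auto)
  then have "bar a = c \<oplus> d \<otimes> (t \<oplus> \<ominus> x)"
    unfolding a'(3) using a' x center_closed by (simp add: bar_add bar_mult bar_center minus_eq)
  moreover have "x \<in> K" using x by (simp add: centralizer_of_def)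
  ultimately show ?thesis using K_ops F_K a' t by simp
qed

lemma bar_bar:
  assumes a: "a \<in> carrier R" shows "bar (bar a) = a"
proof (rule bar_eqI)
  have "y \<otimes> bar a \<otimes> y = y \<otimes> (y \<otimes> a)" unfolding y_bar[OF a] using a y bar_closed by (simp add: m_assoc)
  also have "\<dots> = a \<otimes> \<beta>" using center_comm[OF \<beta>_center a] a y by (simp add: \<beta>_def m_assoc)
  also have "\<dots> = a \<otimes> y \<otimes> y" using a y by (simp add: \<beta>_def m_assoc)
  finally have "y \<otimes> bar a \<otimes> y \<otimes> inv y = a \<otimes> y \<otimes> y \<otimes> inv y" by simp
  then show "y \<otimes> bar a = a \<otimes> y" using a y iy bar_closed by (simp add: m_assoc)
qed (use a bar_closed in auto)

lemma decompose:
  assumes "z \<in> carrier R" obtains a b where "a \<in> K" "b \<in> K" "z = a \<oplus> b \<otimes> y"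
proof -
  obtain a b c d where "a \<in> F" "b \<in> F" "c \<in> F" "d \<in> F" "z = (a \<oplus> b \<otimes> x) \<oplus> (c \<oplus> d \<otimes> x) \<otimes> y"
    using quaternion_coordinates[OF x y nc assms] by blast
  then show thesis using that affine_centralizer[OF x] by blast
qed

lemma decompose_unique:
  assumes K: "a \<in> K" "b \<in> K" "c \<in> K" "d \<in> K" and eq: "a \<oplus> b \<otimes> y = c \<oplus> d \<otimes> y"
  shows "a = c \<and> b = d"
proof -
  note kc = K[THEN K_closed]
  have "(a \<oplus> \<ominus> c) \<oplus> (b \<oplus> \<ominus> d) \<otimes> y = (a \<oplus> b \<otimes> y) \<ominus> (c \<oplus> d \<otimes> y)" using kc y by algebra
  also have "\<dots> = \<zero>" unfolding eq using kc y by (simp add: minus_eq r_neg)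
  finally have 0: "(a \<oplus> \<ominus> c) \<oplus> (b \<oplus> \<ominus> d) \<otimes> y = \<zero>" .
  have "a \<oplus> \<ominus> c \<in> K" "b \<oplus> \<ominus> d \<in> K" 
    by (rule K_ops(1)[OF K(1) K_ops(3)[OF K(3)]], rule K_ops(1)[OF K(2) K_ops(3)[OF K(4)]])
  then have "a \<oplus> \<ominus> c = \<zero> \<and> b \<oplus> \<ominus> d = \<zero>" by (rule centralizer_pair_zero[OF x y nc _ _ 0])
  then show ?thesis using kc by (metis minus_eq r_right_minus_eq)
qed

lemma nrd_eq:
  assumes "a \<in> K" "b \<in> K"
  shows "nrd (a \<oplus> b \<otimes> y) = a \<otimes> bar a \<oplus> \<ominus> (\<beta> \<otimes> (b \<otimes> bar b))"
  unfolding nrd_def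
proof (rule the_equality)
  show "\<exists>a'\<in>K. \<exists>b'\<in>K. a \<oplus> b \<otimes> y = a' \<oplus> b' \<otimes> y \<and>
      a \<otimes> bar a \<oplus> \<ominus> (\<beta> \<otimes> (b \<otimes> bar b)) = a' \<otimes> bar a' \<oplus> \<ominus> (\<beta> \<otimes> (b' \<otimes> bar b'))"
    using assms by blast
next
  fix v assume "\<exists>a'\<in>K. \<exists>b'\<in>K. a \<oplus> b \<otimes> y = a' \<oplus> b' \<otimes> y \<and> v = a' \<otimes> bar a' \<oplus> \<ominus> (\<beta> \<otimes> (b' \<otimes> bar b'))"
  then show "v = a \<otimes> bar a \<oplus> \<ominus> (\<beta> \<otimes> (b \<otimes> bar b))" using decompose_unique assms by blast
qed

lemma bar_norm_center:
  assumes a: "a \<in> K" shows "a \<otimes> bar a \<in> F"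
proof (rule center_if_commutes[OF x y nc])
  note c = K_closed[OF a] K_closed[OF bar_K[OF a]]
  show "a \<otimes> bar a \<in> carrier R" using c by simp
  show "a \<otimes> bar a \<otimes> x = x \<otimes> (a \<otimes> bar a)" using K_ops(2)[OF a bar_K[OF a]] by (rule centralizer_comm)
  have "y \<otimes> (a \<otimes> bar a) = bar (a \<otimes> bar a) \<otimes> y" using c by (intro y_bar) simp
  also have "bar (a \<otimes> bar a) = a \<otimes> bar a"
    using c bar_bar K_commute[OF a bar_K[OF a]] by (simp add: bar_mult)
  finally show "a \<otimes> bar a \<otimes> y = y \<otimes> (a \<otimes> bar a)" ..
qed

lemma nrd_center: assumes "z \<in> carrier R" shows "nrd z \<in> F"
proof -
  obtain a b where ab: "a \<in> K" "b \<in> K" "z = a \<oplus> b \<otimes> y" using decompose assms by blast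
  show ?thesis unfolding ab(3) nrd_eq[OF ab(1,2)]
    by (intro center_add bar_norm_center[OF ab(1)] center_minus
        center_mult[OF \<beta>_center bar_norm_center[OF ab(2)]])
qed

lemma K_cring: "cring (R\<lparr>carrier := K\<rparr>)"
proof -
  interpret C: ring "R\<lparr>carrier := K\<rparr>" by (rule subring_is_ring[OF centralizer_subring[OF x]])
  show ?thesis
    by (intro cring.intro C.ring_axioms comm_monoid.intro C.monoid_axioms comm_monoid_axioms.intro)
      (use K_commute in simp)
qed

text \<open>As \<open>y d = d' y\<close>, the product is \<open>(a + b y) (c + d y) = (a c + \<beta> b d') + (a d + b c') y\<close>, and the
  claim becomes an identity in the commutative ring \<open>K\<close>.\<close>

lemma nrd_mult:
  assumes z: "z \<in> carrier R" and w: "w \<in> carrier R"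
  shows "nrd (z \<otimes> w) = nrd z \<otimes> nrd w"
proof -
  interpret C: cring "R\<lparr>carrier := K\<rparr>" by (rule K_cring)
  have min: "\<ominus>\<^bsub>R\<lparr>carrier := K\<rparr>\<^esub> h = \<ominus> h" if "h \<in> K" for h
    using C.minus_equality[of "\<ominus> h" h] K_ops(3)[OF that] that K_closed[OF that] by (simp add: l_neg)
  obtain a b where ab: "a \<in> K" "b \<in> K" "z = a \<oplus> b \<otimes> y" using decompose z by blast
  obtain c d where cd: "c \<in> K" "d \<in> K" "w = c \<oplus> d \<otimes> y" using decompose w by blast
  note [simp] = K_closed[OF ab(1)] K_closed[OF ab(2)] K_closed[OF cd(1)] K_closed[OF cd(2)] y bar_closed \<beta>c
  note KK = ab(1,2) cd(1,2) bar_K[OF ab(1)] bar_K[OF ab(2)] bar_K[OF cd(1)] bar_K[OF cd(2)] F_K[OF \<beta>_center]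
  have "z \<otimes> w = a \<otimes> c \<oplus> a \<otimes> d \<otimes> y \<oplus> b \<otimes> (y \<otimes> c) \<oplus> b \<otimes> (y \<otimes> d) \<otimes> y"
    unfolding ab(3) cd(3) by (simp add: l_distr r_distr m_assoc a_assoc a_lcomm)
  also have "\<dots> = a \<otimes> c \<oplus> a \<otimes> d \<otimes> y \<oplus> b \<otimes> bar c \<otimes> y \<oplus> (b \<otimes> bar d) \<otimes> \<beta>"
    by (simp add: y_bar[of c] y_bar[of d] \<beta>_def m_assoc)
  also have "(b \<otimes> bar d) \<otimes> \<beta> = \<beta> \<otimes> (b \<otimes> bar d)" by (rule center_comm[OF \<beta>_center]) simp
  also have "a \<otimes> c \<oplus> a \<otimes> d \<otimes> y \<oplus> b \<otimes> bar c \<otimes> y \<oplus> \<beta> \<otimes> (b \<otimes> bar d)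
      = (a \<otimes> c \<oplus> \<beta> \<otimes> (b \<otimes> bar d)) \<oplus> (a \<otimes> d \<oplus> b \<otimes> bar c) \<otimes> y"
    by (simp add: l_distr a_ac)
  finally have zw: "z \<otimes> w = (a \<otimes> c \<oplus> \<beta> \<otimes> (b \<otimes> bar d)) \<oplus> (a \<otimes> d \<oplus> b \<otimes> bar c) \<otimes> y" .
  have "nrd (z \<otimes> w) = (a \<otimes> c \<oplus> \<beta> \<otimes> (b \<otimes> bar d)) \<otimes> bar (a \<otimes> c \<oplus> \<beta> \<otimes> (b \<otimes> bar d))
      \<oplus> \<ominus> (\<beta> \<otimes> ((a \<otimes> d \<oplus> b \<otimes> bar c) \<otimes> bar (a \<otimes> d \<oplus> b \<otimes> bar c)))"
    unfolding zw by (rule nrd_eq) (use KK K_ops in auto)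
  also have "bar (a \<otimes> c \<oplus> \<beta> \<otimes> (b \<otimes> bar d)) = bar a \<otimes> bar c \<oplus> \<beta> \<otimes> (bar b \<otimes> d)"
    by (simp add: bar_add bar_mult bar_bar bar_center \<beta>_center)
  also have "bar (a \<otimes> d \<oplus> b \<otimes> bar c) = bar a \<otimes> bar d \<oplus> bar b \<otimes> c"
    by (simp add: bar_add bar_mult bar_bar)
  also have "(a \<otimes> c \<oplus> \<beta> \<otimes> (b \<otimes> bar d)) \<otimes> (bar a \<otimes> bar c \<oplus> \<beta> \<otimes> (bar b \<otimes> d))
      \<oplus> \<ominus> (\<beta> \<otimes> ((a \<otimes> d \<oplus> b \<otimes> bar c) \<otimes> (bar a \<otimes> bar d \<oplus> bar b \<otimes> c)))
    = (a \<otimes> bar a \<oplus> \<ominus> (\<beta> \<otimes> (b \<otimes> bar b))) \<otimes> (c \<otimes> bar c \<oplus> \<ominus> (\<beta> \<otimes> (d \<otimes> bar d)))"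
    using C.norm_form_mult[of a "bar a" b "bar b" c "bar c" d "bar d" \<beta>] KK K_ops by (simp add: min)
  also have "\<dots> = nrd z \<otimes> nrd w" unfolding ab(3) cd(3) by (simp add: nrd_eq KK)
  finally show ?thesis .
qed

lemma nrd_of_center: "c \<in> F \<Longrightarrow> nrd c = c \<otimes> c"
  using nrd_eq[of c \<zero>] F_K[OF center_zero] F_K[of c] bar_center[of c] bar_center[OF center_zero]
    center_closed[of c] y \<beta>c by simp

lemma nrd_center_plane:
  assumes "c \<in> F" "d \<in> F" shows "nrd (c \<oplus> d \<otimes> y) = c \<otimes> c \<oplus> \<ominus> (\<beta> \<otimes> (d \<otimes> d))"
  using nrd_eq F_K assms bar_center by simp

lemma nrd_K: assumes a: "a \<in> K" shows "nrd a = a \<otimes> bar a"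
  using nrd_eq[OF a F_K[OF center_zero]] K_closed[OF a] K_closed[OF bar_K[OF a]] y \<beta>c bar_center[OF center_zero]
  by simp

lemma nrd_one: "nrd \<one> = \<one>"
  using nrd_of_center[OF center_one] by simp

lemma nrd_inv: "z \<in> carrier R \<Longrightarrow> z \<noteq> \<zero> \<Longrightarrow> nrd (inv z) \<otimes> nrd z = \<one>"
  using nrd_mult[of "inv z" z] inv_skew[of z] nrd_one by simp

text \<open>The norm is a homomorphism into the commutative group of nonzero central elements.\<close>

lemma nrd_commutators:
  assumes "q \<in> derived (mult_of R) (carrier (mult_of R))"
  shows "q \<in> carrier R \<and> q \<noteq> \<zero> \<and> nrd q = \<one>"
proof -
  interpret G: group "mult_of R" by (rule mult_of_group)
  note inc = G.derived_set_in_carrier[of "carrier (mult_of R)", OF subset_refl]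
  have inj: "nrd q = \<one>" if q: "q \<in> derived_set (mult_of R) (carrier (mult_of R))" for q
  proof -
    obtain g h where gh: "g \<in> carrier R" "g \<noteq> \<zero>" "h \<in> carrier R" "h \<noteq> \<zero>"
      "q = g \<otimes> h \<otimes> inv g \<otimes> inv h" using q inv_mult_of by auto
    note i = inv_skew[OF gh(1,2)] inv_skew[OF gh(3,4)]
    note n = nrd_center[OF gh(1)] nrd_center[OF gh(3)] nrd_center[OF i(2)] nrd_center[OF i(7)]
    have "nrd q = nrd g \<otimes> nrd h \<otimes> nrd (inv g) \<otimes> nrd (inv h)"
      unfolding gh(5) using gh i by (simp add: nrd_mult)
    also have "\<dots> = (nrd (inv g) \<otimes> nrd g) \<otimes> (nrd (inv h) \<otimes> nrd h)"
      using n[THEN center_closed] center_comm[OF n(3), of "nrd g \<otimes> nrd h"] center_comm[OF n(4), of "nrd h"]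
      by (simp add: m_assoc)
    finally show ?thesis using gh nrd_inv by simp
  qed
  show ?thesis using assms unfolding derived_def
  proof (induction rule: generate.induct)
    case one then show ?case using one_neq_zero nrd_one by simp
  next
    case (incl h) then show ?case using inj[of h] inc by auto
  next
    case (inv h)
    then have h: "h \<in> carrier R" "h \<noteq> \<zero>" "nrd h = \<one>" using inj[of h] inc by auto
    then have "nrd (inv h) = \<one>" using nrd_inv[of h] nrd_center[of "inv h"] center_closed inv_skew[of h] by simp
    then show ?case using h inv_skew[of h] inv_mult_of by simp
  next
    case (eng h1 h2)
    then show ?case using mult_nonzero nrd_mult by simp
  qed
qed

end

section \<open>Squares and commutators in quaternion division algebras\<close>

context quaternion_skew_field
begin

text \<open>Used for all nonzero central elements and for their squares.\<close>

lemma commutator_times_central_subgroup: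
  assumes C: "C \<subseteq> F - {\<zero>}" "\<one> \<in> C" "\<And>c d. c \<in> C \<Longrightarrow> d \<in> C \<Longrightarrow> c \<otimes> d \<in> C" "\<And>c. c \<in> C \<Longrightarrow> inv c \<in> C"
  shows "subgroup {q \<otimes> c | q c. q \<in> derived (mult_of R) (carrier (mult_of R)) \<and> c \<in> C} (mult_of R)"
    (is "subgroup ?S _")
proof -
  interpret G: group "mult_of R" by (rule mult_of_group)
  let ?D = "derived (mult_of R) (carrier (mult_of R))"
  interpret D: subgroup ?D "mult_of R" by (rule G.derived_is_subgroup) simp
  have Dc: "q \<in> carrier R" "q \<noteq> \<zero>" if "q \<in> ?D" for q using D.mem_carrier[OF that] by auto
  have Cc: "c \<in> F" "c \<in> carrier R" "c \<noteq> \<zero>" if "c \<in> C" for c using C(1) that center_closed by auto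
  show ?thesis
  proof (rule G.subgroupI)
    show "?S \<subseteq> carrier (mult_of R)" using Dc Cc mult_nonzero by auto
    show "?S \<noteq> {}" using D.one_closed C(2) by blast
    fix a assume "a \<in> ?S"
    then obtain q c where a: "a = q \<otimes> c" "q \<in> ?D" "c \<in> C" by blast
    note qc = Dc[OF a(2)] Cc(2,3)[OF a(3)]
    have "inv\<^bsub>mult_of R\<^esub> (c \<otimes> q) = inv q \<otimes> inv c"
      using G.inv_mult_group[of c q] qc by (simp add: inv_mult_of)
    moreover have "inv q \<in> ?D" using D.m_inv_closed[OF a(2)] qc by (simp add: inv_mult_of)
    moreover have "a = c \<otimes> q" unfolding a(1) by (rule center_comm[OF Cc(1)[OF a(3)] qc(1)])
    ultimately show "inv\<^bsub>mult_of R\<^esub> a \<in> ?S" using C(4)[OF a(3)] by auto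
    fix b assume "b \<in> ?S"
    then obtain p d where b: "b = p \<otimes> d" "p \<in> ?D" "d \<in> C" by blast
    note pd = Dc[OF b(2)] Cc(2,3)[OF b(3)]
    have "a \<otimes> b = q \<otimes> (c \<otimes> p) \<otimes> d" unfolding a b using qc pd by (simp add: m_assoc)
    also have "c \<otimes> p = p \<otimes> c" by (rule center_comm[OF Cc(1)[OF a(3)] pd(1), symmetric])
    also have "q \<otimes> (p \<otimes> c) \<otimes> d = (q \<otimes> p) \<otimes> (c \<otimes> d)" using qc pd by (simp add: m_assoc)
    finally have "a \<otimes> b = (q \<otimes> p) \<otimes> (c \<otimes> d)" .
    moreover have "q \<otimes> p \<in> ?D" using D.m_closed[OF a(2) b(2)] by simp
    ultimately show "a \<otimes>\<^bsub>mult_of R\<^esub> b \<in> ?S" using C(3)[OF a(3) b(3)] by auto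
  qed
qed

text \<open>The conjugate of \<open>a\<close> is a group-theoretic conjugate of \<open>a\<close>, so \<open>a\<^sup>2\<close> and the norm of
  \<open>a\<close> agree up to a commutator.\<close>

lemma square_central_mod_commutators:
  assumes a: "a \<in> carrier R" "a \<noteq> \<zero>"
  shows "\<exists>q\<in>derived (mult_of R) (carrier (mult_of R)). \<exists>n\<in>F - {\<zero>}. a \<otimes> a = q \<otimes> n"
proof -
  interpret G: group "mult_of R" by (rule mult_of_group)
  let ?D = "derived (mult_of R) (carrier (mult_of R))"
  interpret D: subgroup ?D "mult_of R" by (rule G.derived_is_subgroup) simp
  show ?thesis
  proof (cases "a \<in> F")
    case True
    moreover have "\<one> \<in> ?D" using D.one_closed by simp
    ultimately show ?thesis using a mult_nonzero center_mult
      by (intro bexI[of _ \<one>] bexI[of _ "a \<otimes> a"]) auto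
  next
    case False
    obtain z where z: "z \<in> carrier R" "a \<otimes> z \<noteq> z \<otimes> a" using not_central_noncommuting a False by blast
    obtain t n where tn: "t \<in> F" "n \<in> F" "a \<otimes> a = t \<otimes> a \<ominus> n" using quadratic[OF a(1) False] by blast
    note tc = center_closed[OF tn(1)] center_closed[OF tn(2)]
    define y where "y = a \<otimes> z \<ominus> z \<otimes> a"
    have y: "y \<in> carrier R" "y \<noteq> \<zero>" using a z by (auto simp: y_def)
    note iy = inv_skew[OF y] and ia = inv_skew[OF a]
    have "a \<otimes> y = y \<otimes> (t \<ominus> a)" unfolding y_def by (rule commutator_intertwines[OF a(1) z(1) tn])
    then have "inv y \<otimes> (a \<otimes> y) = inv y \<otimes> (y \<otimes> (t \<ominus> a))" by simp
    then have conj: "inv y \<otimes> (a \<otimes> y) = t \<ominus> a" using iy y a tc by (simp add: m_assoc[symmetric])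
    have n: "a \<otimes> (t \<ominus> a) = n"
    proof -
      have "a \<otimes> (t \<ominus> a) = a \<otimes> t \<ominus> (t \<otimes> a \<ominus> n)" unfolding tn(3)[symmetric] using a tc by algebra
      also have "a \<otimes> t = t \<otimes> a" by (rule center_comm[OF tn(1) a(1)])
      also have "t \<otimes> a \<ominus> (t \<otimes> a \<ominus> n) = n" using a tc by algebra
      finally show ?thesis .
    qed
    have n0: "n \<noteq> \<zero>"
    proof -
      have "inv y \<otimes> (a \<otimes> y) \<noteq> \<zero>" using iy y a mult_nonzero by simp
      then show ?thesis unfolding conj n[symmetric] using a tc mult_nonzero by simp
    qed
    let ?q = "a \<otimes> inv y \<otimes> inv a \<otimes> y"
    have "a \<otimes> a = ?q \<otimes> n"
    proof -
      have "n = (t \<ominus> a) \<otimes> a"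
        using n center_comm[OF tn(1) a(1)] a tc by (simp add: minus_eq l_distr r_distr l_minus r_minus)
      then have "?q \<otimes> n = ?q \<otimes> (inv y \<otimes> (a \<otimes> y) \<otimes> a)" unfolding conj by simp
      also have "\<dots> = a \<otimes> inv y \<otimes> inv a \<otimes> (y \<otimes> inv y) \<otimes> a \<otimes> y \<otimes> a"
        using a y iy(2) ia(2) by (simp only: m_assoc m_closed)
      also have "\<dots> = a \<otimes> inv y \<otimes> (inv a \<otimes> a) \<otimes> y \<otimes> a" using a y iy ia by (simp add: m_assoc)
      also have "\<dots> = a \<otimes> (inv y \<otimes> y) \<otimes> a" using a y iy ia by (simp add: m_assoc)
      also have "\<dots> = a \<otimes> a" using a iy by simp
      finally show ?thesis ..
    qed
    moreover have "?q \<in> ?D"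
    proof -
      have "?q = a \<otimes>\<^bsub>mult_of R\<^esub> inv y \<otimes>\<^bsub>mult_of R\<^esub> inv\<^bsub>mult_of R\<^esub> a \<otimes>\<^bsub>mult_of R\<^esub> inv\<^bsub>mult_of R\<^esub> (inv y)"
        using a y iy by (simp add: inv_mult_of)
      then show ?thesis unfolding derived_def using a iy by (intro generate.incl) auto
    qed
    ultimately show ?thesis using tn(2) n0 by blast
  qed
qed

text \<open>First every element is a commutator times a central element; the square of such an element is a
  commutator times a central square. Both kinds of elements form subgroups that contain all
  squares.\<close>

lemma central_squares_if_no_index_two:
  assumes no: "\<nexists>H. subgroup H (mult_of R) \<and> card (rcosets\<^bsub>mult_of R\<^esub> H) = 2"
    and a: "a \<in> carrier R" "a \<noteq> \<zero>"
  shows "\<exists>f\<in>F - {\<zero>}. \<exists>q\<in>derived (mult_of R) (carrier (mult_of R)). a = q \<otimes> (f \<otimes> f)"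
proof -
  interpret G: group "mult_of R" by (rule mult_of_group)
  let ?D = "derived (mult_of R) (carrier (mult_of R))"
  interpret D: subgroup ?D "mult_of R" by (rule G.derived_is_subgroup) simp
  have all: "a \<in> S" if "subgroup S (mult_of R)" "\<And>a. a \<in> carrier R \<Longrightarrow> a \<noteq> \<zero> \<Longrightarrow> a \<otimes> a \<in> S"
    "a \<in> carrier R" "a \<noteq> \<zero>" for S a
    using G.exists_index_two[of S a] no that by auto
  have Fc: "c \<in> carrier R" if "c \<in> F" for c using that center_closed by blast
  define C where "C = F - {\<zero>}"
  define C2 where "C2 = {f \<otimes> f | f. f \<in> C}"
  have C: "\<one> \<in> C" "\<And>c d. c \<in> C \<Longrightarrow> d \<in> C \<Longrightarrow> c \<otimes> d \<in> C" "\<And>c. c \<in> C \<Longrightarrow> inv c \<in> C"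
    unfolding C_def using center_one one_neq_zero center_mult mult_nonzero Fc center_inv inv_skew(5) by auto
  have s1: "subgroup {q \<otimes> c | q c. q \<in> ?D \<and> c \<in> C} (mult_of R)"
    by (rule commutator_times_central_subgroup) (use C in \<open>auto simp: C_def\<close>)
  have one: "\<exists>q\<in>?D. \<exists>c\<in>C. a = q \<otimes> c" if "a \<in> carrier R" "a \<noteq> \<zero>" for a
    using all[OF s1 _ that] square_central_mod_commutators unfolding C_def by blast
  have s2: "subgroup {q \<otimes> c | q c. q \<in> ?D \<and> c \<in> C2} (mult_of R)"
  proof (rule commutator_times_central_subgroup)
    have "C2 \<subseteq> C" using C(2) by (auto simp: C2_def)
    then show "C2 \<subseteq> F - {\<zero>}" by (simp add: C_def)
    have "\<one> = \<one> \<otimes> \<one>" by simp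
    then show "\<one> \<in> C2" using C(1) unfolding C2_def by blast
    fix c assume "c \<in> C2"
    then obtain f where f: "f \<in> C" "c = f \<otimes> f" unfolding C2_def by blast
    then have fc: "f \<in> F" "f \<in> carrier R" "f \<noteq> \<zero>" using Fc by (auto simp: C_def)
    have "inv c = inv f \<otimes> inv f"
      using G.inv_mult_group[of f f] fc mult_nonzero by (simp add: inv_mult_of f(2))
    then show "inv c \<in> C2" using C(3)[OF f(1)] unfolding C2_def by blast
    fix d assume "d \<in> C2"
    then obtain g where g: "g \<in> C" "d = g \<otimes> g" unfolding C2_def by blast
    then have gc: "g \<in> carrier R" using Fc by (auto simp: C_def)
    have "c \<otimes> d = f \<otimes> (f \<otimes> g) \<otimes> g" unfolding f g using fc gc by (simp add: m_assoc)
    also have "f \<otimes> g = g \<otimes> f" by (rule center_comm[OF fc(1) gc, symmetric])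
    also have "f \<otimes> (g \<otimes> f) \<otimes> g = (f \<otimes> g) \<otimes> (f \<otimes> g)" using fc gc by (simp add: m_assoc)
    finally show "c \<otimes> d \<in> C2" using C(2)[OF f(1) g(1)] unfolding C2_def by blast
  qed
  have "b \<otimes> b \<in> {q \<otimes> c | q c. q \<in> ?D \<and> c \<in> C2}" if b: "b \<in> carrier R" "b \<noteq> \<zero>" for b
  proof -
    obtain q c where q: "q \<in> ?D" and c: "c \<in> C" and bq: "b = q \<otimes> c" using one[OF b] by blast
    have qc: "q \<in> carrier R" "c \<in> F" "c \<in> carrier R" using D.mem_carrier[OF q] c Fc by (auto simp: C_def)
    have "b \<otimes> b = q \<otimes> (c \<otimes> q) \<otimes> c" unfolding bq using qc by (simp add: m_assoc)
    also have "c \<otimes> q = q \<otimes> c" by (rule center_comm[OF qc(2,1), symmetric])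
    also have "q \<otimes> (q \<otimes> c) \<otimes> c = (q \<otimes> q) \<otimes> (c \<otimes> c)" using qc by (simp add: m_assoc)
    finally have "b \<otimes> b = (q \<otimes> q) \<otimes> (c \<otimes> c)" .
    moreover have "q \<otimes> q \<in> ?D" using D.m_closed[OF q q] by simp
    ultimately show ?thesis using c unfolding C2_def by blast
  qed
  then have "a \<in> {q \<otimes> c | q c. q \<in> ?D \<and> c \<in> C2}" by (intro all[OF s2 _ a])
  then show ?thesis unfolding C2_def C_def by blast
qed

end

lemma (in skew_field) character_of_index_two:
  assumes H: "subgroup H (mult_of R)" and two: "card (rcosets\<^bsub>mult_of R\<^esub> H) = 2"
  shows "skew_field_character R (\<lambda>a. if a \<in> H then 0 else 1 :: bit)"
proof -
  interpret G: group "mult_of R" by (rule mult_of_group)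
  interpret H: subgroup H "mult_of R" by (rule H)
  have 1: "a \<otimes> b \<in> H" if "a \<in> H" "b \<in> H" for a b using H.m_closed[OF that] by simp
  have 2: "a \<otimes> b \<in> H" if "a \<in> carrier R" "b \<in> carrier R" "a \<noteq> \<zero>" "b \<noteq> \<zero>" "a \<notin> H" "b \<notin> H" for a b
    using G.index_two_mult[OF H two, of a b] that by simp
  have 3: "b \<in> H" if "a \<in> H" "a \<otimes> b \<in> H" "b \<in> carrier R" "b \<noteq> \<zero>" for a b
  proof -
    have a: "a \<in> carrier (mult_of R)" using H.mem_carrier that by blast
    have "inv\<^bsub>mult_of R\<^esub> a \<otimes> (a \<otimes> b) \<in> H" using 1 H.m_inv_closed that by blast
    also have "inv\<^bsub>mult_of R\<^esub> a \<otimes> (a \<otimes> b) = b"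
      using a that by (simp add: inv_mult_of m_assoc[symmetric] inv_skew)
    finally show ?thesis .
  qed
  have 4: "a \<in> H" if "b \<in> H" "a \<otimes> b \<in> H" "a \<in> carrier R" "a \<noteq> \<zero>" for a b
  proof -
    have b: "b \<in> carrier (mult_of R)" using H.mem_carrier that by blast
    have "(a \<otimes> b) \<otimes> inv\<^bsub>mult_of R\<^esub> b \<in> H" using 1 H.m_inv_closed that by blast
    also have "(a \<otimes> b) \<otimes> inv\<^bsub>mult_of R\<^esub> b = a"
      using b that by (simp add: inv_mult_of m_assoc inv_skew)
    finally show ?thesis .
  qed
  show ?thesis
  proof (intro skew_field_character.intro skew_field_character_axioms.intro skew_field_axioms)
    fix a b assume ab: "a \<in> carrier R" "b \<in> carrier R" "a \<noteq> \<zero>" "b \<noteq> \<zero>"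
    have "a \<otimes> b \<in> H \<longleftrightarrow> (a \<in> H \<longleftrightarrow> b \<in> H)"
      using 1[of a b] 2[OF ab] 3[of a b, OF _ _ ab(2,4)] 4[of b a, OF _ _ ab(1,3)] by blast
    then show "(if a \<otimes> b \<in> H then 0 else 1 :: bit) = (if a \<in> H then 0 else 1) + (if b \<in> H then 0 else 1)"
      by simp
  qed
qed

section \<open>Recognising the Hamilton quaternions\<close>

context quaternion_generators
begin

text \<open>The hypothesis makes every norm a fourth power. The generator \<open>y\<close> has norm \<open>-y\<^sup>2\<close>; writing this
  as \<open>m\<^sup>4\<close> gives \<open>i = m\<^sup>-\<^sup>2 y\<close> with \<open>i\<^sup>2 = -1\<close>. Then \<open>a + b i\<close> has norm \<open>a\<^sup>2 + b\<^sup>2\<close>, which is a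
  fourth power, and nonzero unless \<open>a = b = 0\<close> because \<open>i\<close> is not central. In particular two is
  invertible, and \<open>x\<^sub>0 = x - t / 2\<close> anticommutes with \<open>y\<close>; a multiple of it serves as \<open>j\<close>.\<close>

lemma hamilton_units:
  assumes sq: "\<And>a. a \<in> carrier R \<Longrightarrow> a \<noteq> \<zero> \<Longrightarrow>
    \<exists>f\<in>F - {\<zero>}. \<exists>q\<in>derived (mult_of R) (carrier (mult_of R)). a = q \<otimes> (f \<otimes> f)"
  shows "\<forall>a\<in>F. \<exists>b\<in>F. a = b \<otimes> b \<or> \<ominus> a = b \<otimes> b"
    and "\<forall>a\<in>F. \<forall>b\<in>F. \<exists>c\<in>F. a \<otimes> a \<oplus> b \<otimes> b = c \<otimes> c"
    and "\<forall>a\<in>F. \<forall>b\<in>F. a \<otimes> a \<oplus> b \<otimes> b = \<zero> \<longrightarrow> a = \<zero> \<and> b = \<zero>"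
    and "\<exists>i\<in>carrier R. \<exists>j\<in>carrier R. i \<otimes> i = \<ominus> \<one> \<and> j \<otimes> j = \<ominus> \<one> \<and> j \<otimes> i = \<ominus> (i \<otimes> j)"
proof -
  have fourth: "\<exists>f\<in>F. f \<noteq> \<zero> \<and> nrd z = (f \<otimes> f) \<otimes> (f \<otimes> f)" if z: "z \<in> carrier R" "z \<noteq> \<zero>" for z
  proof -
    obtain f q where f: "f \<in> F" "f \<noteq> \<zero>" and q: "q \<in> derived (mult_of R) (carrier (mult_of R))"
      and zq: "z = q \<otimes> (f \<otimes> f)" using sq[OF z] by blast
    have "nrd z = nrd q \<otimes> nrd (f \<otimes> f)"
      unfolding zq by (rule nrd_mult) (use nrd_commutators[OF q] f center_closed in auto)
    also have "\<dots> = (f \<otimes> f) \<otimes> (f \<otimes> f)"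
      using nrd_commutators[OF q] nrd_of_center[OF center_mult[OF f(1) f(1)]] center_closed[OF f(1)] by simp
    finally show ?thesis using f by blast
  qed
  have "nrd (\<zero> \<oplus> \<one> \<otimes> y) = \<zero> \<otimes> \<zero> \<oplus> \<ominus> (\<beta> \<otimes> (\<one> \<otimes> \<one>))"
    by (rule nrd_center_plane[OF center_zero center_one])
  then have nrd_y: "nrd y = \<ominus> \<beta>" using y \<beta>c by simp
  obtain m where m: "m \<in> F" "m \<noteq> \<zero>" "\<ominus> \<beta> = (m \<otimes> m) \<otimes> (m \<otimes> m)"
    using fourth[OF y y0] unfolding nrd_y by blast
  note mc = center_closed[OF m(1)]
  have mm: "m \<otimes> m \<in> F" "m \<otimes> m \<in> carrier R" "m \<otimes> m \<noteq> \<zero>" using m mc center_mult mult_nonzero by auto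
  define g where "g = inv (m \<otimes> m)"
  have g: "g \<in> F" "g \<in> carrier R" "g \<noteq> \<zero>" "g \<otimes> (m \<otimes> m) = \<one>"
    using center_inv[OF mm(1,3)] inv_skew[OF mm(2,3)] by (simp_all add: g_def)
  have gg: "(g \<otimes> g) \<otimes> (\<ominus> \<beta>) = \<one>"
  proof -
    have "(g \<otimes> g) \<otimes> (\<ominus> \<beta>) = g \<otimes> (g \<otimes> (m \<otimes> m)) \<otimes> (m \<otimes> m)"
      unfolding m(3) using g(2) mm(2) by (simp only: m_assoc m_closed)
    then show ?thesis using g mm by simp
  qed
  then have gb: "(g \<otimes> g) \<otimes> \<beta> = \<ominus> \<one>" using g \<beta>c by (metis m_closed minus_minus r_minus)
  define i where "i = g \<otimes> y"
  have i: "i \<in> carrier R" using g y by (simp add: i_def)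
  have iF: "i \<notin> F"
  proof
    assume "i \<in> F"
    then have "(m \<otimes> m) \<otimes> i \<in> F" using center_mult mm by blast
    also have "(m \<otimes> m) \<otimes> i = (g \<otimes> (m \<otimes> m)) \<otimes> y"
      using center_comm[OF g(1) mm(2)] mm(2) g(2) y by (simp add: i_def m_assoc[symmetric])
    finally show False using g(4) y yF by simp
  qed
  have ii: "i \<otimes> i = \<ominus> \<one>"
  proof -
    have "i \<otimes> i = g \<otimes> (y \<otimes> g) \<otimes> y" using g y by (simp add: i_def m_assoc)
    also have "y \<otimes> g = g \<otimes> y" by (rule center_comm[OF g(1) y])
    also have "g \<otimes> (g \<otimes> y) \<otimes> y = (g \<otimes> g) \<otimes> \<beta>" using g y by (simp add: \<beta>_def m_assoc)
    finally show ?thesis using gb by simp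
  qed
  have nrd_i: "nrd (c \<oplus> d \<otimes> i) = c \<otimes> c \<oplus> d \<otimes> d" if cd: "c \<in> F" "d \<in> F" for c d
  proof -
    note cc = cd[THEN center_closed]
    have "c \<oplus> d \<otimes> i = c \<oplus> (d \<otimes> g) \<otimes> y" using cc g y by (simp add: i_def m_assoc)
    then have "nrd (c \<oplus> d \<otimes> i) = c \<otimes> c \<oplus> \<ominus> (\<beta> \<otimes> (d \<otimes> g \<otimes> (d \<otimes> g)))"
      using nrd_center_plane[OF cd(1) center_mult[OF cd(2) g(1)]] by simp
    also have "d \<otimes> g \<otimes> (d \<otimes> g) = d \<otimes> (g \<otimes> d) \<otimes> g" using cc g by (simp add: m_assoc)
    also have "g \<otimes> d = d \<otimes> g" by (rule center_comm[OF g(1) cc(2), symmetric])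
    also have "d \<otimes> (d \<otimes> g) \<otimes> g = (d \<otimes> d) \<otimes> (g \<otimes> g)" using cc g by (simp add: m_assoc)
    also have "\<ominus> (\<beta> \<otimes> ((d \<otimes> d) \<otimes> (g \<otimes> g))) = (\<ominus> \<beta>) \<otimes> ((d \<otimes> d) \<otimes> (g \<otimes> g))"
      using cc g \<beta>c by (simp add: l_minus)
    also have "\<dots> = (d \<otimes> d) \<otimes> (g \<otimes> g) \<otimes> (\<ominus> \<beta>)"
      by (rule center_comm[OF center_minus[OF \<beta>_center], symmetric]) (use cc g in simp)
    also have "\<dots> = d \<otimes> d" using gg cc g \<beta>c by (simp add: m_assoc)
    finally show ?thesis .
  qed
  show E2: "\<forall>a\<in>F. \<forall>b\<in>F. \<exists>c\<in>F. a \<otimes> a \<oplus> b \<otimes> b = c \<otimes> c"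
  proof (intro ballI)
    fix a b assume ab: "a \<in> F" "b \<in> F"
    show "\<exists>c\<in>F. a \<otimes> a \<oplus> b \<otimes> b = c \<otimes> c"
    proof (cases "a \<oplus> b \<otimes> i = \<zero>")
      case True
      then have "a = \<zero> \<and> b = \<zero>" by (rule affine_zero[OF i iF ab])
      then show ?thesis using center_zero by (intro bexI[of _ \<zero>]) auto
    next
      case False
      then obtain f where "f \<in> F" "nrd (a \<oplus> b \<otimes> i) = (f \<otimes> f) \<otimes> (f \<otimes> f)"
        using fourth[of "a \<oplus> b \<otimes> i"] ab center_closed i by auto
      then show ?thesis using nrd_i[OF ab] center_mult by (intro bexI[of _ "f \<otimes> f"]) auto
    qed
  qed
  show E3: "\<forall>a\<in>F. \<forall>b\<in>F. a \<otimes> a \<oplus> b \<otimes> b = \<zero> \<longrightarrow> a = \<zero> \<and> b = \<zero>"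
  proof (intro ballI impI)
    fix a b assume ab: "a \<in> F" "b \<in> F" and 0: "a \<otimes> a \<oplus> b \<otimes> b = \<zero>"
    have "a \<oplus> b \<otimes> i = \<zero>"
    proof (rule ccontr)
      assume "a \<oplus> b \<otimes> i \<noteq> \<zero>"
      then obtain f where f: "f \<in> F" "f \<noteq> \<zero>" "nrd (a \<oplus> b \<otimes> i) = (f \<otimes> f) \<otimes> (f \<otimes> f)"
        using fourth[of "a \<oplus> b \<otimes> i"] ab center_closed i by auto
      then have "f \<in> carrier R" using center_closed by blast
      then have "(f \<otimes> f) \<otimes> (f \<otimes> f) \<noteq> \<zero>" using f(2) mult_nonzero by simp
      then show False using f(3) nrd_i[OF ab] 0 by simp
    qed
    then show "a = \<zero> \<and> b = \<zero>" by (rule affine_zero[OF i iF ab])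
  qed
  show "\<forall>a\<in>F. \<exists>b\<in>F. a = b \<otimes> b \<or> \<ominus> a = b \<otimes> b"
  proof
    fix a assume a: "a \<in> F"
    note ac = center_closed[OF a]
    show "\<exists>b\<in>F. a = b \<otimes> b \<or> \<ominus> a = b \<otimes> b"
    proof (cases "a = \<zero>")
      case True then show ?thesis using center_zero by (intro bexI[of _ \<zero>]) auto
    next
      case False
      then obtain f where f: "f \<in> F" "nrd a = (f \<otimes> f) \<otimes> (f \<otimes> f)" using fourth[OF ac] by blast
      note fc = center_closed[OF f(1)]
      have "(a \<ominus> f \<otimes> f) \<otimes> (a \<oplus> f \<otimes> f) = a \<otimes> a \<oplus> a \<otimes> (f \<otimes> f) \<ominus> (f \<otimes> f) \<otimes> a \<ominus> (f \<otimes> f) \<otimes> (f \<otimes> f)"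
        using ac fc by algebra
      also have "a \<otimes> (f \<otimes> f) = (f \<otimes> f) \<otimes> a" by (rule center_comm[OF center_mult[OF f(1) f(1)] ac])
      also have "a \<otimes> a = (f \<otimes> f) \<otimes> (f \<otimes> f)" using f(2) nrd_of_center[OF a] by simp
      also have "(f \<otimes> f) \<otimes> (f \<otimes> f) \<oplus> (f \<otimes> f) \<otimes> a \<ominus> (f \<otimes> f) \<otimes> a \<ominus> (f \<otimes> f) \<otimes> (f \<otimes> f) = \<zero>"
        using ac fc by algebra
      finally have "a \<ominus> f \<otimes> f = \<zero> \<or> a \<oplus> f \<otimes> f = \<zero>"
        using skew_integral[of "a \<ominus> f \<otimes> f" "a \<oplus> f \<otimes> f"] ac fc by blast
      then show ?thesis
      proof
        assume "a \<ominus> f \<otimes> f = \<zero>"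
        then show ?thesis using f ac fc by auto
      next
        assume "a \<oplus> f \<otimes> f = \<zero>"
        then have "\<ominus> a = f \<otimes> f" using ac fc by (metis a_comm m_closed minus_equality)
        then show ?thesis using f by blast
      qed
    qed
  qed
  have two: "\<one> \<oplus> \<one> \<noteq> \<zero>"
  proof
    assume "\<one> \<oplus> \<one> = \<zero>"
    then have "\<one> = \<zero>" using E3 center_one by (metis l_one one_closed)
    then show False using one_neq_zero by simp
  qed
  have tw: "\<one> \<oplus> \<one> \<in> F" "\<one> \<oplus> \<one> \<in> carrier R" using center_add[OF center_one center_one] by auto
  define h where "h = inv (\<one> \<oplus> \<one>)"
  have h: "h \<in> F" "h \<in> carrier R" "h \<otimes> (\<one> \<oplus> \<one>) = \<one>"
    using center_inv[OF tw(1) two] inv_skew[OF tw(2) two] by (simp_all add: h_def)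
  have ht: "h \<otimes> t \<oplus> h \<otimes> t = t"
  proof -
    have "h \<otimes> t \<oplus> h \<otimes> t = (h \<otimes> (\<one> \<oplus> \<one>)) \<otimes> t" using h(2) tc by algebra
    then show ?thesis using h(3) tc by simp
  qed
  define x0 where "x0 = x \<ominus> h \<otimes> t"
  have x0: "x0 \<in> carrier R" using x h tc by (simp add: x0_def)
  have htF: "h \<otimes> t \<in> F" using center_mult h t by blast
  have yx0: "y \<otimes> x0 = \<ominus> x0 \<otimes> y"
  proof -
    have "y \<otimes> x0 = y \<otimes> x \<ominus> y \<otimes> (h \<otimes> t)" unfolding x0_def using x y h tc by algebra
    also have "y \<otimes> (h \<otimes> t) = (h \<otimes> t) \<otimes> y" by (rule center_comm[OF htF y])
    also have "y \<otimes> x \<ominus> (h \<otimes> t) \<otimes> y = ((h \<otimes> t \<oplus> h \<otimes> t) \<ominus> x \<ominus> h \<otimes> t) \<otimes> y"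
      unfolding yx ht using x y h tc by algebra
    also have "\<dots> = \<ominus> x0 \<otimes> y" unfolding x0_def using x y h tc by algebra
    finally show ?thesis .
  qed
  have bx: "bar x0 = \<ominus> x0" by (rule bar_eqI) (use x0 yx0 in auto)
  have x0K: "x0 \<in> K"
    unfolding x0_def minus_eq using K_ops F_K[OF htF] x by (simp add: centralizer_of_def[of x] centralizer_sub)
  have x00: "x0 \<noteq> \<zero>"
  proof
    assume "x0 = \<zero>"
    then have "x = h \<otimes> t" using x h tc by (simp add: x0_def)
    then show False using xF htF by simp
  qed
  obtain r where r: "r \<in> F" "r \<noteq> \<zero>" "nrd x0 = (r \<otimes> r) \<otimes> (r \<otimes> r)" using fourth[OF x0 x00] by blast
  note rc = center_closed[OF r(1)]
  have rr: "r \<otimes> r \<in> F" "r \<otimes> r \<in> carrier R" "r \<otimes> r \<noteq> \<zero>" using r rc center_mult mult_nonzero by auto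
  define k where "k = inv (r \<otimes> r)"
  have k: "k \<in> F" "k \<in> carrier R" "k \<otimes> (r \<otimes> r) = \<one>"
    using center_inv[OF rr(1,3)] inv_skew[OF rr(2,3)] by (simp_all add: k_def)
  define j where "j = k \<otimes> x0"
  have j: "j \<in> carrier R" using k x0 by (simp add: j_def)
  have "x0 \<otimes> (\<ominus> x0) = (r \<otimes> r) \<otimes> (r \<otimes> r)" using r(3) nrd_K[OF x0K] bx by simp
  then have xx: "x0 \<otimes> x0 = \<ominus> ((r \<otimes> r) \<otimes> (r \<otimes> r))" using x0 by (metis m_closed minus_minus r_minus)
  have jj: "j \<otimes> j = \<ominus> \<one>"
  proof -
    have "j \<otimes> j = k \<otimes> (x0 \<otimes> k) \<otimes> x0" using k x0 by (simp add: j_def m_assoc)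
    also have "x0 \<otimes> k = k \<otimes> x0" by (rule center_comm[OF k(1) x0])
    also have "k \<otimes> (k \<otimes> x0) \<otimes> x0 = (k \<otimes> k) \<otimes> (x0 \<otimes> x0)" using k x0 by (simp add: m_assoc)
    also have "\<dots> = \<ominus> (k \<otimes> (k \<otimes> (r \<otimes> r)) \<otimes> (r \<otimes> r))"
      unfolding xx using k(2) rr(2) by (simp add: r_minus) (simp only: m_assoc m_closed)
    finally show ?thesis using k rr by simp
  qed
  have "j \<otimes> i = \<ominus> (i \<otimes> j)"
  proof -
    have "i \<otimes> j = g \<otimes> (y \<otimes> k) \<otimes> x0" using g k y x0 by (simp add: i_def j_def m_assoc)
    also have "y \<otimes> k = k \<otimes> y" by (rule center_comm[OF k(1) y])
    also have "g \<otimes> (k \<otimes> y) \<otimes> x0 = g \<otimes> k \<otimes> (y \<otimes> x0)" using g k y x0 by (simp add: m_assoc)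
    also have "\<dots> = \<ominus> (g \<otimes> k \<otimes> x0 \<otimes> y)" unfolding yx0 using g k y x0 by (simp add: l_minus r_minus m_assoc)
    also have "g \<otimes> k = k \<otimes> g" by (rule center_comm[OF k(1) g(2)])
    also have "k \<otimes> g \<otimes> x0 \<otimes> y = k \<otimes> (g \<otimes> x0) \<otimes> y" using g k y x0 by (simp add: m_assoc)
    also have "g \<otimes> x0 = x0 \<otimes> g" by (rule center_comm[OF g(1) x0, symmetric])
    also have "k \<otimes> (x0 \<otimes> g) \<otimes> y = j \<otimes> i" using g k y x0 by (simp add: i_def j_def m_assoc)
    finally show ?thesis using i j by simp
  qed
  then show "\<exists>i\<in>carrier R. \<exists>j\<in>carrier R. i \<otimes> i = \<ominus> \<one> \<and> j \<otimes> j = \<ominus> \<one> \<and> j \<otimes> i = \<ominus> (i \<otimes> j)"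
    using i j ii jj by blast
qed

end

context quaternion_skew_field
begin

lemma center_field: "field (R\<lparr>carrier := F\<rparr>)"
  by (rule subfield_iff(2)[OF center_subfield])

lemma center_ring_minus: "h \<in> F \<Longrightarrow> \<ominus>\<^bsub>R\<lparr>carrier := F\<rparr>\<^esub> h = \<ominus> h"
proof -
  assume h: "h \<in> F"
  interpret C: field "R\<lparr>carrier := F\<rparr>" by (rule center_field)
  show ?thesis using C.minus_equality[of "\<ominus> h" h] center_minus[OF h] h center_closed[OF h] by (simp add: l_neg)
qed

lemma euclidean_center:
  assumes "\<forall>a\<in>F. \<exists>b\<in>F. a = b \<otimes> b \<or> \<ominus> a = b \<otimes> b"
    and "\<forall>a\<in>F. \<forall>b\<in>F. \<exists>c\<in>F. a \<otimes> a \<oplus> b \<otimes> b = c \<otimes> c"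
    and "\<forall>a\<in>F. \<forall>b\<in>F. a \<otimes> a \<oplus> b \<otimes> b = \<zero> \<longrightarrow> a = \<zero> \<and> b = \<zero>"
  shows "euclidean_field (R\<lparr>carrier := F\<rparr>)"
  unfolding euclidean_field_iff[OF center_field] using assms by (simp add: center_ring_minus)

abbreviation H4 :: "('a \<times> 'a \<times> 'a \<times> 'a) ring" where
  "H4 \<equiv> quaternion_algebra (\<ominus> \<one>) (\<ominus> \<one>) (R\<lparr>carrier := F\<rparr>)"

lemma H4_mult:
  assumes "a \<in> F" "b \<in> F" "c \<in> F" "d \<in> F" "e \<in> F" "f \<in> F" "g \<in> F" "h \<in> F"
  shows "(a, b, c, d) \<otimes>\<^bsub>H4\<^esub> (e, f, g, h) =
    (a \<otimes> e \<oplus> \<ominus> (b \<otimes> f) \<oplus> \<ominus> (c \<otimes> g) \<oplus> \<ominus> (d \<otimes> h),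
     a \<otimes> f \<oplus> b \<otimes> e \<oplus> \<ominus> (d \<otimes> g) \<oplus> c \<otimes> h,
     a \<otimes> g \<oplus> c \<otimes> e \<oplus> \<ominus> (b \<otimes> h) \<oplus> d \<otimes> f,
     a \<otimes> h \<oplus> d \<otimes> e \<oplus> b \<otimes> g \<oplus> \<ominus> (c \<otimes> f))"
proof -
  note c = assms[THEN center_closed]
  have m: "u \<ominus>\<^bsub>R\<lparr>carrier := F\<rparr>\<^esub> v = u \<oplus> \<ominus> v" if "v \<in> F" for u v
    using center_ring_minus[OF that] by (simp add: a_minus_def)
  have F: "\<ominus> \<one> \<otimes> \<ominus> \<one> \<otimes> (d \<otimes> h) \<in> F" "c \<otimes> h \<in> F" "d \<otimes> f \<in> F" "c \<otimes> f \<in> F"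
    using assms center_one by (simp_all add: center_mult center_minus)
  show ?thesis
    using c F by (simp add: quaternion_algebra_def m l_minus r_minus minus_add a_assoc)
qed

lemma H4_simps:
  "carrier H4 = F \<times> F \<times> F \<times> F" "\<one>\<^bsub>H4\<^esub> = (\<one>, \<zero>, \<zero>, \<zero>)"
  "(a, b, c, d) \<oplus>\<^bsub>H4\<^esub> (e, f, g, h) = (a \<oplus> e, b \<oplus> f, c \<oplus> g, d \<oplus> h)"
  by (simp_all add: quaternion_algebra_def)

text \<open>The elements \<open>1, i, j, i j\<close> form a basis by the description of coordinates with respect to two
  noncommuting elements, and their multiplication table is that of the Hamilton quaternions.\<close>

lemma iso_hamilton:
  assumes i: "i \<in> carrier R" and j: "j \<in> carrier R"
    and ii: "i \<otimes> i = \<ominus> \<one>" and jj: "j \<otimes> j = \<ominus> \<one>" and ji: "j \<otimes> i = \<ominus> (i \<otimes> j)"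
    and two: "\<one> \<oplus> \<one> \<noteq> \<zero>"
  shows "iso_quaternion_algebra F R (\<ominus> \<one>) (\<ominus> \<one>)"
proof -
  define k where "k = i \<otimes> j"
  have k: "k \<in> carrier R" using i j by (simp add: k_def)
  have m1: "\<ominus> \<one> \<otimes> u = \<ominus> u" if "u \<in> carrier R" for u using that by (simp add: l_minus)
  have ik: "i \<otimes> k = \<ominus> j" and kj: "k \<otimes> j = \<ominus> i" and jk: "j \<otimes> k = i" and ki: "k \<otimes> i = j"
    and kk: "k \<otimes> k = \<ominus> \<one>"
  proof -
    show "i \<otimes> k = \<ominus> j" using i j ii by (simp add: k_def m_assoc[symmetric] l_minus)
    show "k \<otimes> j = \<ominus> i" using i j jj by (simp add: k_def m_assoc r_minus)
    have "j \<otimes> k = (j \<otimes> i) \<otimes> j" using i j by (simp add: k_def m_assoc)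
    also have "\<dots> = \<ominus> (i \<otimes> (j \<otimes> j))" unfolding ji using i j by (simp add: l_minus m_assoc)
    finally show jk: "j \<otimes> k = i" using i jj by (simp add: r_minus)
    have "k \<otimes> i = i \<otimes> (j \<otimes> i)" using i j by (simp add: k_def m_assoc)
    also have "\<dots> = \<ominus> ((i \<otimes> i) \<otimes> j)" unfolding ji using i j by (simp add: r_minus m_assoc)
    finally show "k \<otimes> i = j" using j ii by (simp add: l_minus)
    have "k \<otimes> k = i \<otimes> (j \<otimes> k)" using i j k by (simp add: k_def m_assoc)
    then show "k \<otimes> k = \<ominus> \<one>" using jk ii by simp
  qed
  have nc: "i \<otimes> j \<noteq> j \<otimes> i"
  proof
    assume "i \<otimes> j = j \<otimes> i"
    then have "k = \<ominus> k" using ji by (simp add: k_def)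
    then have "k \<oplus> k = \<zero>" using k by (metis r_neg)
    moreover have "k \<oplus> k = (\<one> \<oplus> \<one>) \<otimes> k" using k by (simp add: l_distr)
    ultimately have "k = \<zero>" using skew_integral[of "\<one> \<oplus> \<one>" k] two k by simp
    then have "\<one> = \<zero>" using kk by (metis minus_minus minus_zero one_closed l_null zero_closed)
    then show False using one_neq_zero by simp
  qed
  have iF: "i \<notin> F" using nc center_comm j by metis
  define \<psi> where "\<psi> = (\<lambda>(a, b, c, d). a \<oplus> b \<otimes> i \<oplus> c \<otimes> j \<oplus> d \<otimes> k)"
  have \<psi>: "\<psi> (a, b, c, d) = (a \<oplus> b \<otimes> i) \<oplus> (c \<oplus> d \<otimes> i) \<otimes> j"
    if "a \<in> F" "b \<in> F" "c \<in> F" "d \<in> F" for a b c d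
    using that[THEN center_closed] i j by (simp add: \<psi>_def k_def l_distr m_assoc a_assoc)
  have inj: "inj_on \<psi> (carrier H4)"
  proof (rule inj_onI)
    fix u v assume "u \<in> carrier H4" "v \<in> carrier H4" and eq: "\<psi> u = \<psi> v"
    then obtain a b c d e f g h where uv: "u = (a, b, c, d)" "v = (e, f, g, h)"
      and F: "a \<in> F" "b \<in> F" "c \<in> F" "d \<in> F" "e \<in> F" "f \<in> F" "g \<in> F" "h \<in> F"
      by (auto simp: H4_simps)
    note cc = F[THEN center_closed]
    have "((a \<ominus> e) \<oplus> (b \<ominus> f) \<otimes> i) \<oplus> ((c \<ominus> g) \<oplus> (d \<ominus> h) \<otimes> i) \<otimes> j
        = ((a \<oplus> b \<otimes> i) \<oplus> (c \<oplus> d \<otimes> i) \<otimes> j) \<ominus> ((e \<oplus> f \<otimes> i) \<oplus> (g \<oplus> h \<otimes> i) \<otimes> j)"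
      using cc i j by algebra
    also have "\<dots> = \<psi> u \<ominus> \<psi> v" unfolding uv using F by (simp only: \<psi>)
    also have "\<dots> = \<zero>"
    proof -
      have "\<psi> v \<in> carrier R" unfolding uv using cc i j k by (simp add: \<psi>_def)
      then show ?thesis unfolding eq by (simp add: minus_eq r_neg)
    qed
    finally have 0: "((a \<ominus> e) \<oplus> (b \<ominus> f) \<otimes> i) \<oplus> ((c \<ominus> g) \<oplus> (d \<ominus> h) \<otimes> i) \<otimes> j = \<zero>" .
    have D: "a \<ominus> e \<in> F" "b \<ominus> f \<in> F" "c \<ominus> g \<in> F" "d \<ominus> h \<in> F" using F center_sub by auto
    have "(a \<ominus> e) \<oplus> (b \<ominus> f) \<otimes> i = \<zero> \<and> (c \<ominus> g) \<oplus> (d \<ominus> h) \<otimes> i = \<zero>"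
      by (rule centralizer_pair_zero[OF i j nc affine_centralizer[OF i D(1,2)] affine_centralizer[OF i D(3,4)] 0])
    then have "a \<ominus> e = \<zero> \<and> b \<ominus> f = \<zero> \<and> c \<ominus> g = \<zero> \<and> d \<ominus> h = \<zero>"
      using affine_zero[OF i iF D(1,2)] affine_zero[OF i iF D(3,4)] by blast
    then show "u = v" using cc uv by simp
  qed
  have surj: "\<psi> ` carrier H4 = carrier R"
  proof
    show "\<psi> ` carrier H4 \<subseteq> carrier R" using i j k center_closed by (auto simp: H4_simps \<psi>_def)
    show "carrier R \<subseteq> \<psi> ` carrier H4"
    proof
      fix z assume "z \<in> carrier R"
      then obtain a b c d where F: "a \<in> F" "b \<in> F" "c \<in> F" "d \<in> F" and "z = (a \<oplus> b \<otimes> i) \<oplus> (c \<oplus> d \<otimes> i) \<otimes> j"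
        using quaternion_coordinates[OF i j nc] by blast
      then have "z = \<psi> (a, b, c, d)" using \<psi> by simp
      then show "z \<in> \<psi> ` carrier H4" using F by (auto simp: H4_simps)
    qed
  qed
  have bij: "bij_betw \<psi> (carrier H4) (carrier R)" using inj surj by (simp add: bij_betw_def)
  have mono: "(s \<otimes> u) \<otimes> (r \<otimes> v) = (s \<otimes> r) \<otimes> (u \<otimes> v)"
    if "s \<in> carrier R" "r \<in> F" "u \<in> carrier R" "v \<in> carrier R" for s r u v
  proof -
    have "(s \<otimes> u) \<otimes> (r \<otimes> v) = s \<otimes> (u \<otimes> r) \<otimes> v" using that center_closed by (simp add: m_assoc)
    also have "u \<otimes> r = r \<otimes> u" by (rule center_comm) (use that in auto)
    finally show ?thesis using that center_closed by (simp add: m_assoc)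
  qed
  have mono0: "(s \<otimes> u) \<otimes> r = (s \<otimes> r) \<otimes> u"
    if "s \<in> carrier R" "r \<in> F" "u \<in> carrier R" for s r u
    using mono[OF that one_closed] that center_closed by simp
  have mult: "\<psi> (u \<otimes>\<^bsub>H4\<^esub> v) = \<psi> u \<otimes> \<psi> v" if "u \<in> carrier H4" "v \<in> carrier H4" for u v
  proof -
    obtain a b c d e f g h where uv: "u = (a, b, c, d)" "v = (e, f, g, h)"
      and F: "a \<in> F" "b \<in> F" "c \<in> F" "d \<in> F" "e \<in> F" "f \<in> F" "g \<in> F" "h \<in> F"
      using \<open>u \<in> carrier H4\<close> \<open>v \<in> carrier H4\<close> by (auto simp: H4_simps)
    note cc = F[THEN center_closed]
    have "\<psi> u \<otimes> \<psi> v =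
      (a \<otimes> e \<oplus> (a \<otimes> f) \<otimes> i \<oplus> (a \<otimes> g) \<otimes> j \<oplus> (a \<otimes> h) \<otimes> k)
      \<oplus> ((b \<otimes> i) \<otimes> e \<oplus> (b \<otimes> i) \<otimes> (f \<otimes> i) \<oplus> (b \<otimes> i) \<otimes> (g \<otimes> j) \<oplus> (b \<otimes> i) \<otimes> (h \<otimes> k))
      \<oplus> ((c \<otimes> j) \<otimes> e \<oplus> (c \<otimes> j) \<otimes> (f \<otimes> i) \<oplus> (c \<otimes> j) \<otimes> (g \<otimes> j) \<oplus> (c \<otimes> j) \<otimes> (h \<otimes> k))
      \<oplus> ((d \<otimes> k) \<otimes> e \<oplus> (d \<otimes> k) \<otimes> (f \<otimes> i) \<oplus> (d \<otimes> k) \<otimes> (g \<otimes> j) \<oplus> (d \<otimes> k) \<otimes> (h \<otimes> k))"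
      unfolding uv \<psi>_def using cc i j k by (simp add: l_distr r_distr m_assoc a_ac)
    also have "\<dots> =
      (a \<otimes> e \<oplus> (a \<otimes> f) \<otimes> i \<oplus> (a \<otimes> g) \<otimes> j \<oplus> (a \<otimes> h) \<otimes> k)
      \<oplus> ((b \<otimes> e) \<otimes> i \<oplus> \<ominus> (b \<otimes> f) \<oplus> (b \<otimes> g) \<otimes> k \<oplus> \<ominus> (b \<otimes> h) \<otimes> j)
      \<oplus> ((c \<otimes> e) \<otimes> j \<oplus> \<ominus> (c \<otimes> f) \<otimes> k \<oplus> \<ominus> (c \<otimes> g) \<oplus> (c \<otimes> h) \<otimes> i)
      \<oplus> ((d \<otimes> e) \<otimes> k \<oplus> (d \<otimes> f) \<otimes> j \<oplus> \<ominus> (d \<otimes> g) \<otimes> i \<oplus> \<ominus> (d \<otimes> h))"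
      using cc F i j k
      by (simp add: mono mono0 ii jj kk ik kj jk ki ji k_def[symmetric] l_minus r_minus)
    also have "\<dots> = \<psi> (u \<otimes>\<^bsub>H4\<^esub> v)"
      unfolding uv H4_mult[OF F] \<psi>_def using cc i j k by (simp add: l_distr l_minus a_ac)
    finally show ?thesis ..
  qed
  have add: "\<psi> (u \<oplus>\<^bsub>H4\<^esub> v) = \<psi> u \<oplus> \<psi> v" if "u \<in> carrier H4" "v \<in> carrier H4" for u v
  proof -
    obtain a b c d e f g h where uv: "u = (a, b, c, d)" "v = (e, f, g, h)"
      and F: "a \<in> F" "b \<in> F" "c \<in> F" "d \<in> F" "e \<in> F" "f \<in> F" "g \<in> F" "h \<in> F"
      using \<open>u \<in> carrier H4\<close> \<open>v \<in> carrier H4\<close> by (auto simp: H4_simps)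
    show ?thesis unfolding uv H4_simps \<psi>_def using F[THEN center_closed] i j k
      by (simp add: l_distr a_ac)
  qed
  define \<phi> where "\<phi> = inv_into (carrier H4) \<psi>"
  have \<phi>: "\<phi> z \<in> carrier H4" "\<psi> (\<phi> z) = z" if "z \<in> carrier R" for z
    using that surj unfolding \<phi>_def by (auto intro: inv_into_into f_inv_into_f)
  have \<phi>I: "\<phi> z = u" if "u \<in> carrier H4" "\<psi> u = z" for z u
    using that inj unfolding \<phi>_def by (auto intro: inv_into_f_eq)
  have cl: "u \<otimes>\<^bsub>H4\<^esub> v \<in> carrier H4" "u \<oplus>\<^bsub>H4\<^esub> v \<in> carrier H4" if "u \<in> carrier H4" "v \<in> carrier H4" for u v
  proof -
    obtain a b c d e f g h where uv: "u = (a, b, c, d)" "v = (e, f, g, h)"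
      and F: "a \<in> F" "b \<in> F" "c \<in> F" "d \<in> F" "e \<in> F" "f \<in> F" "g \<in> F" "h \<in> F"
      using \<open>u \<in> carrier H4\<close> \<open>v \<in> carrier H4\<close> by (auto simp: H4_simps)
    show "u \<otimes>\<^bsub>H4\<^esub> v \<in> carrier H4" "u \<oplus>\<^bsub>H4\<^esub> v \<in> carrier H4"
      unfolding uv H4_mult[OF F] using F by (simp_all add: H4_simps center_add center_mult center_minus)
  qed
  have "\<phi> \<in> ring_iso R H4"
  proof (rule ring_iso_memI)
    show "bij_betw \<phi> (carrier R) (carrier H4)" unfolding \<phi>_def by (rule bij_betw_inv_into[OF bij])
    show "\<phi> \<one> = \<one>\<^bsub>H4\<^esub>"
      by (rule \<phi>I) (use center_one center_zero i j k in \<open>auto simp: H4_simps \<psi>_def\<close>)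
    fix z w assume z: "z \<in> carrier R" and w: "w \<in> carrier R"
    show "\<phi> z \<in> carrier H4" using \<phi> z by blast
    show "\<phi> (z \<otimes> w) = \<phi> z \<otimes>\<^bsub>H4\<^esub> \<phi> w" using \<phi> z w cl mult by (intro \<phi>I) auto
    show "\<phi> (z \<oplus> w) = \<phi> z \<oplus>\<^bsub>H4\<^esub> \<phi> w" using \<phi> z w cl add by (intro \<phi>I) auto
  qed
  moreover have "\<forall>c\<in>F. \<phi> c = (c, \<zero>, \<zero>, \<zero>)"
    by (intro ballI \<phi>I) (use center_zero center_closed i j k in \<open>auto simp: H4_simps \<psi>_def\<close>)
  ultimately show ?thesis unfolding iso_quaternion_algebra_def by blast
qed

lemma square_if_hamilton:
  assumes E: "euclidean_field (R\<lparr>carrier := F\<rparr>)"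
    and iso: "iso_quaternion_algebra F R (\<ominus> \<one>) (\<ominus> \<one>)" and z: "z \<in> carrier R"
  shows "\<exists>p\<in>carrier R. z = p \<otimes> p"
proof -
  obtain \<phi> where \<phi>: "\<phi> \<in> ring_iso R H4" using iso unfolding iso_quaternion_algebra_def by blast
  then have bij: "bij_betw \<phi> (carrier R) (carrier H4)" by (simp add: ring_iso_def)
  have eq: "\<ominus>\<^bsub>R\<lparr>carrier := F\<rparr>\<^esub> \<one>\<^bsub>R\<lparr>carrier := F\<rparr>\<^esub> = \<ominus> \<one>"
    using center_ring_minus[OF center_one] by simp
  have "\<phi> z \<in> carrier H4" using bij z by (auto simp: bij_betw_def)
  then obtain p' where p': "p' \<in> carrier H4" "p' \<otimes>\<^bsub>H4\<^esub> p' = \<phi> z"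
    using hamilton_square[OF E, of "\<phi> z"] unfolding eq by blast
  then obtain p where p: "p \<in> carrier R" "\<phi> p = p'"
    using bij unfolding bij_betw_def by (metis imageE)
  have "\<phi> (p \<otimes> p) = \<phi> z" using ring_iso_memE(2)[OF \<phi> p(1) p(1)] p p' by simp
  then have "p \<otimes> p = z" using bij p z by (auto simp: bij_betw_def dest: inj_onD)
  then show ?thesis using p by blast
qed

end

theorem proposition5:
  fixes Q :: "('a, 'm) ring_scheme" and F :: "'a set"
  assumes "quaternion_division_algebra F Q"
  shows "((\<nexists>H. subgroup H (Multiplicative_Group.mult_of Q) \<and>
              card (rcosets\<^bsub>Multiplicative_Group.mult_of Q\<^esub> H) = 2)
            \<longleftrightarrow> trivial_group (CK1 (matrix_ring 2 Q)))
       \<and> (trivial_group (CK1 (matrix_ring 2 Q))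
            \<longleftrightarrow> euclidean_field (Q\<lparr>carrier := F\<rparr>) \<and>
                iso_quaternion_algebra F Q (\<ominus>\<^bsub>Q\<^esub> \<one>\<^bsub>Q\<^esub>) (\<ominus>\<^bsub>Q\<^esub> \<one>\<^bsub>Q\<^esub>))"
proof -
  have "skew_field Q" and F: "F = ring_center Q" and dim: "ring.dimension Q 4 (ring_center Q) (carrier Q)"
    using assms by (auto simp: quaternion_division_algebra_def)
  interpret skew_field Q by fact
  interpret quaternion_skew_field Q using dim by unfold_locales
  interpret G: group "mult_of Q" by (rule mult_of_group)
  let ?i = "\<nexists>H. subgroup H (mult_of Q) \<and> card (rcosets\<^bsub>mult_of Q\<^esub> H) = 2"
  let ?ii = "trivial_group (CK1 (matrix_ring 2 Q))"
  let ?iii = "euclidean_field (Q\<lparr>carrier := ring_center Q\<rparr>) \<and>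
    iso_quaternion_algebra (ring_center Q) Q (\<ominus>\<^bsub>Q\<^esub> \<one>\<^bsub>Q\<^esub>) (\<ominus>\<^bsub>Q\<^esub> \<one>\<^bsub>Q\<^esub>)"
  have "?ii" if ?i
    by (rule trivial_CK1_if_central_squares[OF central_squares_if_no_index_two[OF that]])
  moreover have "?i" if ii: ?ii
  proof (rule notI)
    assume "\<exists>H. subgroup H (mult_of Q) \<and> card (rcosets\<^bsub>mult_of Q\<^esub> H) = 2"
    then obtain H where H: "subgroup H (mult_of Q)" "card (rcosets\<^bsub>mult_of Q\<^esub> H) = 2" by blast
    obtain a where "a \<in> carrier (mult_of Q)" "a \<notin> H" using G.index_two_proper[OF H] by blast
    then show False
      using character_trivial_if_trivial_CK1[OF character_of_index_two[OF H] ii, of a] by simp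
  qed
  moreover have "?iii" if i: ?i
  proof -
    obtain x y t where "x \<in> carrier Q" "y \<in> carrier Q" "t \<in> ring_center Q" "x \<otimes>\<^bsub>Q\<^esub> y \<noteq> y \<otimes>\<^bsub>Q\<^esub> x"
      "x \<otimes>\<^bsub>Q\<^esub> y = y \<otimes>\<^bsub>Q\<^esub> (t \<ominus>\<^bsub>Q\<^esub> x)" using separable_generator by blast
    then interpret quaternion_generators Q x y t by unfold_locales
    note units = hamilton_units[OF central_squares_if_no_index_two[OF i]]
    have "\<one>\<^bsub>Q\<^esub> \<oplus>\<^bsub>Q\<^esub> \<one>\<^bsub>Q\<^esub> \<noteq> \<zero>\<^bsub>Q\<^esub>"
    proof
      assume "\<one>\<^bsub>Q\<^esub> \<oplus>\<^bsub>Q\<^esub> \<one>\<^bsub>Q\<^esub> = \<zero>\<^bsub>Q\<^esub>"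
      then have "\<one>\<^bsub>Q\<^esub> = \<zero>\<^bsub>Q\<^esub>" using units(3) center_one by (metis l_one one_closed)
      then show False using one_neq_zero by simp
    qed
    then show ?thesis using euclidean_center[OF units(1,2,3)] units(4) iso_hamilton by blast
  qed
  moreover have "?i" if iii: ?iii
  proof (rule notI)
    assume "\<exists>H. subgroup H (mult_of Q) \<and> card (rcosets\<^bsub>mult_of Q\<^esub> H) = 2"
    then obtain H where H: "subgroup H (mult_of Q)" "card (rcosets\<^bsub>mult_of Q\<^esub> H) = 2" by blast
    obtain a where a: "a \<in> carrier (mult_of Q)" "a \<notin> H" using G.index_two_proper[OF H] by blast
    then obtain p where p: "p \<in> carrier Q" "a = p \<otimes>\<^bsub>Q\<^esub> p" using square_if_hamilton iii by auto
    then have "p \<in> carrier (mult_of Q)" using a by auto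
    then have "p \<otimes>\<^bsub>mult_of Q\<^esub> p \<in> H"
      using G.index_two_mult[OF H, of p p] subgroup.m_closed[OF H(1), of p p] by blast
    then show False using a p by simp
  qed
  ultimately show ?thesis unfolding F by blast
qed

end
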